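(* Let $k\in\mathbb N$ and $p\in(1,\infty)$. Then there exists a positive constant $C$ such that, for any $s\in(\frac1p,1)$ and $f\in\operatorname{BMO}\cap\dot W^{k,sp}$, $$\int_{\mathbb R^n}\int_{\mathbb R^n}\frac{|\Delta_h^kf(x)|^p}{|h|^{n+skp}}\,dh\,dx\le\frac{C}{(1-s)(sp-1)}\|f\|_{\operatorname{BMO}}^{(1-s)p}\int_{\mathbb R^n}|\nabla^kf(x)|^{sp}\,dx,$$ where $C$ is independent of $s$ and $f$.
   Context: All functions are real-valued measurable functions on $\mathbb R^n$. $\Delta_h^kf(x):=\sum_{j=0}^k(-1)^{k-j}\binom kj f(x+jh)$. $\dot W^{k,sp}$ is the set of all $f\in L^1_{\rm loc}$ whose weak derivatives $\partial^\alpha f$ exist and belong to $L^{sp}$ for all $|\alpha|=k$. $\operatorname{BMO}$ is the space of $f\in L^1_{\rm loc}$ with $\|f\|_{\operatorname{BMO}}:=\sup_Q\inf_{c\in\mathbb R}\frac1{|Q|}\int_Q|f-c|<\infty$ (supremum over all cubes). *)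

theory Defs
  imports "HOL-Analysis.Analysis"
begin

definition fin_diff :: "nat \<Rightarrow> 'a::real_vector \<Rightarrow> ('a \<Rightarrow> real) \<Rightarrow> 'a \<Rightarrow> real" where
  "fin_diff k h f x = (\<Sum>j=0..k. (-1) ^ (k - j) * real (k choose j) * f (x + real j *\<^sub>R h))"

definition L1_loc :: "('a::euclidean_space \<Rightarrow> real) set" where
  "L1_loc = {f \<in> borel_measurable lebesgue. \<forall>K. compact K \<longrightarrow> set_integrable lebesgue K f}"

definition Lp :: "real \<Rightarrow> ('a::euclidean_space \<Rightarrow> real) set" where
  "Lp q = {f \<in> borel_measurable lebesgue. integrable lebesgue (\<lambda>x. \<bar>f x\<bar> powr q)}"

definition cubes :: "(real ^ 'n) set set" where
  "cubes = {cbox a (a + (\<chi> i. l)) | a l. l > 0}"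

definition bmo_norm :: "(real ^ 'n \<Rightarrow> real) \<Rightarrow> ennreal" where
  "bmo_norm f = (SUP Q\<in>cubes. INF c.
     (\<integral>\<^sup>+x\<in>Q. ennreal \<bar>f x - c\<bar> \<partial>lebesgue) / emeasure lebesgue Q)"

definition BMO :: "(real ^ 'n \<Rightarrow> real) set" where
  "BMO = {f \<in> L1_loc. bmo_norm f < \<infinity>}"

definition partial_deriv :: "'n \<Rightarrow> (real ^ 'n \<Rightarrow> real) \<Rightarrow> real ^ 'n \<Rightarrow> real" where
  "partial_deriv i \<phi> x = frechet_derivative \<phi> (at x) (axis i 1)"

primrec iter_partial_deriv :: "'n list \<Rightarrow> (real ^ 'n \<Rightarrow> real) \<Rightarrow> real ^ 'n \<Rightarrow> real" where
  "iter_partial_deriv [] \<phi> = \<phi>"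
| "iter_partial_deriv (i # is) \<phi> = partial_deriv i (iter_partial_deriv is \<phi>)"

text \<open>Smooth functions with compact support. Differentiability of every iterated partial
  derivative makes all of them continuous, so this is \<open>C\<^sub>c\<^sup>\<infinity>\<close>.\<close>

definition test_functions :: "(real ^ 'n \<Rightarrow> real) set" where
  "test_functions = {\<phi>. (\<forall>is x. iter_partial_deriv is \<phi> differentiable (at x)) \<and>
     compact (closure {x. \<phi> x \<noteq> 0})}"

definition multi_indices :: "nat \<Rightarrow> ('n::finite \<Rightarrow> nat) set" where
  "multi_indices k = {\<alpha>. (\<Sum>i\<in>UNIV. \<alpha> i) = k}"

lemma finite_multi_indices: "finite (multi_indices k :: ('n::finite \<Rightarrow> nat) set)"
proof (rule finite_subset)
  show "multi_indices k \<subseteq> (PiE UNIV (\<lambda>_. {..k}) :: ('n \<Rightarrow> nat) set)"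
    by (auto simp: multi_indices_def intro: member_le_sum)
qed (simp add: finite_PiE)

text \<open>The derivative of a test function for the multi-index \<open>\<alpha>\<close> is taken along a list that
  contains each direction \<open>i\<close> exactly \<open>\<alpha> i\<close> times. As partial derivatives of test functions
  commute, all these lists give the same function.\<close>

definition has_weak_deriv ::
    "('n::finite \<Rightarrow> nat) \<Rightarrow> (real ^ 'n \<Rightarrow> real) \<Rightarrow> (real ^ 'n \<Rightarrow> real) \<Rightarrow> bool" where
  "has_weak_deriv \<alpha> f g \<longleftrightarrow> f \<in> L1_loc \<and> g \<in> L1_loc \<and>
     (\<forall>\<phi>\<in>test_functions. \<forall>is. (\<forall>i. count_list is i = \<alpha> i) \<longrightarrow>
        (\<integral>x. f x * iter_partial_deriv is \<phi> x \<partial>lebesgue) =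
        (-1) ^ (\<Sum>i\<in>UNIV. \<alpha> i) * (\<integral>x. g x * \<phi> x \<partial>lebesgue))"

text \<open>A representative of the weak derivative, which is unique almost everywhere; meaningful
  only where a weak derivative exists.\<close>

definition weak_deriv :: "('n::finite \<Rightarrow> nat) \<Rightarrow> (real ^ 'n \<Rightarrow> real) \<Rightarrow> real ^ 'n \<Rightarrow> real" where
  "weak_deriv \<alpha> f = (SOME g. has_weak_deriv \<alpha> f g)"

definition hom_sobolev :: "nat \<Rightarrow> real \<Rightarrow> (real ^ 'n \<Rightarrow> real) set" where
  "hom_sobolev k q = {f \<in> L1_loc. \<forall>\<alpha>\<in>multi_indices k.
     (\<exists>g. has_weak_deriv \<alpha> f g) \<and> weak_deriv \<alpha> f \<in> Lp q}"

definition norm_grad :: "nat \<Rightarrow> (real ^ 'n \<Rightarrow> real) \<Rightarrow> real ^ 'n \<Rightarrow> real" where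
  "norm_grad k f x = sqrt (\<Sum>\<alpha>\<in>multi_indices k. (weak_deriv \<alpha> f x)\<^sup>2)"

end

theory Submission
  imports Defs
begin

text \<open>
  Write \<open>f\<^sub>t\<close> for a combination of averages of \<open>f\<close> over balls of radius \<open>t, \<dots>, k t\<close>, chosen so
  that \<open>f - f\<^sub>t\<close> is (up to sign) the average of the \<open>k\<close>-th differences of \<open>f\<close> over steps in the
  ball of radius \<open>t\<close>. Split \<open>\<Delta>\<^sub>h\<^sup>k f = \<Delta>\<^sub>h\<^sup>k (f - f\<^sub>t) + \<Delta>\<^sub>h\<^sup>k f\<^sub>t\<close> with \<open>t = |h|\<close>; by translation invariance
  the first part only needs a bound for \<open>(f - f\<^sub>t) x\<close>. Let \<open>M\<close> be the maximal function of
  \<open>|\<nabla>\<^sup>k f|\<close> and \<open>N\<close> the BMO norm. Both parts are at most \<open>C t\<^sup>k M x\<close> and, for \<open>t \<ge> \<rho>\<close>, at most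
  \<open>C N (t / \<rho>)\<^sup>\<delta>\<close>, because averages of a BMO function drift only logarithmically with
  the scale; here \<open>\<rho>\<close> is given by \<open>\<rho>\<^sup>k M x = N\<close> and \<open>\<delta> = 1 / (2 p)\<close>. Integrating over \<open>h\<close> gives
  \<open>C / (1 - s) N\<^bsup>(1 - s) p\<^esup> (M x)\<^bsup>s p\<^esup>\<close>, and the maximal theorem in \<open>L\<^bsup>s p\<^esup>\<close> costs the remaining factor
  \<open>1 / (s p - 1)\<close>. The bound of \<open>\<Delta>\<^sub>h\<^sup>k f\<close> by line integrals of \<open>|\<nabla>\<^sup>k f|\<close> follows by testing the weak
  derivatives against mollifiers.
\<close>

subsection \<open>The Hardy--Littlewood maximal function\<close>

text \<open>The obstacle is that BMO controls averages and not values: the distance of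
  \<open>f x\<close> from its averages has no bound by \<open>N\<close>. At the scale
  \<open>\<rho>\<close>, however, the derivative bound is exactly of size \<open>N\<close>, and in
  passing from there to a larger scale the value \<open>f x\<close> cancels, so that only averages
  drift. The exponent \<open>\<delta>\<close> pays for the logarithm of this drift. Any
  \<open>\<delta>\<close> with \<open>\<delta> p < 1\<close> keeps the integral over large
  \<open>h\<close> convergent uniformly in \<open>s\<close>, because \<open>s k p\<close> exceeds 1;
  the choice \<open>\<delta> p = 1 / 2\<close> leaves a margin of 1/2. Hence the factor
  \<open>1 / (1 - s)\<close> arises from small \<open>h\<close> alone, where the radial integrand is
  \<open>t\<close> to the power \<open>k p (1 - s) - 1\<close>. In the estimates \<open>N\<close>
  lies strictly above the (scaled) seminorm. It is then positive, so that \<open>\<rho>\<close>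
  makes sense, and the infimum over constants in the mean oscillation is undercut by an actual
  constant. The seminorm itself is reached by a limit at the very end. Everything before that is
  done for Borel representatives on \<open>lborel\<close>, where Tonelli and affine substitutions
  apply directly.\<close>

lemma emeasure_ball_scale:
  fixes x :: "'a::euclidean_space"
  assumes "0 \<le> r"
  shows "emeasure lborel (ball x r) = ennreal (r ^ DIM('a)) * emeasure lborel (ball (0::'a) 1)"
  using emeasure_lebesgue_ball_conv_unit_ball[OF assms, of x] by simp

lemma emeasure_ball_pos:
  fixes x :: "'a::euclidean_space"
  assumes "0 < r"
  shows "0 < emeasure lborel (ball x r)"
  using content_ball_pos[OF assms, of x] emeasure_lborel_ball_finite[of x r]
  by (simp add: emeasure_eq_ennreal_measure)

text \<open>The uncentred maximal function: the balls only have to contain \<open>x\<close>. Its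
  superlevel sets are therefore unions of balls, hence open, which gives measurability for arbitrary
  \<open>g\<close> and a cover to which Vitali's lemma applies.\<close>

definition maximal :: "('a::euclidean_space \<Rightarrow> ennreal) \<Rightarrow> 'a \<Rightarrow> ennreal" where
  "maximal g x = (SUP (y, r)\<in>{(y, r). dist y x < r}.
     (\<integral>\<^sup>+z\<in>ball y r. g z \<partial>lborel) / emeasure lborel (ball y r))"

lemma set_nn_integral_le_maximal:
  assumes "dist y x < r"
  shows "(\<integral>\<^sup>+z\<in>ball y r. g z \<partial>lborel) \<le> maximal g x * emeasure lborel (ball y r)"
proof -
  have r: "0 < r" using assms by (meson dual_order.strict_trans2 zero_le_dist)
  have "(\<integral>\<^sup>+z\<in>ball y r. g z \<partial>lborel) / emeasure lborel (ball y r) \<le> maximal g x"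
    unfolding maximal_def using assms
    by (intro SUP_upper2[where i="(y, r)"]) auto
  then have "(\<integral>\<^sup>+z\<in>ball y r. g z \<partial>lborel) / emeasure lborel (ball y r) * emeasure lborel (ball y r)
      \<le> maximal g x * emeasure lborel (ball y r)"
    by (rule mult_right_mono) simp
  then show ?thesis
    using emeasure_ball_pos[OF r, of y] emeasure_lborel_ball_finite[of y r]
    by (simp add: ennreal_divide_times mult_divide_eq_ennreal)
qed

lemma maximal_superlevel:
  "{x. a < maximal g x} =
    (\<Union>(y, r)\<in>{(y, r). 0 < r \<and> a < (\<integral>\<^sup>+z\<in>ball y r. g z \<partial>lborel) / emeasure lborel (ball y r)}. ball y r)"
  unfolding maximal_def less_SUP_iff
  by (fastforce intro: le_less_trans[OF zero_le_dist])

lemma borel_measurable_maximal [measurable]: "maximal g \<in> borel_measurable borel"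
proof (rule borel_measurableI_greater)
  fix a
  have "open {x. a < maximal g x}"
    unfolding maximal_superlevel by auto
  then show "{x \<in> space borel. a < maximal g x} \<in> sets borel" by simp
qed

text \<open>Vitali covering: the superlevel set is covered by balls with
  \<open>a |B| \<le> \<integral> g\<close> over \<open>B\<close>. A disjoint subfamily still covers
  it after enlarging the radii five times, and on disjoint balls the integrals of \<open>g\<close>
  add up to at most its total integral.\<close>

lemma maximal_weak_type:
  fixes g :: "'a::euclidean_space \<Rightarrow> ennreal"
  assumes [measurable]: "g \<in> borel_measurable borel" and "0 < a"
  shows "emeasure lborel {x. ennreal a < maximal g x} \<le> ennreal (5 ^ DIM('a) / a) * (\<integral>\<^sup>+x. g x \<partial>lborel)"
proof (cases "(\<integral>\<^sup>+x. g x \<partial>lborel) = \<infinity>")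
  case True
  then show ?thesis using \<open>0 < a\<close> by (simp add: ennreal_mult_top)
next
  case False
  then obtain G where G: "(\<integral>\<^sup>+x. g x \<partial>lborel) = ennreal G" "0 \<le> G"
    by (cases "\<integral>\<^sup>+x. g x \<partial>lborel") auto
  let ?\<omega> = "measure lborel (ball (0::'a) 1)"
  have \<omega>: "0 < ?\<omega>" by (simp add: content_ball_pos)
  have em: "emeasure lborel (ball (y::'a) r) = ennreal (r ^ DIM('a) * ?\<omega>)" if "0 \<le> r" for y r
    using emeasure_ball_scale[OF that, of y] emeasure_lborel_ball_finite[of "0::'a" 1] that
    by (simp add: emeasure_eq_ennreal_measure ennreal_mult)
  define K where "K = {(y::'a, r). 0 < r \<and> ennreal a < (\<integral>\<^sup>+z\<in>ball y r. g z \<partial>lborel) / emeasure lborel (ball y r)}"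
  have K: "0 < snd i" "ennreal a * emeasure lborel (ball (fst i) (snd i)) \<le> (\<integral>\<^sup>+z\<in>ball (fst i) (snd i). g z \<partial>lborel)"
    if "i \<in> K" for i
  proof -
    show r: "0 < snd i" using that by (auto simp: K_def)
    have "ennreal a * emeasure lborel (ball (fst i) (snd i)) \<le>
       (\<integral>\<^sup>+z\<in>ball (fst i) (snd i). g z \<partial>lborel) / emeasure lborel (ball (fst i) (snd i)) * emeasure lborel (ball (fst i) (snd i))"
      using that by (intro mult_right_mono) (auto simp: K_def split: prod.splits)
    then show "ennreal a * emeasure lborel (ball (fst i) (snd i)) \<le> (\<integral>\<^sup>+z\<in>ball (fst i) (snd i). g z \<partial>lborel)"
      using emeasure_ball_pos[OF r, of "fst i"] emeasure_lborel_ball_finite[of "fst i" "snd i"]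
      by (simp add: ennreal_divide_times mult_divide_eq_ennreal)
  qed
  \<comment> \<open>The covering lemma wants bounded radii. For \<open>r > 1\<close> one has
    \<open>r \<le> r ^ n\<close>, and \<open>r ^ n\<close> is bounded by the total integral of
    \<open>g\<close>; radii up to 1 are covered by the maximum with 1.\<close>
  define B where "B = max 1 (G / (a * ?\<omega>))"
  have bd: "0 < snd i \<and> snd i \<le> B" if i: "i \<in> K" for i
  proof -
    have "ennreal a * emeasure lborel (ball (fst i) (snd i)) \<le> ennreal G"
      using K(2)[OF i] unfolding G(1)[symmetric]
      by (rule order_trans) (auto intro!: nn_integral_mono simp: indicator_def)
    then have "a * (snd i ^ DIM('a) * ?\<omega>) \<le> G"
      using K(1)[OF i] \<open>0 < a\<close> G(2) by (simp add: em ennreal_mult[symmetric] del: ennreal_mult'' )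
    then have *: "snd i ^ DIM('a) \<le> G / (a * ?\<omega>)"
      using \<omega> \<open>0 < a\<close> by (simp add: field_simps)
    show ?thesis
    proof (cases "snd i \<le> 1")
      case True then show ?thesis using K(1)[OF i] by (simp add: B_def)
    next
      case False
      then have "snd i \<le> snd i ^ DIM('a)"
        by (intro self_le_power) auto
      then show ?thesis using * K(1)[OF i] by (simp add: B_def)
    qed
  qed
  have sub: "{x. ennreal a < maximal g x} \<subseteq> (\<Union>i\<in>K. ball (fst i) (snd i))"
    unfolding maximal_superlevel K_def by auto
  obtain C where C: "countable C" "C \<subseteq> K"
      "pairwise (\<lambda>i j. disjnt (ball (fst i) (snd i)) (ball (fst j) (snd j))) C"
      "{x. ennreal a < maximal g x} \<subseteq> (\<Union>i\<in>C. ball (fst i) (5 * snd i))"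
    by (rule Vitali_covering_lemma_balls[OF sub bd])
  \<comment> \<open>The countable subfamily is indexed by naturals so that countable additivity
    applies; the sets \<open>D\<close> and \<open>D5\<close> are empty at the indices not in
    use.\<close>
  define J where "J = to_nat_on C ` C"
  have J: "from_nat_into C j \<in> C" if "j \<in> J" for j
    using that C(1) by (auto simp: J_def)
  have injJ: "inj_on (from_nat_into C) J"
    using C(1) by (auto simp: J_def inj_on_def)
  define D where "D j = (if j \<in> J then ball (fst (from_nat_into C j)) (snd (from_nat_into C j)) else {})" for j
  define D5 where "D5 j = (if j \<in> J then ball (fst (from_nat_into C j)) (5 * snd (from_nat_into C j)) else {})" for j
  have [measurable]: "D j \<in> sets borel" "D5 j \<in> sets borel" for j
    by (auto simp: D_def D5_def)
  have disj: "disjoint_family D"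
    unfolding disjoint_family_on_def
  proof (intro ballI impI)
    fix m n :: nat assume "m \<noteq> n"
    show "D m \<inter> D n = {}"
    proof (cases "m \<in> J \<and> n \<in> J")
      case True
      then have "from_nat_into C m \<noteq> from_nat_into C n"
        using injJ \<open>m \<noteq> n\<close> by (auto simp: inj_on_def)
      with pairwiseD[OF C(3) J J, of m n] True show ?thesis
        by (simp add: D_def disjnt_def)
    qed (auto simp: D_def)
  qed
  have "{x. ennreal a < maximal g x} \<subseteq> (\<Union>j. D5 j)"
  proof
    fix x assume "x \<in> {x. ennreal a < maximal g x}"
    then obtain i where i: "i \<in> C" "x \<in> ball (fst i) (5 * snd i)" using C(4) by blast
    then have "x \<in> D5 (to_nat_on C i)" using C(1) by (simp add: D5_def J_def)
    then show "x \<in> (\<Union>j. D5 j)" by blast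
  qed
  then have "emeasure lborel {x. ennreal a < maximal g x} \<le> emeasure lborel (\<Union>j. D5 j)"
    by (intro emeasure_mono) auto
  also have "\<dots> \<le> (\<Sum>j. emeasure lborel (D5 j))"
    by (intro emeasure_subadditive_countably) auto
  also have "\<dots> \<le> (\<Sum>j. ennreal (5 ^ DIM('a) / a) * (\<integral>\<^sup>+x\<in>D j. g x \<partial>lborel))"
  proof (intro suminf_le allI)
    fix j
    show "emeasure lborel (D5 j) \<le> ennreal (5 ^ DIM('a) / a) * (\<integral>\<^sup>+x\<in>D j. g x \<partial>lborel)"
    proof (cases "j \<in> J")
      case True
      let ?i = "from_nat_into C j"
      have i: "?i \<in> K" using J[OF True] C(2) by auto
      have "emeasure lborel (D5 j) = ennreal (5 ^ DIM('a) / a) * (ennreal a * emeasure lborel (ball (fst ?i) (snd ?i)))"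
        using True K(1)[OF i] \<open>0 < a\<close>
        by (simp add: D5_def em ennreal_mult'[symmetric] power_mult_distrib algebra_simps)
      also have "\<dots> \<le> ennreal (5 ^ DIM('a) / a) * (\<integral>\<^sup>+x\<in>D j. g x \<partial>lborel)"
        using K(2)[OF i] True by (intro mult_left_mono) (auto simp: D_def)
      finally show ?thesis .
    qed (simp add: D5_def)
  qed auto
  also have "\<dots> = ennreal (5 ^ DIM('a) / a) * (\<Sum>j. \<integral>\<^sup>+x\<in>D j. g x \<partial>lborel)"
    by simp
  also have "(\<Sum>j. \<integral>\<^sup>+x\<in>D j. g x \<partial>lborel) = (\<Sum>j. emeasure (density lborel g) (D j))"
    by (simp add: emeasure_density)
  also have "\<dots> = emeasure (density lborel g) (\<Union>j. D j)"
    using disj by (intro suminf_emeasure) auto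
  also have "\<dots> \<le> emeasure (density lborel g) UNIV"
    by (intro emeasure_mono) auto
  also have "\<dots> = (\<integral>\<^sup>+x. g x \<partial>lborel)"
    by (simp add: emeasure_density)
  finally show ?thesis by (simp add: mult_left_mono)
qed

lemma nn_integral_powr_0:
  assumes "-1 < b" "0 \<le> y"
  shows "(\<integral>\<^sup>+t\<in>{0<..<y}. ennreal (t powr b) \<partial>lborel) = ennreal (y powr (b + 1) / (b + 1))"
proof -
  have "((\<lambda>x. x powr b) has_integral (y powr (b + 1) / (b + 1))) {0..y}"
    using has_integral_powr_from_0[OF assms] .
  then have 1: "(\<integral>\<^sup>+t\<in>{0..y}. ennreal (t powr b) \<partial>lborel) = ennreal (y powr (b + 1) / (b + 1))"
    by (intro nn_integral_has_integral_lebesgue') auto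
  have "AE t in lborel. t \<noteq> (0::real)" "AE t in lborel. t \<noteq> (y::real)"
    by (auto intro: AE_lborel_singleton)
  then have "AE t in lborel. indicator {0<..<y} t = (indicator {0..y} t :: ennreal)"
    by eventually_elim (auto simp: indicator_def)
  then have "(\<integral>\<^sup>+t\<in>{0<..<y}. ennreal (t powr b) \<partial>lborel) = (\<integral>\<^sup>+t\<in>{0..y}. ennreal (t powr b) \<partial>lborel)"
    by (intro nn_integral_cong_AE) (auto elim!: eventually_mono)
  then show ?thesis using 1 by simp
qed

text \<open>The part of \<open>g\<close> below the level \<open>a\<close> has averages at most
  \<open>a\<close>, so only the part above \<open>a\<close> needs a maximal function.\<close>

lemma maximal_split:
  fixes g :: "'a::euclidean_space \<Rightarrow> ennreal"
  assumes [measurable]: "g \<in> borel_measurable borel"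
  shows "maximal g x \<le> maximal (\<lambda>z. g z * indicator {z. a < g z} z) x + a"
  unfolding maximal_def[of g]
proof (rule SUP_least, clarify)
  fix y :: 'a and r :: real assume d: "dist y x < r"
  have r: "0 < r" using d by (meson dual_order.strict_trans2 zero_le_dist)
  let ?e = "emeasure lborel (ball y r)"
  have [measurable]: "ball y r \<in> sets borel" by simp
  have e: "?e \<noteq> 0" "?e \<noteq> \<infinity>" using emeasure_ball_pos[OF r, of y] emeasure_lborel_ball_finite[of y r] by auto
  have "(\<integral>\<^sup>+z\<in>ball y r. g z \<partial>lborel) \<le>
     (\<integral>\<^sup>+z. g z * indicator {z. a < g z} z * indicator (ball y r) z + a * indicator (ball y r) z \<partial>lborel)"
    by (intro nn_integral_mono) (auto simp: indicator_def)
  also have "\<dots> = (\<integral>\<^sup>+z. g z * indicator {z. a < g z} z * indicator (ball y r) z \<partial>lborel) + a * ?e"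
    by (subst nn_integral_add) (auto simp: nn_integral_cmult_indicator)
  also have "\<dots> \<le> maximal (\<lambda>z. g z * indicator {z. a < g z} z) x * ?e + a * ?e"
    by (intro add_right_mono set_nn_integral_le_maximal d)
  also have "\<dots> = (maximal (\<lambda>z. g z * indicator {z. a < g z} z) x + a) * ?e"
    by (simp add: distrib_right)
  finally have "(\<integral>\<^sup>+z\<in>ball y r. g z \<partial>lborel) / ?e \<le> (maximal (\<lambda>z. g z * indicator {z. a < g z} z) x + a) * ?e / ?e"
    by (rule divide_right_mono_ennreal)
  then show "(\<integral>\<^sup>+z\<in>ball y r. g z \<partial>lborel) / ?e \<le> maximal (\<lambda>z. g z * indicator {z. a < g z} z) x + a"
    using e by (simp add: mult_divide_eq_ennreal)
qed

text \<open>Cutting at half the level: the low part contributes at most \<open>a / 2\<close>, so the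
  high part must exceed \<open>a / 2\<close>. Having only the high part on the right makes the bound
  integrable against powers of \<open>a\<close>.\<close>

lemma maximal_weak_type_trunc:
  fixes g :: "'a::euclidean_space \<Rightarrow> ennreal"
  assumes [measurable]: "g \<in> borel_measurable borel" and "0 < a"
  shows "emeasure lborel {x. ennreal a < maximal g x} \<le>
    ennreal (2 * 5 ^ DIM('a) / a) * (\<integral>\<^sup>+x. g x * indicator {x. ennreal (a / 2) < g x} x \<partial>lborel)"
proof -
  let ?g = "\<lambda>z. g z * indicator {z. ennreal (a / 2) < g z} z"
  have "{x. ennreal a < maximal g x} \<subseteq> {x. ennreal (a / 2) < maximal ?g x}"
  proof safe
    fix x assume "ennreal a < maximal g x"
    then have "ennreal (a / 2) + ennreal (a / 2) < maximal ?g x + ennreal (a / 2)"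
      using maximal_split[of g x "ennreal (a / 2)"] \<open>0 < a\<close>
      by (subst ennreal_plus[symmetric]) auto
    then show "ennreal (a / 2) < maximal ?g x"
      by (meson add_right_mono leD not_le_imp_less)
  qed
  then have "emeasure lborel {x. ennreal a < maximal g x} \<le> emeasure lborel {x. ennreal (a / 2) < maximal ?g x}"
    by (intro emeasure_mono) auto
  also have "\<dots> \<le> ennreal (5 ^ DIM('a) / (a / 2)) * (\<integral>\<^sup>+x. ?g x \<partial>lborel)"
    using \<open>0 < a\<close> by (intro maximal_weak_type) auto
  finally show ?thesis by (simp add: field_simps)
qed

text \<open>Since \<open>enn2real\<close> sends infinity to 0, later bounds for real values of the
  maximal function say something only where it is finite. For \<open>a \<ge> 2\<close>, points with
  \<open>g > a / 2\<close> satisfy \<open>g \<le> g powr q\<close>, so the set of infinite values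
  has measure at most a constant divided by \<open>a\<close>, for every such
  \<open>a\<close>.\<close>

lemma maximal_finite:
  fixes g :: "'a::euclidean_space \<Rightarrow> real"
  assumes [measurable]: "g \<in> borel_measurable borel" and g: "\<And>x. 0 \<le> g x" and "1 < q"
    and fin: "(\<integral>\<^sup>+x. ennreal (g x powr q) \<partial>lborel) < \<infinity>"
  shows "AE x in lborel. maximal (\<lambda>x. ennreal (g x)) x < \<infinity>"
proof -
  obtain I where I: "(\<integral>\<^sup>+x. ennreal (g x powr q) \<partial>lborel) = ennreal I" "0 \<le> I"
    using fin by (cases "\<integral>\<^sup>+x. ennreal (g x powr q) \<partial>lborel") auto
  let ?S = "{x. maximal (\<lambda>x. ennreal (g x)) x = \<infinity>}"
  have le: "emeasure lborel ?S \<le> ennreal (2 * 5 ^ DIM('a) * I / a)" if a: "2 \<le> a" for a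
  proof -
    have "emeasure lborel ?S \<le> emeasure lborel {x. ennreal a < maximal (\<lambda>x. ennreal (g x)) x}"
      by (intro emeasure_mono) (auto simp: less_top)
    also have "\<dots> \<le> ennreal (2 * 5 ^ DIM('a) / a) *
        (\<integral>\<^sup>+x. ennreal (g x) * indicator {x. ennreal (a / 2) < ennreal (g x)} x \<partial>lborel)"
      using a by (intro maximal_weak_type_trunc) auto
    also have "\<dots> \<le> ennreal (2 * 5 ^ DIM('a) / a) * (\<integral>\<^sup>+x. ennreal (g x powr q) \<partial>lborel)"
    proof (intro mult_left_mono nn_integral_mono)
      fix x
      show "ennreal (g x) * indicator {x. ennreal (a / 2) < ennreal (g x)} x \<le> ennreal (g x powr q)"
      proof (cases "ennreal (a / 2) < ennreal (g x)")
        case True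
        then have "1 \<le> g x" using a by (simp add: ennreal_less_iff)
        then have "g x powr 1 \<le> g x powr q" using \<open>1 < q\<close> by (intro powr_mono) auto
        then show ?thesis using \<open>1 \<le> g x\<close> by (simp add: indicator_def)
      qed auto
    qed auto
    finally show ?thesis using a I by (simp add: ennreal_mult'[symmetric])
  qed
  have "emeasure lborel ?S = 0"
  proof (rule ccontr)
    assume ne: "emeasure lborel ?S \<noteq> 0"
    have "emeasure lborel ?S < \<infinity>" using le[of 2] by (simp add: le_less_trans)
    then obtain c where c: "emeasure lborel ?S = ennreal c" "0 \<le> c"
      by (cases "emeasure lborel ?S") auto
    with ne have "0 < c" by auto
    define a where "a = max 2 (2 * 5 ^ DIM('a) * I / c + 1)"
    have a: "2 \<le> a" "2 * 5 ^ DIM('a) * I / c < a" by (auto simp: a_def)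
    have "c \<le> 2 * 5 ^ DIM('a) * I / a"
      using le[OF a(1)] c I(2) a(1) by simp
    then have "a \<le> 2 * 5 ^ DIM('a) * I / c" using a(1) \<open>0 < c\<close> by (simp add: field_simps)
    then show False using a(2) by simp
  qed
  moreover have "?S \<in> sets lborel" by measurable
  ultimately have "?S \<in> null_sets lborel" by auto
  then have "AE x in lborel. x \<notin> ?S" by (rule AE_not_in)
  then show ?thesis by eventually_elim (auto simp: less_top)
qed

text \<open>Layer cake formula, the truncated weak type bound at each level \<open>t\<close>, and
  Tonelli back. What remains is the integral of \<open>t powr (q - 2)\<close> over
  \<open>0 < t < 2 * g x\<close>; it produces the factor \<open>1 / (q - 1)\<close>, which becomes
  \<open>1 / (s p - 1)\<close> in the final estimate, and turns the factor 2 into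
  \<open>2 powr q\<close>.\<close>

theorem maximal_strong_type:
  fixes g :: "'a::euclidean_space \<Rightarrow> real"
  assumes [measurable]: "g \<in> borel_measurable borel" and g: "\<And>x. 0 \<le> g x" and "1 < q"
  shows "(\<integral>\<^sup>+x. ennreal (enn2real (maximal (\<lambda>x. ennreal (g x)) x) powr q) \<partial>lborel)
    \<le> ennreal (2 powr q * 5 ^ DIM('a) * q / (q - 1)) * (\<integral>\<^sup>+x. ennreal (g x powr q) \<partial>lborel)"
proof -
  let ?M = "\<lambda>x. enn2real (maximal (\<lambda>x. ennreal (g x)) x)"
  let ?c = "2 * 5 ^ DIM('a) * q"
  have "(\<integral>\<^sup>+x. ennreal (?M x powr q) \<partial>lborel) =
      (\<integral>\<^sup>+x. ennreal q * (\<integral>\<^sup>+t\<in>{0<..<?M x}. ennreal (t powr (q - 1)) \<partial>lborel) \<partial>lborel)"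
    using \<open>1 < q\<close> by (intro nn_integral_cong, subst nn_integral_powr_0) (auto simp: ennreal_mult'[symmetric])
  also have "\<dots> = (\<integral>\<^sup>+x. \<integral>\<^sup>+t. ennreal (q * t powr (q - 1)) * indicator {(x, t). 0 < t \<and> t < ?M x} (x, t) \<partial>lborel \<partial>lborel)"
    using \<open>1 < q\<close> by (subst nn_integral_cmult[symmetric])
      (auto intro!: nn_integral_cong simp: ennreal_mult indicator_def)
  also have "\<dots> = (\<integral>\<^sup>+t. \<integral>\<^sup>+x. ennreal (q * t powr (q - 1)) * indicator {(x, t). 0 < t \<and> t < ?M x} (x, t) \<partial>lborel \<partial>lborel)"
    by (rule lborel_pair.Fubini'[symmetric]) measurable
  also have "\<dots> \<le> (\<integral>\<^sup>+t. \<integral>\<^sup>+x. ennreal (?c * g x) * (ennreal (t powr (q - 2)) * indicator {0<..<2 * g x} t) \<partial>lborel \<partial>lborel)"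
  proof (rule nn_integral_mono)
    fix t :: real
    show "(\<integral>\<^sup>+x. ennreal (q * t powr (q - 1)) * indicator {(x, t). 0 < t \<and> t < ?M x} (x, t) \<partial>lborel)
       \<le> (\<integral>\<^sup>+x. ennreal (?c * g x) * (ennreal (t powr (q - 2)) * indicator {0<..<2 * g x} t) \<partial>lborel)"
    proof (cases "0 < t")
      case t: True
      have "(\<integral>\<^sup>+x. ennreal (q * t powr (q - 1)) * indicator {(x, t). 0 < t \<and> t < ?M x} (x, t) \<partial>lborel)
        = (\<integral>\<^sup>+x. ennreal (q * t powr (q - 1)) * indicator {x. t < ?M x} x \<partial>lborel)"
        using t by (intro nn_integral_cong) (auto simp: indicator_def)
      also have "\<dots> = ennreal (q * t powr (q - 1)) * emeasure lborel {x. t < ?M x}"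
        by (subst nn_integral_cmult_indicator) auto
      also have "\<dots> \<le> ennreal (q * t powr (q - 1)) * emeasure lborel {x. ennreal t < maximal (\<lambda>x. ennreal (g x)) x}"
      proof (intro mult_left_mono emeasure_mono subsetI CollectI)
        fix x assume "x \<in> {x. t < ?M x}"
        then show "ennreal t < maximal (\<lambda>x. ennreal (g x)) x"
          using t by (cases "maximal (\<lambda>x. ennreal (g x)) x") (auto simp: ennreal_less_iff)
      qed auto
      also have "\<dots> \<le> ennreal (q * t powr (q - 1)) * (ennreal (2 * 5 ^ DIM('a) / t) *
          (\<integral>\<^sup>+x. ennreal (g x) * indicator {x. ennreal (t / 2) < ennreal (g x)} x \<partial>lborel))"
        using t by (intro mult_left_mono maximal_weak_type_trunc) auto
      also have "\<dots> = (\<integral>\<^sup>+x. (ennreal (q * t powr (q - 1)) * ennreal (2 * 5 ^ DIM('a) / t)) *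
          (ennreal (g x) * indicator {x. ennreal (t / 2) < ennreal (g x)} x) \<partial>lborel)"
        by (simp add: mult.assoc nn_integral_cmult)
      also have "\<dots> = (\<integral>\<^sup>+x. ennreal (?c * g x) * (ennreal (t powr (q - 2)) * indicator {0<..<2 * g x} t) \<partial>lborel)"
      proof (rule nn_integral_cong)
        fix x
        have *: "t powr (q - 2) = t powr (q - 1) / t"
          using t by (simp add: powr_diff power2_eq_square)
        have "q * t powr (q - 1) * (2 * 5 ^ DIM('a) / t) = ?c * t powr (q - 2)"
          unfolding * by (simp add: field_simps)
        then show "ennreal (q * t powr (q - 1)) * ennreal (2 * 5 ^ DIM('a) / t) *
            (ennreal (g x) * indicator {x. ennreal (t / 2) < ennreal (g x)} x)
          = ennreal (?c * g x) * (ennreal (t powr (q - 2)) * indicator {0<..<2 * g x} t)"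
          using t \<open>1 < q\<close> g[of x] by (auto simp: indicator_def ennreal_mult'[symmetric] ennreal_less_iff mult_ac)
      qed
      finally show ?thesis .
    qed (simp add: indicator_def)
  qed
  also have "\<dots> = (\<integral>\<^sup>+x. \<integral>\<^sup>+t. ennreal (?c * g x) * (ennreal (t powr (q - 2)) * indicator {0<..<2 * g x} t) \<partial>lborel \<partial>lborel)"
    by (rule lborel_pair.Fubini') (unfold split_beta indicator_def greaterThanLessThan_iff, measurable)
  also have "\<dots> = (\<integral>\<^sup>+x. ennreal (2 powr q * 5 ^ DIM('a) * q / (q - 1)) * ennreal (g x powr q) \<partial>lborel)"
  proof (rule nn_integral_cong)
    fix x
    have "(\<integral>\<^sup>+t. ennreal (?c * g x) * (ennreal (t powr (q - 2)) * indicator {0<..<2 * g x} t) \<partial>lborel)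
      = ennreal (?c * g x) * ennreal ((2 * g x) powr (q - 1) / (q - 1))"
      using \<open>1 < q\<close> g[of x] by (simp add: nn_integral_cmult nn_integral_powr_0)
    also have "\<dots> = ennreal (?c * g x * ((2 * g x) powr (q - 1) / (q - 1)))"
      using g[of x] \<open>1 < q\<close> by (simp add: ennreal_mult'[symmetric])
    also have "?c * g x * ((2 * g x) powr (q - 1) / (q - 1)) = 2 powr q * 5 ^ DIM('a) * q / (q - 1) * g x powr q"
    proof (cases "g x = 0")
      case False
      then have "0 < g x" using g[of x] by simp
      then show ?thesis by (simp add: powr_mult powr_diff)
    qed simp
    finally show "(\<integral>\<^sup>+t. ennreal (?c * g x) * (ennreal (t powr (q - 2)) * indicator {0<..<2 * g x} t) \<partial>lborel)
      = ennreal (2 powr q * 5 ^ DIM('a) * q / (q - 1)) * ennreal (g x powr q)"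
      using \<open>1 < q\<close> by (simp add: ennreal_mult'[symmetric])
  qed
  also have "\<dots> = ennreal (2 powr q * 5 ^ DIM('a) * q / (q - 1)) * (\<integral>\<^sup>+x. ennreal (g x powr q) \<partial>lborel)"
    by (simp add: nn_integral_cmult)
  finally show ?thesis .
qed

subsection \<open>Radial power integrals\<close>

text \<open>Instead of polar coordinates: since \<open>\<integral> du / u = ln 2\<close> over \<open>|h| < u < 2 |h|\<close>, integrate over the
  shells \<open>u / 2 < |h| < u\<close> first and over \<open>u\<close> afterwards.\<close>

lemma nn_integral_shells:
  fixes \<phi> \<psi> :: "real \<Rightarrow> ennreal"
  assumes [measurable]: "\<phi> \<in> borel_measurable borel" "\<psi> \<in> borel_measurable borel"
    and le: "\<And>t u. 0 < u \<Longrightarrow> u / 2 < t \<Longrightarrow> t < u \<Longrightarrow> \<phi> t \<le> \<psi> u"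
  shows "ennreal (ln 2) * (\<integral>\<^sup>+h. \<phi> (norm h) \<partial>(lborel :: 'a::euclidean_space measure))
    \<le> emeasure lborel (ball (0::'a) 1) * (\<integral>\<^sup>+u\<in>{0<..}. ennreal (u powr (real DIM('a) - 1)) * \<psi> u \<partial>lborel)"
proof -
  let ?K = "\<lambda>(h::'a) u. \<phi> (norm h) * (ennreal (1 / u) * indicator {norm h<..<2 * norm h} u)"
  have log: "(\<integral>\<^sup>+u. ennreal (1 / u) * indicator {t<..<2 * t} u \<partial>lborel) = ennreal (ln 2)" if "0 < t" for t :: real
  proof -
    have "((\<lambda>x. 1 / x) has_integral (ln (2 * t) - ln t)) {t..2 * t}"
      using that by (intro fundamental_theorem_of_calculus)
        (auto intro!: derivative_eq_intros simp: has_real_derivative_iff_has_vector_derivative[symmetric])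
    moreover have "ln (2 * t) - ln t = ln 2"
      using that by (simp add: ln_mult)
    ultimately have *: "((\<lambda>x. 1 / x) has_integral (ln 2)) {t..2 * t}" by simp
    have 1: "(\<integral>\<^sup>+u. ennreal (1 / u) * indicator {t..2 * t} u \<partial>lborel) = ennreal (ln 2)"
      using that by (intro nn_integral_has_integral_lebesgue'[OF _ *]) auto
    have "AE u in lborel. u \<noteq> t" "AE u in lborel. u \<noteq> 2 * t"
      by (auto intro: AE_lborel_singleton)
    then have "AE u in lborel. indicator {t<..<2 * t} u = (indicator {t..2 * t} u :: ennreal)"
      by eventually_elim (auto simp: indicator_def)
    then have "(\<integral>\<^sup>+u. ennreal (1 / u) * indicator {t<..<2 * t} u \<partial>lborel) =
        (\<integral>\<^sup>+u. ennreal (1 / u) * indicator {t..2 * t} u \<partial>lborel)"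
      by (intro nn_integral_cong_AE) (auto elim!: eventually_mono)
    then show ?thesis using 1 by simp
  qed
  have "ennreal (ln 2) * (\<integral>\<^sup>+h. \<phi> (norm h) \<partial>(lborel :: 'a measure))
     = (\<integral>\<^sup>+h. \<phi> (norm h) * ennreal (ln 2) \<partial>(lborel :: 'a measure))"
    by (subst mult.commute, subst nn_integral_multc) auto
  also have "\<dots> = (\<integral>\<^sup>+h. \<phi> (norm h) * (\<integral>\<^sup>+u. ennreal (1 / u) * indicator {norm h<..<2 * norm h} u \<partial>lborel) \<partial>(lborel :: 'a measure))"
  proof (rule nn_integral_cong_AE)
    have "AE h in (lborel :: 'a measure). h \<noteq> 0" by (rule AE_lborel_singleton)
    then show "AE h in (lborel :: 'a measure). \<phi> (norm h) * ennreal (ln 2) =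
      \<phi> (norm h) * (\<integral>\<^sup>+u. ennreal (1 / u) * indicator {norm h<..<2 * norm h} u \<partial>lborel)"
      by eventually_elim (simp add: log)
  qed
  also have "\<dots> = (\<integral>\<^sup>+h. \<integral>\<^sup>+u. ?K h u \<partial>lborel \<partial>(lborel :: 'a measure))"
    by (intro nn_integral_cong nn_integral_cmult[symmetric]) simp
  also have "\<dots> = (\<integral>\<^sup>+u. \<integral>\<^sup>+h. ?K h u \<partial>(lborel :: 'a measure) \<partial>lborel)"
    by (rule lborel_pair.Fubini'[symmetric]) (unfold split_beta indicator_def greaterThanLessThan_iff, measurable)
  \<comment> \<open>The shell is enlarged to the whole ball of radius \<open>u\<close>. Its volume
    is proportional to \<open>u ^ n\<close>, and the weight \<open>1 / u\<close> leaves the radial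
    density \<open>u powr (n - 1)\<close>.\<close>
  also have "\<dots> \<le> (\<integral>\<^sup>+u. emeasure lborel (ball (0::'a) 1) * (ennreal (u powr (real DIM('a) - 1)) * \<psi> u * indicator {0<..} u) \<partial>lborel)"
  proof (rule nn_integral_mono)
    fix u :: real
    show "(\<integral>\<^sup>+h. ?K h u \<partial>(lborel :: 'a measure))
       \<le> emeasure lborel (ball (0::'a) 1) * (ennreal (u powr (real DIM('a) - 1)) * \<psi> u * indicator {0<..} u)"
    proof (cases "0 < u")
      case True
      have "(\<integral>\<^sup>+h. ?K h u \<partial>(lborel :: 'a measure))
        \<le> (\<integral>\<^sup>+h. (ennreal (1 / u) * \<psi> u) * indicator (ball 0 u) h \<partial>(lborel :: 'a measure))"
      proof (rule nn_integral_mono)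
        fix h :: 'a
        show "?K h u \<le> (ennreal (1 / u) * \<psi> u) * indicator (ball 0 u) h"
          using le[OF True, of "norm h"] True
          by (cases "norm h < u \<and> u / 2 < norm h") (auto simp: indicator_def mult.commute intro!: mult_right_mono)
      qed
      also have "\<dots> = (ennreal (1 / u) * \<psi> u) * (ennreal (u ^ DIM('a)) * emeasure lborel (ball (0::'a) 1))"
        using True by (subst nn_integral_cmult_indicator) (auto simp: emeasure_ball_scale[of u])
      also have "\<dots> = emeasure lborel (ball (0::'a) 1) * (ennreal (1 / u) * ennreal (u ^ DIM('a)) * \<psi> u)"
        by (simp only: mult_ac)
      also have "ennreal (1 / u) * ennreal (u ^ DIM('a)) = ennreal (u powr (real DIM('a) - 1))"
        using True by (simp add: ennreal_mult'[symmetric] powr_diff powr_realpow)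
      finally show ?thesis using True by simp
    next
      case False
      then have "indicator {norm h<..<2 * norm h} u = (0::ennreal)" for h :: 'a
        using norm_ge_zero[of h] by (auto simp: indicator_def simp del: norm_ge_zero)
      then show ?thesis by simp
    qed
  qed
  also have "\<dots> = emeasure lborel (ball (0::'a) 1) * (\<integral>\<^sup>+u\<in>{0<..}. ennreal (u powr (real DIM('a) - 1)) * \<psi> u \<partial>lborel)"
    by (rule nn_integral_cmult) measurable
  finally show ?thesis .
qed


lemma ln_2_ge_half: "1 / 2 \<le> ln (2::real)"
  using ln2_ge_two_thirds by simp

lemma le_of_ln_2_mult_le:
  assumes "ennreal (ln 2) * x \<le> ennreal c" "0 \<le> c"
  shows "x \<le> ennreal (2 * c)"
proof -
  have "ennreal 2 * ennreal (1 / 2) = 1"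
    by (subst ennreal_mult'[symmetric]) auto
  then have "x = ennreal 2 * (ennreal (1 / 2) * x)"
    by (simp only: mult.assoc[symmetric] mult_1_left)
  also have "\<dots> \<le> ennreal 2 * (ennreal (ln 2) * x)"
    by (intro mult_left_mono mult_right_mono ennreal_leI ln_2_ge_half) auto
  also have "\<dots> \<le> ennreal 2 * ennreal c"
    by (intro mult_left_mono assms) auto
  also have "\<dots> = ennreal (2 * c)"
    using assms(2) by (simp add: ennreal_mult)
  finally show ?thesis .
qed

text \<open>The pointwise bound divided by \<open>N\<close>. Inserting
  \<open>M x = N / \<rho> ^ k\<close> into \<open>t ^ k * M x / N\<close> gives the first branch;
  both branches have the value 1 at \<open>\<rho>\<close>.\<close>

definition two_scale :: "nat \<Rightarrow> real \<Rightarrow> real \<Rightarrow> real \<Rightarrow> real" where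
  "two_scale k d \<rho> t = (if t \<le> \<rho> then (t / \<rho>) ^ k else (t / \<rho>) powr d)"

lemma two_scale_nonneg: "0 < \<rho> \<Longrightarrow> 0 \<le> t \<Longrightarrow> 0 \<le> two_scale k d \<rho> t"
  by (simp add: two_scale_def)

text \<open>Needed for the shells, where the value at \<open>t\<close> has to be replaced by that at
  a larger \<open>u\<close>. When \<open>\<rho>\<close> lies between the two, the value 1 separates
  them.\<close>

lemma two_scale_mono:
  assumes "0 < \<rho>" "0 \<le> d" "0 \<le> t" "t \<le> u"
  shows "two_scale k d \<rho> t \<le> two_scale k d \<rho> u"
proof -
  have "(t / \<rho>) ^ k \<le> 1" "1 \<le> (u / \<rho>) powr d" if "t \<le> \<rho>" "\<rho> < u"
    using that assms by (auto intro: power_le_one ge_one_powr_ge_zero)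
  then show ?thesis
    using assms by (auto simp: two_scale_def intro!: power_mono powr_mono2 divide_right_mono)
qed

text \<open>Radii below \<open>\<rho>\<close> contribute \<open>1 / a\<close> and radii above
  contribute \<open>1 / b\<close>, both times the same power of \<open>\<rho>\<close>. Here
  \<open>a = k p (1 - s)\<close> is at least \<open>1 - s\<close>, while
  \<open>b = s k p - 1 / 2\<close> stays above 1/2 because the growth exponent
  \<open>1 / (2 p)\<close> becomes 1/2 after taking the \<open>p\<close>-th power. So only small
  radii feel \<open>s\<close> tending to 1. The factor 8 combines 4 for the two pieces with 2 for
  the division by \<open>ln 2\<close>.\<close>

lemma nn_integral_two_scale:
  fixes k :: nat and p s \<rho> :: real
  assumes k: "1 \<le> k" and p: "1 < p" and s: "1 / p < s" "s < 1" and \<rho>: "0 < \<rho>"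
  shows "(\<integral>\<^sup>+h. ennreal (two_scale k (1 / (2 * p)) \<rho> (norm h) powr p / norm h powr (real DIM('a) + s * real k * p))
      \<partial>(lborel :: 'a::euclidean_space measure))
    \<le> ennreal (8 * measure lborel (ball (0::'a) 1) * 2 powr (real k * p + real DIM('a)) / (1 - s) * \<rho> powr (- (s * real k * p)))"
proof -
  let ?n = "real DIM('a)" let ?\<omega> = "measure lborel (ball (0::'a) 1)"
  let ?e = "?n + s * real k * p" and ?c = "2 powr (real k * p + ?n)" and ?r = "\<rho> powr (- (s * real k * p))"
  define W where "W = two_scale k (1 / (2 * p)) \<rho>"
  define a where "a = real k * p * (1 - s)"
  define b where "b = s * real k * p - 1 / 2"
  have s0: "0 < s" using s(1) p by (meson less_trans zero_less_divide_1_iff zero_less_one)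
  have sp: "1 < s * p" using s p by (simp add: field_simps)
  have kp: "1 \<le> real k * p" using k p mult_mono[of 1 "real k" 1 p] by simp
  have "s * p * 1 \<le> s * p * real k" using sp k by (intro mult_left_mono) auto
  then have b: "1 / 2 \<le> b" using sp by (simp add: b_def mult_ac)
  have a: "1 - s \<le> a" using mult_right_mono[OF kp, of "1 - s"] s by (simp add: a_def)
  have "ennreal (ln 2) * (\<integral>\<^sup>+h. ennreal (W (norm h) powr p / norm h powr ?e) \<partial>(lborel :: 'a measure))
    \<le> emeasure lborel (ball (0::'a) 1) *
      (\<integral>\<^sup>+u\<in>{0<..}. ennreal (u powr (?n - 1)) * ennreal (?c * (W u powr p / u powr ?e)) \<partial>lborel)"
  proof (rule nn_integral_shells)
    fix t u :: real assume *: "0 < u" "u / 2 < t" "t < u"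
    have "W t powr p \<le> W u powr p"
      unfolding W_def using * p \<rho> by (intro powr_mono2 two_scale_mono two_scale_nonneg) auto
    \<comment> \<open>On a shell \<open>t\<close> exceeds \<open>u / 2\<close>, which costs
      \<open>2 powr ?e\<close>. Since \<open>s < 1\<close> this is at most \<open>?c\<close>, a
      constant free of \<open>s\<close>.\<close>
    moreover have "u powr ?e / ?c \<le> t powr ?e"
    proof -
      have "2 powr ?e \<le> ?c"
        using mult_right_mono[of s 1 "real k * p"] s kp by (intro powr_mono) (auto simp: mult_ac)
      then have "u powr ?e / ?c \<le> u powr ?e / 2 powr ?e" by (intro divide_left_mono) auto
      also have "\<dots> = (u / 2) powr ?e" using * by (simp add: powr_divide)
      also have "\<dots> \<le> t powr ?e" using * s0 p by (intro powr_mono2) auto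
      finally show ?thesis .
    qed
    ultimately have "W t powr p / t powr ?e \<le> W u powr p / (u powr ?e / ?c)"
      using * by (intro frac_le) auto
    then show "ennreal (W t powr p / t powr ?e) \<le> ennreal (?c * (W u powr p / u powr ?e))"
      by (intro ennreal_leI) (simp add: mult.commute)
  qed (simp_all add: W_def two_scale_def)
  also have "(\<integral>\<^sup>+u\<in>{0<..}. ennreal (u powr (?n - 1)) * ennreal (?c * (W u powr p / u powr ?e)) \<partial>lborel) =
    (\<integral>\<^sup>+u. ennreal (?c * \<rho> powr (- (real k * p))) * (ennreal (u powr (a - 1)) * indicator {0<..<\<rho>} u) +
      ennreal (?c * \<rho> powr (- 1 / 2)) * (ennreal (u powr (- b - 1)) * indicator {\<rho>..} u) \<partial>lborel)"
  proof (rule nn_integral_cong)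
    fix u :: real
    have exps: "u powr (?n - 1) / u powr ?e = u powr (- 1 - s * real k * p)" by (simp add: powr_diff[symmetric])
    consider "u \<le> 0" | "0 < u" "u < \<rho>" | "0 < u" "\<rho> \<le> u" by linarith
    then show "ennreal (u powr (?n - 1)) * ennreal (?c * (W u powr p / u powr ?e)) * indicator {0<..} u =
      ennreal (?c * \<rho> powr (- (real k * p))) * (ennreal (u powr (a - 1)) * indicator {0<..<\<rho>} u) +
      ennreal (?c * \<rho> powr (- 1 / 2)) * (ennreal (u powr (- b - 1)) * indicator {\<rho>..} u)"
    proof cases
      case 2
      have "W u powr p = (u / \<rho>) powr (real k * p)"
        using 2 \<rho> by (simp add: W_def two_scale_def powr_realpow[symmetric] powr_powr)
      also have "\<dots> = u powr (real k * p) * \<rho> powr (- (real k * p))"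
        using 2 \<rho> by (simp add: powr_divide powr_minus field_simps)
      finally have "W u powr p = u powr (real k * p) * \<rho> powr (- (real k * p))" .
      moreover have "u powr (a - 1) = u powr (real k * p) * (u powr (?n - 1) / u powr ?e)"
        unfolding exps by (simp add: powr_add[symmetric] a_def algebra_simps)
      ultimately show ?thesis using 2 by (simp add: ennreal_mult'[symmetric] mult_ac)
    next
      case 3
      have "W u powr p = (u / \<rho>) powr (1 / 2)"
        using 3 p \<rho> by (auto simp: W_def two_scale_def powr_powr)
      also have "\<dots> = u powr (1 / 2) * \<rho> powr (- 1 / 2)"
        using 3 \<rho> by (simp add: powr_divide powr_minus field_simps)
      finally have "W u powr p = u powr (1 / 2) * \<rho> powr (- 1 / 2)" .
      moreover have "u powr (- b - 1) = u powr (1 / 2) * (u powr (?n - 1) / u powr ?e)"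
        unfolding exps by (simp add: powr_add[symmetric] b_def algebra_simps)
      ultimately show ?thesis using 3 by (simp add: ennreal_mult'[symmetric] mult_ac)
    qed (use \<rho> in simp)
  qed
  also have "\<dots> = ennreal (?c * \<rho> powr (- (real k * p))) * ennreal (\<rho> powr a / a) + ennreal (?c * \<rho> powr (- 1 / 2)) * ennreal (\<rho> powr - b / b)"
  proof -
    have "((\<lambda>u. u powr (- b - 1)) has_integral (\<rho> powr - b / b)) {\<rho>..}"
      using has_integral_powr_to_inf[of "- b - 1" \<rho>] b \<rho> by simp
    then have "(\<integral>\<^sup>+u. ennreal (u powr (- b - 1)) * indicator {\<rho>..} u \<partial>lborel) = ennreal (\<rho> powr - b / b)"
      by (intro nn_integral_has_integral_lebesgue') auto
    then show ?thesis
      using nn_integral_powr_0[of "a - 1" \<rho>] a s \<rho> by (simp add: nn_integral_add nn_integral_cmult)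
  qed
  also have "\<dots> = ennreal (?c * ((\<rho> powr (- (real k * p)) * \<rho> powr a) / a + (\<rho> powr (- 1 / 2) * \<rho> powr - b) / b))"
    using a b s by (simp add: ennreal_mult'[symmetric] ennreal_plus[symmetric] algebra_simps del: ennreal_plus)
  also have "\<rho> powr (- (real k * p)) * \<rho> powr a = ?r"
    by (simp add: powr_add[symmetric] a_def algebra_simps)
  also have "\<rho> powr (- 1 / 2) * \<rho> powr - b = ?r"
    by (simp add: powr_add[symmetric] b_def)
  also have "emeasure lborel (ball (0::'a) 1) = ennreal ?\<omega>"
    using emeasure_lborel_ball_finite[of "0::'a" 1] by (simp add: emeasure_eq_ennreal_measure)
  also have "ennreal ?\<omega> * ennreal (?c * (?r / a + ?r / b)) \<le> ennreal (4 * ?\<omega> * ?c / (1 - s) * ?r)"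
  proof -
    have arith: "x \<le> z \<Longrightarrow> y \<le> 2 * w \<Longrightarrow> w \<le> z \<Longrightarrow> 0 \<le> w \<Longrightarrow> x + y \<le> 4 * z" for x y z w :: real
      by linarith
    have "?r / a \<le> ?r / (1 - s)" using a s by (intro divide_left_mono mult_pos_pos) auto
    moreover have "?r / b \<le> 2 * ?r" using b divide_left_mono[of "1 / 2" b ?r] by simp
    moreover have "?r \<le> ?r / (1 - s)" using s s0 by (simp add: field_simps)
    ultimately have "?r / a + ?r / b \<le> 4 * (?r / (1 - s))"
      by (rule arith) simp
    then have "?\<omega> * ?c * (?r / a + ?r / b) \<le> ?\<omega> * ?c * (4 * (?r / (1 - s)))"
      by (intro mult_left_mono) auto
    then show ?thesis
      using a b s by (subst ennreal_mult'[symmetric]) (auto intro!: ennreal_leI simp: mult_ac)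
  qed
  finally have "ennreal (ln 2) * (\<integral>\<^sup>+h. ennreal (W (norm h) powr p / norm h powr ?e) \<partial>(lborel :: 'a measure))
      \<le> ennreal (4 * ?\<omega> * ?c / (1 - s) * ?r)" by simp
  from le_of_ln_2_mult_le[OF this] show ?thesis
    using s by (simp add: W_def mult.assoc)
qed

subsection \<open>Finite differences and ball averages\<close>

lemma nn_integral_lborel_affine:
  fixes x :: "'a::euclidean_space"
  assumes [measurable]: "f \<in> borel_measurable borel" and "t \<noteq> 0"
  shows "(\<integral>\<^sup>+u. f u \<partial>lborel) = ennreal (\<bar>t\<bar> ^ DIM('a)) * (\<integral>\<^sup>+u. f (x + t *\<^sub>R u) \<partial>lborel)"
  by (subst lborel_affine[OF \<open>t \<noteq> 0\<close>, of x])
     (simp add: nn_integral_density nn_integral_distr nn_integral_cmult)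

lemma nn_integral_lborel_translate:
  fixes x :: "'a::euclidean_space"
  assumes "f \<in> borel_measurable borel"
  shows "(\<integral>\<^sup>+u. f (u + x) \<partial>lborel) = (\<integral>\<^sup>+u. f u \<partial>lborel)"
  using nn_integral_lborel_affine[OF assms, of 1 x] by (simp add: add.commute)

text \<open>Affine preimages of null sets are null. This moves an inequality valid for almost every
  step or base point to almost every point of the unit ball, at any scale \<open>t\<close>.\<close>

lemma AE_lborel_affine:
  fixes x :: "'a::euclidean_space"
  assumes "AE y in lborel. P y" and "t \<noteq> 0"
  shows "AE u in lborel. P (x + t *\<^sub>R u)"
proof -
  obtain N where N: "{y. \<not> P y} \<subseteq> N" "N \<in> null_sets lborel"
    by (rule AE_E[OF assms(1)]) (auto simp: null_sets_def)
  have [measurable]: "N \<in> sets borel" using N(2) by auto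
  have [measurable]: "(\<lambda>u. x + t *\<^sub>R u) -` N \<in> sets borel"
    using measurable_sets[of "\<lambda>u. x + t *\<^sub>R u" borel borel N] by simp
  have "(\<integral>\<^sup>+u. indicator N u \<partial>lborel) = ennreal (\<bar>t\<bar> ^ DIM('a)) * (\<integral>\<^sup>+u. indicator N (x + t *\<^sub>R u) \<partial>lborel)"
    using assms(2) by (intro nn_integral_lborel_affine) auto
  also have "(\<integral>\<^sup>+u. indicator N (x + t *\<^sub>R u) \<partial>lborel) = (\<integral>\<^sup>+u. indicator ((\<lambda>u. x + t *\<^sub>R u) -` N) u \<partial>lborel)"
    by (simp add: indicator_def)
  finally have "emeasure lborel ((\<lambda>u. x + t *\<^sub>R u) -` N) = 0"
    using N(2) assms(2) by (auto simp: null_sets_def)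
  then have "(\<lambda>u. x + t *\<^sub>R u) -` N \<in> null_sets lborel" by auto
  then have "AE u in lborel. u \<notin> (\<lambda>u. x + t *\<^sub>R u) -` N" by (rule AE_not_in)
  then show ?thesis by eventually_elim (use N(1) in auto)
qed

lemma integrable_lborel_affine:
  fixes x :: "'a::euclidean_space" and f :: "'a \<Rightarrow> real"
  assumes "integrable lborel f" and "t \<noteq> 0"
  shows "integrable lborel (\<lambda>u. f (x + t *\<^sub>R u))"
proof -
  have [measurable]: "f \<in> borel_measurable borel" using assms(1) by simp
  have "ennreal (\<bar>t\<bar> ^ DIM('a)) * (\<integral>\<^sup>+u. ennreal (norm (f (x + t *\<^sub>R u))) \<partial>lborel) < \<infinity>"
    using assms nn_integral_lborel_affine[of "\<lambda>u. ennreal (norm (f u))" t x]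
    unfolding integrable_iff_bounded by auto
  then have "(\<integral>\<^sup>+u. ennreal (norm (f (x + t *\<^sub>R u))) \<partial>lborel) < \<infinity>"
    using assms(2) by (auto simp: ennreal_mult_less_top)
  then show ?thesis by (simp add: integrable_iff_bounded)
qed

section \<open>Elementary properties of finite differences\<close>

lemma fin_diff_const:
  assumes "1 \<le> k"
  shows "fin_diff k h (\<lambda>_. c) x = 0"
proof -
  have "fin_diff k h (\<lambda>_. c) x = c * (\<Sum>j\<le>k. of_nat (k choose j) * 1 ^ j * (-1) ^ (k - j))"
    by (simp add: fin_diff_def sum_distrib_left atMost_atLeast0 mult_ac)
  also have "\<dots> = c * (1 + (-1)) ^ k" by (simp only: binomial_ring)
  finally show ?thesis using assms by simp
qed

lemma fin_diff_diff: "fin_diff k h (\<lambda>y. f y - g y) x = fin_diff k h f x - fin_diff k h g x"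
  by (simp add: fin_diff_def sum_subtractf[symmetric] algebra_simps)

lemma fin_diff_abs_le:
  assumes "\<And>j. j \<le> k \<Longrightarrow> \<bar>f (x + real j *\<^sub>R h)\<bar> \<le> c"
  shows "\<bar>fin_diff k h f x\<bar> \<le> 2 ^ k * c"
proof -
  have "\<bar>fin_diff k h f x\<bar> \<le> (\<Sum>j=0..k. real (k choose j) * c)"
    unfolding fin_diff_def
    by (rule order_trans[OF sum_abs sum_mono]) (auto simp: abs_mult power_abs intro!: mult_left_mono assms)
  also have "\<dots> = 2 ^ k * c"
    using choose_row_sum[of k]
    by (simp add: sum_distrib_right[symmetric] of_nat_sum[symmetric] atMost_atLeast0[symmetric] del: of_nat_sum)
  finally show ?thesis .
qed

lemma borel_measurable_fin_diff [measurable (raw)]: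
  fixes f :: "'a::euclidean_space \<Rightarrow> real"
  assumes [measurable]: "f \<in> borel_measurable borel" "h \<in> borel_measurable M" "x \<in> borel_measurable M"
  shows "(\<lambda>z. fin_diff k (h z) f (x z)) \<in> borel_measurable M"
  unfolding fin_diff_def by measurable

text \<open>Rescaled to the unit ball instead of integrating over \<open>ball x t\<close>: at
  \<open>t = 0\<close> this is \<open>f x\<close> itself, and measurability in \<open>x\<close> and
  \<open>t\<close> jointly is immediate.\<close>

definition ball_avg :: "('a::euclidean_space \<Rightarrow> real) \<Rightarrow> 'a \<Rightarrow> real \<Rightarrow> real" where
  "ball_avg f x t = (\<integral>u. indicator (ball 0 1) u * f (x + t *\<^sub>R u) \<partial>lborel) / measure lborel (ball (0::'a) 1)"

lemma borel_measurable_ball_avg [measurable (raw)]: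
  fixes f :: "'a::euclidean_space \<Rightarrow> real"
  assumes [measurable]: "f \<in> borel_measurable borel" "x \<in> borel_measurable M" "t \<in> borel_measurable M"
  shows "(\<lambda>z. ball_avg f (x z) (t z)) \<in> borel_measurable M"
proof -
  have [measurable]: "ball (0::'a) 1 \<in> sets borel" by simp
  show ?thesis unfolding ball_avg_def by measurable
qed

text \<open>\<open>F\<close> will be a Borel representative of the given function. Local
  integrability is stated on balls, the only sets on which averages are taken.\<close>

locale locally_integrable =
  fixes F :: "'a::euclidean_space \<Rightarrow> real" and \<omega> :: real
  defines \<omega>_def: "\<omega> \<equiv> measure lborel (ball (0::'a) 1)"
  assumes borel_F [measurable]: "F \<in> borel_measurable borel"
    and integrable_ball: "\<And>x r. integrable lborel (\<lambda>y. indicator (ball x r) y * F y)"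
begin

lemma \<omega>_pos: "0 < \<omega>"
  by (simp add: \<omega>_def content_ball_pos)

lemma emeasure_unit_ball: "emeasure lborel (ball (0::'a) 1) = ennreal \<omega>"
  using emeasure_lborel_ball_finite[of "0::'a" 1] by (simp add: \<omega>_def emeasure_eq_ennreal_measure)

lemma indicator_ball_affine:
  assumes "t \<noteq> 0"
  shows "indicator (ball x \<bar>t\<bar>) (x + t *\<^sub>R u) = (indicator (ball (0::'a) 1) u :: 'b::zero_neq_one)"
  using assms by (auto simp: indicator_def dist_norm field_simps)

lemma integrable_scaled: "integrable lborel (\<lambda>u. indicator (ball 0 1) u * F (x + t *\<^sub>R u))"
proof (cases "t = 0")
  case True
  have "integrable lborel (\<lambda>u. indicator (ball (0::'a) 1) u :: real)"
    using emeasure_lborel_ball_finite[of "0::'a" 1] by (simp add: less_top[symmetric])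
  then show ?thesis using True by simp
next
  case False
  show ?thesis
    using integrable_lborel_affine[OF integrable_ball[of x "\<bar>t\<bar>"] False, of x] False
    by (simp add: indicator_ball_affine)
qed

lemma ball_avg_0: "ball_avg F x 0 = F x"
  using \<omega>_pos by (simp add: ball_avg_def \<omega>_def[symmetric])

text \<open>One statement for two uses: a moving step at a fixed point (\<open>h = 0\<close>,
  \<open>t = 0\<close>) and a fixed step at a moving point (\<open>a = 0\<close>).\<close>

lemma integrable_scaled_fin_diff:
  "integrable lborel (\<lambda>u. indicator (ball 0 1) u * fin_diff k (a *\<^sub>R u + h) F (x + t *\<^sub>R u))"
proof -
  have "integrable lborel (\<lambda>u. \<Sum>j=0..k. (-1) ^ (k - j) * real (k choose j) *
      (indicator (ball 0 1) u * F ((x + real j *\<^sub>R h) + (t + real j * a) *\<^sub>R u)))"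
    by (intro Bochner_Integration.integrable_sum integrable_mult_right integrable_scaled)
  then show ?thesis
    by (simp add: fin_diff_def sum_distrib_left algebra_simps)
qed

text \<open>As \<open>ball_avg F x 0 = F x\<close>, the summand for \<open>j = 0\<close> is \<open>F\<close> itself, up to sign.\<close>

definition "smooth_err k x t = (\<Sum>j=0..k. (-1) ^ (k - j) * real (k choose j) * ball_avg F x (real j * t))"

lemma smooth_err_eq:
  "smooth_err k x t = (\<integral>u. indicator (ball 0 1) u * fin_diff k (t *\<^sub>R u) F x \<partial>lborel) / \<omega>"
proof -
  have "(\<integral>u. indicator (ball 0 1) u * fin_diff k (t *\<^sub>R u) F x \<partial>lborel) =
     (\<integral>u. (\<Sum>j=0..k. (-1) ^ (k - j) * real (k choose j) * (indicator (ball 0 1) u * F (x + (real j * t) *\<^sub>R u))) \<partial>lborel)"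
    by (intro Bochner_Integration.integral_cong) (auto simp: fin_diff_def sum_distrib_left algebra_simps)
  also have "\<dots> = (\<Sum>j=0..k. (-1) ^ (k - j) * real (k choose j) * (\<integral>u. indicator (ball 0 1) u * F (x + (real j * t) *\<^sub>R u) \<partial>lborel))"
    by (subst Bochner_Integration.integral_sum) (auto intro!: integrable_mult_right integrable_scaled)
  finally show ?thesis
    by (simp add: smooth_err_def ball_avg_def \<omega>_def[symmetric] sum_divide_distrib)
qed

lemma fin_diff_ball_avg:
  "fin_diff k h (\<lambda>y. ball_avg F y t) x = (\<integral>u. indicator (ball 0 1) u * fin_diff k h F (x + t *\<^sub>R u) \<partial>lborel) / \<omega>"
proof -
  have "(\<integral>u. indicator (ball 0 1) u * fin_diff k h F (x + t *\<^sub>R u) \<partial>lborel) =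
     (\<integral>u. (\<Sum>j=0..k. (-1) ^ (k - j) * real (k choose j) * (indicator (ball 0 1) u * F ((x + real j *\<^sub>R h) + t *\<^sub>R u))) \<partial>lborel)"
    by (intro Bochner_Integration.integral_cong) (auto simp: fin_diff_def sum_distrib_left algebra_simps)
  also have "\<dots> = (\<Sum>j=0..k. (-1) ^ (k - j) * real (k choose j) * (\<integral>u. indicator (ball 0 1) u * F ((x + real j *\<^sub>R h) + t *\<^sub>R u) \<partial>lborel))"
    by (subst Bochner_Integration.integral_sum) (auto intro!: integrable_mult_right integrable_scaled)
  finally show ?thesis
    by (simp add: fin_diff_def ball_avg_def \<omega>_def[symmetric] sum_divide_distrib)
qed

lemma abs_integral_le:
  assumes "integrable lborel (\<lambda>u. indicator (ball 0 1) u * f u)"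
    and "(\<integral>\<^sup>+u\<in>ball 0 1. ennreal \<bar>f u\<bar> \<partial>lborel) \<le> c * ennreal \<omega>"
  shows "ennreal \<bar>(\<integral>u. indicator (ball (0::'a) 1) u * f u \<partial>lborel) / \<omega>\<bar> \<le> c"
proof -
  have "ennreal (norm (\<integral>u. indicator (ball (0::'a) 1) u * f u \<partial>lborel)) \<le>
      (\<integral>\<^sup>+u. ennreal (norm (indicator (ball (0::'a) 1) u * f u)) \<partial>lborel)"
    by (rule integral_norm_bound_ennreal[OF assms(1)])
  also have "\<dots> = (\<integral>\<^sup>+u\<in>ball 0 1. ennreal \<bar>f u\<bar> \<partial>lborel)"
    by (intro nn_integral_cong) (auto simp: indicator_def)
  also note assms(2)
  finally have "ennreal (norm (\<integral>u. indicator (ball (0::'a) 1) u * f u \<partial>lborel)) / ennreal \<omega> \<le> c * ennreal \<omega> / ennreal \<omega>"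
    by (rule divide_right_mono_ennreal)
  then show ?thesis
    using \<omega>_pos by (simp add: mult_divide_eq_ennreal abs_divide divide_ennreal)
qed

text \<open>The \<open>j = 0\<close> summand of \<open>smooth_err\<close> is
  \<open>(-1) ^ k * F\<close>, so \<open>F\<close> is recovered from \<open>smooth_err\<close> and
  the averages of radii \<open>j * t\<close> with \<open>j \<ge> 1\<close>. The radius is a free
  parameter that the difference operator does not touch, hence it may be set to
  \<open>norm h\<close> afterwards.\<close>

lemma fin_diff_eq:
  "fin_diff k h F x = (-1) ^ k *
    (fin_diff k h (\<lambda>y. smooth_err k y t) x -
     (\<Sum>j=1..k. (-1) ^ (k - j) * real (k choose j) * fin_diff k h (\<lambda>y. ball_avg F y (real j * t)) x))"
proof -
  have "smooth_err k y t = (-1) ^ k * F y + (\<Sum>j=1..k. (-1) ^ (k - j) * real (k choose j) * ball_avg F y (real j * t))" for y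
    unfolding smooth_err_def by (subst sum.atLeast_Suc_atMost) (auto simp: ball_avg_0)
  then have "fin_diff k h (\<lambda>y. smooth_err k y t) x = (-1) ^ k * fin_diff k h F x +
     fin_diff k h (\<lambda>y. (\<Sum>j=1..k. (-1) ^ (k - j) * real (k choose j) * ball_avg F y (real j * t))) x"
    by (simp add: fin_diff_def sum.distrib[symmetric] sum_distrib_left algebra_simps)
  moreover have "fin_diff k h (\<lambda>y. (\<Sum>j=1..k. (-1) ^ (k - j) * real (k choose j) * ball_avg F y (real j * t))) x
     = (\<Sum>j=1..k. (-1) ^ (k - j) * real (k choose j) * fin_diff k h (\<lambda>y. ball_avg F y (real j * t)) x)"
    unfolding fin_diff_def sum_distrib_left by (subst sum.swap) (simp add: mult_ac)
  ultimately show ?thesis by (simp add: power_mult_distrib[symmetric] mult.assoc[symmetric])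
qed

end

text \<open>The BMO condition on balls instead of cubes, multiplied out by the volume, with the
  factor from comparing balls and cubes absorbed into \<open>N\<close>.\<close>

locale bounded_oscillation = locally_integrable F \<omega>
  for F :: "'a::euclidean_space \<Rightarrow> real" and \<omega> +
  fixes N :: real
  assumes N_pos: "0 < N"
    and oscillation: "\<And>x r. 0 < r \<Longrightarrow> \<exists>c. (\<integral>\<^sup>+y\<in>ball x r. ennreal \<bar>F y - c\<bar> \<partial>lborel) \<le> ennreal (N * r ^ DIM('a))"
begin

lemma set_nn_integral_ball_affine:
  fixes f :: "'a \<Rightarrow> ennreal"
  assumes [measurable]: "f \<in> borel_measurable borel" and "0 < s"
  shows "(\<integral>\<^sup>+z\<in>ball y s. f z \<partial>lborel) = ennreal (s ^ DIM('a)) * (\<integral>\<^sup>+u\<in>ball 0 1. f (y + s *\<^sub>R u) \<partial>lborel)"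
proof -
  have [measurable]: "ball y s \<in> sets borel" by simp
  have "(\<integral>\<^sup>+z\<in>ball y s. f z \<partial>lborel) =
      ennreal (\<bar>s\<bar> ^ DIM('a)) * (\<integral>\<^sup>+u. f (y + s *\<^sub>R u) * indicator (ball y s) (y + s *\<^sub>R u) \<partial>lborel)"
    using assms(2) by (intro nn_integral_lborel_affine) auto
  moreover have "(indicator (ball y s) (y + s *\<^sub>R u) :: ennreal) = indicator (ball 0 1) u" for u
    using indicator_ball_affine[of s y u] assms(2) by simp
  ultimately show ?thesis using assms(2) by simp
qed

text \<open>The integral of \<open>\<bar>F - c\<bar>\<close> does not decrease when the ball is
  enlarged, so a constant that is good on a large ball is good on a smaller one up to the volume
  ratio.\<close>

lemma ball_avg_near:
  assumes "0 < s" "0 < R" and sub: "ball y s \<subseteq> ball x R"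
    and c: "(\<integral>\<^sup>+z\<in>ball x R. ennreal \<bar>F z - c\<bar> \<partial>lborel) \<le> ennreal (N * R ^ DIM('a))"
  shows "\<bar>ball_avg F y s - c\<bar> \<le> N / \<omega> * (R / s) ^ DIM('a)"
proof -
  have const: "integrable lborel (\<lambda>u. indicator (ball (0::'a) 1) u * c)"
    using emeasure_lborel_ball_finite[of "0::'a" 1] by (simp add: less_top[symmetric])
  have int: "integrable lborel (\<lambda>u. indicator (ball (0::'a) 1) u * (F (y + s *\<^sub>R u) - c))"
    using Bochner_Integration.integrable_diff[OF integrable_scaled[of y s] const] by (simp add: right_diff_distrib)
  have eq: "ball_avg F y s - c = (\<integral>u. indicator (ball (0::'a) 1) u * (F (y + s *\<^sub>R u) - c) \<partial>lborel) / \<omega>"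
  proof -
    have "(\<integral>u. indicator (ball (0::'a) 1) u * (F (y + s *\<^sub>R u) - c) \<partial>lborel)
      = (\<integral>u. indicator (ball (0::'a) 1) u * F (y + s *\<^sub>R u) \<partial>lborel) - (\<integral>u. indicator (ball (0::'a) 1) u * c \<partial>lborel)"
      unfolding right_diff_distrib by (rule Bochner_Integration.integral_diff[OF integrable_scaled const])
    also have "(\<integral>u. indicator (ball (0::'a) 1) u * c \<partial>lborel) = \<omega> * c"
      by (simp add: \<omega>_def)
    finally show ?thesis using \<omega>_pos by (simp add: ball_avg_def \<omega>_def[symmetric] field_simps)
  qed
  let ?X = "\<integral>\<^sup>+u\<in>ball 0 1. ennreal \<bar>F (y + s *\<^sub>R u) - c\<bar> \<partial>lborel"
  have "ennreal (s ^ DIM('a)) * ?X = (\<integral>\<^sup>+z\<in>ball y s. ennreal \<bar>F z - c\<bar> \<partial>lborel)"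
    using assms by (intro set_nn_integral_ball_affine[symmetric]) auto
  also have "\<dots> \<le> (\<integral>\<^sup>+z\<in>ball x R. ennreal \<bar>F z - c\<bar> \<partial>lborel)"
    using sub by (intro nn_integral_mono) (auto simp: indicator_def)
  also note c
  finally have *: "ennreal (s ^ DIM('a)) * ?X \<le> ennreal (N * R ^ DIM('a))" .
  have "?X = ennreal (1 / s ^ DIM('a)) * (ennreal (s ^ DIM('a)) * ?X)"
    using assms by (simp add: mult.assoc[symmetric] ennreal_mult'[symmetric])
  also have "\<dots> \<le> ennreal (1 / s ^ DIM('a)) * ennreal (N * R ^ DIM('a))"
    using * by (intro mult_left_mono) auto
  also have "\<dots> = ennreal (N / \<omega> * (R / s) ^ DIM('a)) * ennreal \<omega>"
    using assms N_pos \<omega>_pos by (simp add: ennreal_mult'[symmetric] ennreal_mult''[symmetric] power_divide)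
  finally have "ennreal \<bar>ball_avg F y s - c\<bar> \<le> ennreal (N / \<omega> * (R / s) ^ DIM('a))"
    unfolding eq by (rule abs_integral_le[OF int])
  then show ?thesis
    using assms N_pos \<omega>_pos by (subst (asm) ennreal_le_iff) auto
qed

text \<open>Both averages are compared with the constant that belongs to the larger ball; the volume
  ratio is at most \<open>2 ^ n\<close>.\<close>

lemma ball_avg_step:
  assumes "0 < r" "r \<le> t" "t \<le> 2 * r"
  shows "\<bar>ball_avg F x t - ball_avg F x r\<bar> \<le> 2 ^ (DIM('a) + 1) * N / \<omega>"
proof -
  obtain c where c: "(\<integral>\<^sup>+y\<in>ball x t. ennreal \<bar>F y - c\<bar> \<partial>lborel) \<le> ennreal (N * t ^ DIM('a))"
    using oscillation[of t x] assms by auto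
  have "\<bar>ball_avg F x t - c\<bar> \<le> N / \<omega> * (t / t) ^ DIM('a)"
    by (rule ball_avg_near[OF _ _ _ c]) (use assms in auto)
  also have "\<dots> \<le> N / \<omega> * 2 ^ DIM('a)"
    using assms N_pos \<omega>_pos by (intro mult_left_mono) (auto intro!: one_le_power)
  finally have 1: "\<bar>ball_avg F x t - c\<bar> \<le> N / \<omega> * 2 ^ DIM('a)" .
  have "\<bar>ball_avg F x r - c\<bar> \<le> N / \<omega> * (t / r) ^ DIM('a)"
    by (rule ball_avg_near[OF _ _ _ c]) (use assms in auto)
  also have "\<dots> \<le> N / \<omega> * 2 ^ DIM('a)"
    using assms N_pos \<omega>_pos by (intro mult_left_mono power_mono) (auto simp: field_simps)
  finally have 2: "\<bar>ball_avg F x r - c\<bar> \<le> N / \<omega> * 2 ^ DIM('a)" .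
  have "2 ^ (DIM('a) + 1) * N / \<omega> = N / \<omega> * 2 ^ DIM('a) + N / \<omega> * 2 ^ DIM('a)" by simp
  with 1 2 show ?thesis by linarith
qed

lemma ball_avg_chain:
  assumes "0 < r" "r \<le> t" "t \<le> 2 ^ m * r"
  shows "\<bar>ball_avg F x t - ball_avg F x r\<bar> \<le> real m * (2 ^ (DIM('a) + 1) * N / \<omega>)"
  using assms
proof (induction m arbitrary: t)
  case (Suc m)
  let ?c = "2 ^ (DIM('a) + 1) * N / \<omega>"
  have c: "0 \<le> ?c" using N_pos \<omega>_pos by simp
  show ?case
  proof (cases "t \<le> 2 * r")
    case True
    have "\<bar>ball_avg F x t - ball_avg F x r\<bar> \<le> ?c"
      using Suc.prems True by (intro ball_avg_step) auto
    moreover have "0 \<le> real m * ?c" using c by (intro mult_nonneg_nonneg) auto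
    ultimately show ?thesis unfolding of_nat_Suc distrib_right by linarith
  next
    case False
    have 1: "\<bar>ball_avg F x (t / 2) - ball_avg F x r\<bar> \<le> real m * ?c"
      using Suc.prems False by (intro Suc.IH) auto
    have 2: "\<bar>ball_avg F x t - ball_avg F x (t / 2)\<bar> \<le> ?c"
      using Suc.prems False by (intro ball_avg_step) auto
    show ?thesis using 1 2 unfolding of_nat_Suc distrib_right by linarith
  qed
qed simp

text \<open>About \<open>log 2 (t / r)\<close> doublings lead from \<open>r\<close> to
  \<open>t\<close>. The logarithm is traded for a small power by
  \<open>d * ln y \<le> y powr d\<close>, losing \<open>2 / d\<close> because
  \<open>ln 2 \<ge> 1 / 2\<close>; the one extra step from rounding up is absorbed by
  \<open>1 \<le> y powr d\<close>.\<close>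

lemma ball_avg_growth:
  assumes "0 < r" "r \<le> t" "0 < d"
  shows "\<bar>ball_avg F x t - ball_avg F x r\<bar> \<le> 2 ^ (DIM('a) + 1) * N / \<omega> * ((1 + 2 / d) * (t / r) powr d)"
proof -
  let ?y = "t / r"
  have y: "1 \<le> ?y" using assms by simp
  define m where "m = nat \<lceil>log 2 ?y\<rceil>"
  have l0: "0 \<le> log 2 ?y" using y by simp
  have m1: "log 2 ?y \<le> real m" "real m \<le> log 2 ?y + 1"
    using l0 by (auto simp: m_def)
  have "?y = 2 powr (log 2 ?y)" using y by simp
  also have "\<dots> \<le> 2 powr real m" using m1 by (intro powr_mono) auto
  finally have "t \<le> 2 ^ m * r" using assms by (simp add: powr_realpow field_simps)
  then have "\<bar>ball_avg F x t - ball_avg F x r\<bar> \<le> real m * (2 ^ (DIM('a) + 1) * N / \<omega>)"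
    using assms by (intro ball_avg_chain) auto
  also have "\<dots> \<le> ((1 + 2 / d) * ?y powr d) * (2 ^ (DIM('a) + 1) * N / \<omega>)"
  proof (intro mult_right_mono)
    have "ln (?y powr d) \<le> ?y powr d - 1" using y by (intro ln_le_minus_one) (auto simp: powr_def)
    then have dl: "d * ln ?y \<le> ?y powr d" using y by (simp add: ln_powr)
    have "log 2 ?y = ln ?y / ln 2" by (simp add: log_def)
    also have "\<dots> \<le> ln ?y / (1 / 2)"
      using y ln_2_ge_half by (intro divide_left_mono) auto
    also have "\<dots> \<le> 2 / d * ?y powr d" using dl assms(3) by (simp add: field_simps)
    finally have "log 2 ?y \<le> 2 / d * ?y powr d" .
    moreover have "1 \<le> ?y powr d" using y assms(3) by (simp add: ge_one_powr_ge_zero)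
    ultimately show "real m \<le> (1 + 2 / d) * ?y powr d" using m1(2) unfolding distrib_right by linarith
  qed (use N_pos \<omega>_pos in auto)
  finally show ?thesis by (simp add: mult_ac)
qed

text \<open>\<open>smooth_err\<close> contains the value \<open>F x\<close>, over which BMO has no
  control, but between two scales it cancels: the \<open>j = 0\<close> summand does not depend on
  \<open>t\<close>. For \<open>j \<ge> 1\<close> the radii \<open>j * r\<close> and
  \<open>j * t\<close> have the ratio \<open>t / r\<close>. Reading the sum over \<open>j\<close> as
  a difference with step 1 at 0 reuses the bound \<open>2 ^ k\<close> for the coefficients.\<close>

lemma smooth_err_growth:
  assumes "0 < r" "r \<le> t" "0 < d"
  shows "\<bar>smooth_err k x t - smooth_err k x r\<bar> \<le> 2 ^ k * (2 ^ (DIM('a) + 1) * N / \<omega> * ((1 + 2 / d) * (t / r) powr d))"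
proof -
  have "smooth_err k x t - smooth_err k x r =
      fin_diff k 1 (\<lambda>j. ball_avg F x (j * t) - ball_avg F x (j * r)) (0::real)"
    unfolding fin_diff_diff by (simp add: fin_diff_def smooth_err_def)
  also have "\<bar>\<dots>\<bar> \<le> 2 ^ k * (2 ^ (DIM('a) + 1) * N / \<omega> * ((1 + 2 / d) * (t / r) powr d))"
  proof (rule fin_diff_abs_le)
    fix j :: nat
    show "\<bar>ball_avg F x ((0 + real j *\<^sub>R 1) * t) - ball_avg F x ((0 + real j *\<^sub>R 1) * r)\<bar>
      \<le> 2 ^ (DIM('a) + 1) * N / \<omega> * ((1 + 2 / d) * (t / r) powr d)"
    proof (cases "j = 0")
      case True
      then show ?thesis using N_pos \<omega>_pos assms by simp
    next
      case False
      then show ?thesis using ball_avg_growth[of "real j * r" "real j * t" d x] assms by simp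
    qed
  qed
  finally show ?thesis .
qed

text \<open>All balls that occur lie in the ball of radius \<open>2 * k * norm h\<close> around
  \<open>x\<close>. Subtracting the constant of that ball changes nothing, as differences of order
  at least 1 kill constants.\<close>

lemma fin_diff_ball_avg_le:
  assumes "1 \<le> j" "j \<le> k" "h \<noteq> 0"
  shows "\<bar>fin_diff k h (\<lambda>y. ball_avg F y (real j * norm h)) x\<bar> \<le> 2 ^ k * (N / \<omega> * (2 * real k) ^ DIM('a))"
proof -
  let ?R = "2 * real k * norm h"
  have R: "0 < ?R" using assms by simp
  obtain c where c: "(\<integral>\<^sup>+y\<in>ball x ?R. ennreal \<bar>F y - c\<bar> \<partial>lborel) \<le> ennreal (N * ?R ^ DIM('a))"
    using oscillation[OF R] by blast
  have "fin_diff k h (\<lambda>y. ball_avg F y (real j * norm h)) x = fin_diff k h (\<lambda>y. ball_avg F y (real j * norm h) - c) x"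
    unfolding fin_diff_diff using fin_diff_const[of k h c x] assms by simp
  also have "\<bar>\<dots>\<bar> \<le> 2 ^ k * (N / \<omega> * (2 * real k) ^ DIM('a))"
  proof (rule fin_diff_abs_le)
    fix i assume i: "i \<le> k"
    have "\<bar>ball_avg F (x + real i *\<^sub>R h) (real j * norm h) - c\<bar> \<le> N / \<omega> * (?R / (real j * norm h)) ^ DIM('a)"
    proof (rule ball_avg_near[OF _ R _ c])
      have "real i * norm h + real j * norm h \<le> real k * norm h + real k * norm h"
        using i assms by (intro add_mono mult_right_mono) auto
      then show "ball (x + real i *\<^sub>R h) (real j * norm h) \<subseteq> ball x ?R"
        by (simp add: ball_subset_ball_iff dist_norm)
    qed (use assms in auto)
    also have "?R / (real j * norm h) = 2 * real k / real j" using assms by simp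
    also have "N / \<omega> * (2 * real k / real j) ^ DIM('a) \<le> N / \<omega> * (2 * real k) ^ DIM('a)"
      using assms N_pos \<omega>_pos by (intro mult_left_mono power_mono) (auto simp: divide_le_eq mult_le_cancel_left1)
    finally show "\<bar>ball_avg F (x + real i *\<^sub>R h) (real j * norm h) - c\<bar> \<le> N / \<omega> * (2 * real k) ^ DIM('a)" .
  qed
  finally show ?thesis .
qed

end

text \<open>The whole information about derivatives is condensed in \<open>fin_diff_le\<close>, a
  \<open>k\<close>-th order mean value inequality with majorant \<open>g\<close>. Stated almost
  everywhere in the product, it can be sliced both ways: for almost every point and then almost
  every step, or the reverse.\<close>

locale diff_controlled = bounded_oscillation F \<omega> N
  for F :: "'a::euclidean_space \<Rightarrow> real" and \<omega> N +
  fixes g :: "'a \<Rightarrow> real" and k :: nat and D :: real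
  assumes borel_g [measurable]: "g \<in> borel_measurable borel"
    and g_nonneg: "\<And>x. 0 \<le> g x"
    and k_pos: "1 \<le> k" and D_pos: "0 < D"
    and fin_diff_le: "AE z in lborel \<Otimes>\<^sub>M lborel. ennreal \<bar>fin_diff k (snd z) F (fst z)\<bar> \<le>
      ennreal (D * norm (snd z) ^ k) * (\<integral>\<^sup>+\<sigma>\<in>{0..real k}. ennreal (g (fst z + \<sigma> *\<^sub>R snd z)) \<partial>lborel)"
begin

abbreviation "M \<equiv> maximal (\<lambda>x. ennreal (g x))"

lemma avg_g_le:
  assumes "0 < s" "0 < R" and sub: "ball y s \<subseteq> ball x R"
  shows "(\<integral>\<^sup>+u\<in>ball 0 1. ennreal (g (y + s *\<^sub>R u)) \<partial>lborel) \<le> M x * ennreal (\<omega> * (R / s) ^ DIM('a))"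
proof -
  let ?X = "\<integral>\<^sup>+u\<in>ball 0 1. ennreal (g (y + s *\<^sub>R u)) \<partial>lborel"
  have "ennreal (s ^ DIM('a)) * ?X = (\<integral>\<^sup>+z\<in>ball y s. ennreal (g z) \<partial>lborel)"
    using assms by (intro set_nn_integral_ball_affine[symmetric]) auto
  also have "\<dots> \<le> (\<integral>\<^sup>+z\<in>ball x R. ennreal (g z) \<partial>lborel)"
    using sub by (intro nn_integral_mono) (auto simp: indicator_def)
  also have "\<dots> \<le> M x * emeasure lborel (ball x R)"
    using assms by (intro set_nn_integral_le_maximal) auto
  also have "emeasure lborel (ball x R) = ennreal (R ^ DIM('a) * \<omega>)"
    using assms \<omega>_pos by (simp add: emeasure_ball_scale emeasure_unit_ball ennreal_mult)
  finally have *: "ennreal (s ^ DIM('a)) * ?X \<le> M x * ennreal (R ^ DIM('a) * \<omega>)" .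
  have "?X = ennreal (1 / s ^ DIM('a)) * (ennreal (s ^ DIM('a)) * ?X)"
    using assms by (simp add: mult.assoc[symmetric] ennreal_mult'[symmetric])
  also have "\<dots> \<le> ennreal (1 / s ^ DIM('a)) * (M x * ennreal (R ^ DIM('a) * \<omega>))"
    using * by (intro mult_left_mono) auto
  also have "\<dots> = M x * (ennreal (1 / s ^ DIM('a)) * ennreal (R ^ DIM('a) * \<omega>))"
    by (simp only: mult_ac)
  also have "ennreal (1 / s ^ DIM('a)) * ennreal (R ^ DIM('a) * \<omega>) = ennreal (\<omega> * (R / s) ^ DIM('a))"
    using assms \<omega>_pos by (subst ennreal_mult'[symmetric]) (auto simp: power_divide field_simps)
  finally show ?thesis .
qed

text \<open>The common pattern of the next two lemmas: a line integral in \<open>\<sigma>\<close>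
  averaged over the unit ball is estimated for each fixed \<open>\<sigma>\<close> after Tonelli. The
  value \<open>\<sigma> = 0\<close> is left out, because balls of radius proportional to
  \<open>\<sigma>\<close> degenerate there.\<close>

lemma nn_integral_ball_line_le:
  fixes G :: "real \<Rightarrow> 'a \<Rightarrow> ennreal"
  assumes [measurable]: "case_prod G \<in> borel_measurable (borel \<Otimes>\<^sub>M borel)"
    and ae: "AE u in lborel. u \<in> ball 0 1 \<longrightarrow> A u \<le> c * (\<integral>\<^sup>+\<sigma>\<in>{0..real k}. G \<sigma> u \<partial>lborel)"
    and le: "\<And>\<sigma>. 0 < \<sigma> \<Longrightarrow> \<sigma> \<le> real k \<Longrightarrow> (\<integral>\<^sup>+u\<in>ball 0 1. G \<sigma> u \<partial>lborel) \<le> B"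
  shows "(\<integral>\<^sup>+u\<in>ball 0 1. A u \<partial>lborel) \<le> c * ennreal (real k) * B"
proof -
  have [measurable]: "ball (0::'a) 1 \<in> sets borel" by simp
  let ?\<Phi> = "\<lambda>\<sigma> u. c * (indicator (ball 0 1) u * (G \<sigma> u * indicator {0..real k} \<sigma>))"
  have "(\<integral>\<^sup>+u\<in>ball 0 1. A u \<partial>lborel) \<le> (\<integral>\<^sup>+u. \<integral>\<^sup>+\<sigma>. ?\<Phi> \<sigma> u \<partial>lborel \<partial>lborel)"
  proof (rule nn_integral_mono_AE, use ae in eventually_elim)
    fix u assume "u \<in> ball 0 1 \<longrightarrow> A u \<le> c * (\<integral>\<^sup>+\<sigma>\<in>{0..real k}. G \<sigma> u \<partial>lborel)"
    then show "A u * indicator (ball 0 1) u \<le> (\<integral>\<^sup>+\<sigma>. ?\<Phi> \<sigma> u \<partial>lborel)"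
      by (cases "u \<in> ball 0 1") (simp_all add: nn_integral_cmult)
  qed
  also have "\<dots> = (\<integral>\<^sup>+\<sigma>. \<integral>\<^sup>+u. ?\<Phi> \<sigma> u \<partial>lborel \<partial>lborel)"
    by (rule lborel_pair.Fubini'[symmetric]) measurable
  also have "\<dots> \<le> (\<integral>\<^sup>+\<sigma>. (c * B) * indicator {0..real k} \<sigma> \<partial>lborel)"
  proof (rule nn_integral_mono_AE)
    have "AE \<sigma> in lborel. \<sigma> \<noteq> (0::real)" by (rule AE_lborel_singleton)
    then show "AE \<sigma> in lborel. (\<integral>\<^sup>+u. ?\<Phi> \<sigma> u \<partial>lborel) \<le> (c * B) * indicator {0..real k} \<sigma>"
    proof eventually_elim
      fix \<sigma> :: real assume "\<sigma> \<noteq> 0"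
      show "(\<integral>\<^sup>+u. ?\<Phi> \<sigma> u \<partial>lborel) \<le> (c * B) * indicator {0..real k} \<sigma>"
      proof (cases "\<sigma> \<in> {0..real k}")
        case True
        then show ?thesis
          using le[of \<sigma>] \<open>\<sigma> \<noteq> 0\<close>
          by (simp add: nn_integral_cmult mult.commute[of "indicator _ _"] mult_left_mono)
      qed simp
    qed
  qed
  also have "\<dots> = c * ennreal (real k) * B"
    by (subst nn_integral_cmult_indicator) (auto simp: mult_ac)
  finally show ?thesis .
qed

text \<open>For fixed \<open>\<sigma>\<close> the points \<open>x + \<sigma> t u\<close> fill the
  ball of radius \<open>\<sigma> t\<close> around \<open>x\<close>, and the average of
  \<open>g\<close> over it is at most \<open>M x\<close>. The exceptional set of \<open>x\<close>
  does not depend on \<open>t\<close>, since rescaling the steps keeps null sets null; this matters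
  because \<open>t\<close> becomes \<open>norm h\<close>.\<close>

lemma smooth_err_le:
  "AE x in lborel. \<forall>t>0. ennreal \<bar>smooth_err k x t\<bar> \<le> ennreal (D * real k * t ^ k) * M x"
  using lborel_pair.AE_pair[OF fin_diff_le, unfolded fst_conv snd_conv]
proof eventually_elim
  case (elim x)
  show ?case
  proof (intro allI impI)
    fix t :: real assume t: "0 < t"
    have "(\<integral>\<^sup>+u\<in>ball 0 1. ennreal \<bar>fin_diff k (t *\<^sub>R u) F x\<bar> \<partial>lborel)
      \<le> ennreal (D * t ^ k) * ennreal (real k) * (M x * ennreal \<omega>)"
    proof (rule nn_integral_ball_line_le)
      show "(\<lambda>(\<sigma>, u). ennreal (g (x + \<sigma> *\<^sub>R t *\<^sub>R u))) \<in> borel_measurable (borel \<Otimes>\<^sub>M borel)"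
        by measurable
      have "AE u in lborel. ennreal \<bar>fin_diff k (0 + t *\<^sub>R u) F x\<bar> \<le>
        ennreal (D * norm (0 + t *\<^sub>R u) ^ k) * (\<integral>\<^sup>+\<sigma>\<in>{0..real k}. ennreal (g (x + \<sigma> *\<^sub>R (0 + t *\<^sub>R u))) \<partial>lborel)"
        using t by (intro AE_lborel_affine[OF elim]) simp
      then show "AE u in lborel. u \<in> ball 0 1 \<longrightarrow> ennreal \<bar>fin_diff k (t *\<^sub>R u) F x\<bar> \<le>
        ennreal (D * t ^ k) * (\<integral>\<^sup>+\<sigma>\<in>{0..real k}. ennreal (g (x + \<sigma> *\<^sub>R t *\<^sub>R u)) \<partial>lborel)"
      proof (eventually_elim, intro impI, unfold add_0)
        fix u :: 'a
        let ?J = "\<integral>\<^sup>+\<sigma>\<in>{0..real k}. ennreal (g (x + \<sigma> *\<^sub>R t *\<^sub>R u)) \<partial>lborel"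
        assume *: "ennreal \<bar>fin_diff k (t *\<^sub>R u) F x\<bar> \<le> ennreal (D * norm (t *\<^sub>R u) ^ k) * ?J"
          and u: "u \<in> ball 0 1"
        have "norm (t *\<^sub>R u) ^ k \<le> t ^ k"
          using t u by (intro power_mono) (auto simp: mult_le_cancel_left1)
        then have "ennreal (D * norm (t *\<^sub>R u) ^ k) \<le> ennreal (D * t ^ k)"
          using D_pos by (intro ennreal_leI mult_left_mono) auto
        with * show "ennreal \<bar>fin_diff k (t *\<^sub>R u) F x\<bar> \<le> ennreal (D * t ^ k) * ?J"
          by (meson mult_right_mono order_trans zero_le)
      qed
      show "(\<integral>\<^sup>+u\<in>ball 0 1. ennreal (g (x + \<sigma> *\<^sub>R t *\<^sub>R u)) \<partial>lborel) \<le> M x * ennreal \<omega>" if "0 < \<sigma>" for \<sigma>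
        using avg_g_le[of "\<sigma> * t" "\<sigma> * t" x x] that t by simp
    qed
    also have "\<dots> = (ennreal (D * t ^ k) * ennreal (real k)) * M x * ennreal \<omega>"
      by (simp only: mult_ac)
    also have "ennreal (D * t ^ k) * ennreal (real k) = ennreal (D * real k * t ^ k)"
      using D_pos t by (subst ennreal_mult'[symmetric]) (auto simp: mult_ac)
    finally show "ennreal \<bar>smooth_err k x t\<bar> \<le> ennreal (D * real k * t ^ k) * M x"
      unfolding smooth_err_eq
      using integrable_scaled_fin_diff[of k t 0 x 0] by (intro abs_integral_le) auto
  qed
qed

text \<open>Here the step is fixed first. For almost every \<open>h\<close> the inequality holds at
  almost every base point, and averaging over base points makes it valid for every \<open>x\<close>.
  The balls of radius \<open>j * norm h\<close> around \<open>x + \<sigma> h\<close> lie in the ball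
  of radius \<open>2 * k * norm h\<close> around \<open>x\<close>.\<close>

lemma fin_diff_ball_avg_le_maximal:
  "AE h in lborel. \<forall>x. \<forall>j\<in>{1..k}. ennreal \<bar>fin_diff k h (\<lambda>y. ball_avg F y (real j * norm h)) x\<bar>
     \<le> ennreal (D * real k * (2 * real k) ^ DIM('a) * norm h ^ k) * M x"
proof -
  have "AE x in lborel. AE h in lborel. ennreal \<bar>fin_diff k h F x\<bar> \<le>
      ennreal (D * norm h ^ k) * (\<integral>\<^sup>+\<sigma>\<in>{0..real k}. ennreal (g (x + \<sigma> *\<^sub>R h)) \<partial>lborel)"
    using lborel_pair.AE_pair[OF fin_diff_le] by simp
  then have "AE h in lborel. AE x in lborel. ennreal \<bar>fin_diff k h F x\<bar> \<le>
      ennreal (D * norm h ^ k) * (\<integral>\<^sup>+\<sigma>\<in>{0..real k}. ennreal (g (x + \<sigma> *\<^sub>R h)) \<partial>lborel)"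
    by (subst (asm) lborel_pair.AE_commute) measurable
  moreover have "AE h in lborel. h \<noteq> (0::'a)" by (rule AE_lborel_singleton)
  ultimately show ?thesis
  proof eventually_elim
    case (elim h)
    show ?case
    proof (intro allI ballI)
      fix x :: 'a and j assume j: "j \<in> {1..k}"
      let ?s = "real j * norm h" and ?R = "2 * real k * norm h" and ?K = "(2 * real k) ^ DIM('a)"
      let ?c = "ennreal (D * norm h ^ k)"
      have s: "0 < ?s" "0 < ?R" using j elim by auto
      have "(\<integral>\<^sup>+u\<in>ball 0 1. ennreal \<bar>fin_diff k h F (x + ?s *\<^sub>R u)\<bar> \<partial>lborel)
        \<le> ?c * ennreal (real k) * (M x * ennreal (\<omega> * ?K))"
      proof (rule nn_integral_ball_line_le)
        show "(\<lambda>(\<sigma>, u). ennreal (g (x + \<sigma> *\<^sub>R h + ?s *\<^sub>R u))) \<in> borel_measurable (borel \<Otimes>\<^sub>M borel)"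
          by measurable
        have "?s \<noteq> 0" using s(1) by linarith
        from AE_lborel_affine[OF elim(1) this, of x]
        show "AE u in lborel. u \<in> ball 0 1 \<longrightarrow> ennreal \<bar>fin_diff k h F (x + ?s *\<^sub>R u)\<bar> \<le>
          ?c * (\<integral>\<^sup>+\<sigma>\<in>{0..real k}. ennreal (g (x + \<sigma> *\<^sub>R h + ?s *\<^sub>R u)) \<partial>lborel)"
          by eventually_elim (simp add: add_ac)
        fix \<sigma> :: real assume \<sigma>: "0 < \<sigma>" "\<sigma> \<le> real k"
        have "\<sigma> * norm h + ?s \<le> real k * norm h + real k * norm h"
          using j \<sigma> by (intro add_mono mult_right_mono) auto
        then have "(\<integral>\<^sup>+u\<in>ball 0 1. ennreal (g (x + \<sigma> *\<^sub>R h + ?s *\<^sub>R u)) \<partial>lborel) \<le> M x * ennreal (\<omega> * (?R / ?s) ^ DIM('a))"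
          using \<sigma> s by (intro avg_g_le) (auto simp: ball_subset_ball_iff dist_norm)
        also have "\<dots> \<le> M x * ennreal (\<omega> * ?K)"
          using j \<omega>_pos elim(2)
          by (intro mult_left_mono ennreal_leI power_mono) (auto simp: divide_le_eq mult_le_cancel_left1 mult_ac)
        finally show "(\<integral>\<^sup>+u\<in>ball 0 1. ennreal (g (x + \<sigma> *\<^sub>R h + ?s *\<^sub>R u)) \<partial>lborel) \<le> M x * ennreal (\<omega> * ?K)" .
      qed
      also have "\<dots> = (?c * ennreal (real k) * ennreal ?K) * M x * ennreal \<omega>"
        using \<omega>_pos by (simp add: ennreal_mult mult_ac)
      also have "?c * ennreal (real k) * ennreal ?K = ennreal (D * real k * ?K * norm h ^ k)"
        using D_pos by (subst ennreal_mult[symmetric], simp, simp, subst ennreal_mult[symmetric]) (auto simp: mult_ac)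
      finally show "ennreal \<bar>fin_diff k h (\<lambda>y. ball_avg F y ?s) x\<bar> \<le> ennreal (D * real k * ?K * norm h ^ k) * M x"
        unfolding fin_diff_ball_avg
        using integrable_scaled_fin_diff[of k 0 h x ?s] by (intro abs_integral_le) auto
    qed
  qed
qed

end

subsection \<open>The pointwise two-scale bound\<close>

text \<open>Each summand is at most the largest one, and the power of the largest is one of the
  summands on the right. This crude form covers every \<open>p \<ge> 0\<close>.\<close>

lemma powr_sum_le:
  fixes b :: "'i \<Rightarrow> real"
  assumes "finite I" "\<And>i. i \<in> I \<Longrightarrow> 0 \<le> b i" "0 \<le> p"
  shows "(\<Sum>i\<in>I. b i) powr p \<le> real (card I) powr p * (\<Sum>i\<in>I. b i powr p)"
proof (cases "I = {}")
  case False
  then have "Max (b ` I) \<in> b ` I" using assms(1) by simp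
  then obtain m where m: "m \<in> I" "b m = Max (b ` I)" by auto
  have "(\<Sum>i\<in>I. b i) \<le> (\<Sum>i\<in>I. b m)"
    using assms(1) m by (intro sum_mono) simp
  then have "(\<Sum>i\<in>I. b i) powr p \<le> (real (card I) * b m) powr p"
    using assms by (intro powr_mono2 sum_nonneg) auto
  also have "\<dots> = real (card I) powr p * b m powr p"
    using assms m by (simp add: powr_mult)
  also have "\<dots> \<le> real (card I) powr p * (\<Sum>i\<in>I. b i powr p)"
    using assms(1) m by (intro mult_left_mono member_le_sum) auto
  finally show ?thesis .
qed simp

context diff_controlled
begin

text \<open>Points with \<open>M x = \<infinity>\<close> get the value 0; under the hypothesis of
  the final estimate they form a null set.\<close>

abbreviation "m \<equiv> \<lambda>x. enn2real (M x)"

definition crit_radius :: "'a \<Rightarrow> real" where "crit_radius x = (N / m x) powr (1 / real k)"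

text \<open>If \<open>m x = 0\<close>, the critical radius ought to be infinite, whereas division by
  zero makes it 0. The derivative bound then vanishes at every scale, hence the separate value
  0.\<close>

definition profile :: "real \<Rightarrow> 'a \<Rightarrow> real \<Rightarrow> real" where
  "profile d x t = (if m x = 0 then 0 else N * two_scale k d (crit_radius x) t)"

text \<open>Large enough for four bounds: \<open>smooth_err\<close> and the differences of averages,
  each below and above the critical radius. \<open>1 + 2 / d\<close> comes from the drift of
  averages, \<open>(2 * real k) ^ DIM('a)\<close> from the ratio of ball volumes.\<close>

definition profile_const :: "real \<Rightarrow> real" where
  "profile_const d = D * real k * (2 * real k) ^ DIM('a) +
  2 ^ k * (2 ^ (DIM('a) + 1) * (1 + 2 / d) + (2 * real k) ^ DIM('a)) / \<omega>"

lemma profile_const_pos: "0 < d \<Longrightarrow> 0 < profile_const d"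
  using D_pos k_pos \<omega>_pos unfolding profile_const_def
  by (intro add_pos_nonneg mult_pos_pos) auto

lemma crit_radius_pos: "m x \<noteq> 0 \<Longrightarrow> 0 < crit_radius x"
  using N_pos enn2real_nonneg[of "M x"] by (simp add: crit_radius_def)

lemma crit_radius_power: "m x \<noteq> 0 \<Longrightarrow> crit_radius x ^ k * m x = N"
  using N_pos k_pos enn2real_nonneg[of "M x"] by (simp add: crit_radius_def powr_realpow'[symmetric] powr_powr)

lemma profile_small: "m x \<noteq> 0 \<Longrightarrow> t \<le> crit_radius x \<Longrightarrow> profile d x t = t ^ k * m x"
  using crit_radius_power[of x] crit_radius_pos[of x] by (simp add: profile_def two_scale_def power_divide field_simps)

lemma profile_large: "m x \<noteq> 0 \<Longrightarrow> crit_radius x < t \<Longrightarrow> profile d x t = N * (t / crit_radius x) powr d"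
  by (simp add: profile_def two_scale_def)

lemma profile_nonneg: "0 \<le> t \<Longrightarrow> 0 \<le> profile d x t"
  using N_pos crit_radius_pos[of x] by (auto simp: profile_def two_scale_def intro!: mult_nonneg_nonneg)

lemma one_le_two_k: "1 \<le> (2 * real k) ^ DIM('a)"
  using k_pos by (intro one_le_power) auto

lemma borel_measurable_profile [measurable]:
  "(\<lambda>(x, t). profile d x t) \<in> borel_measurable (borel \<Otimes>\<^sub>M borel)"
  unfolding profile_def two_scale_def crit_radius_def by measurable

lemma borel_measurable_smooth_err [measurable (raw)]:
  assumes [measurable]: "f \<in> borel_measurable A" "t \<in> borel_measurable A"
  shows "(\<lambda>z. smooth_err k (f z) (t z)) \<in> borel_measurable A"
  unfolding smooth_err_def by measurable

lemma borel_measurable_fin_diff_ball_avg [measurable (raw)]: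
  assumes [measurable]: "h \<in> borel_measurable A" "x \<in> borel_measurable A" "t \<in> borel_measurable A"
  shows "(\<lambda>z. fin_diff k (h z) (\<lambda>y. ball_avg F y (t z)) (x z)) \<in> borel_measurable A"
  unfolding fin_diff_def by measurable

lemma ennreal_bound:
  assumes "ennreal \<bar>a\<bar> \<le> ennreal c * M x" "0 \<le> c" "M x < \<infinity>"
  shows "\<bar>a\<bar> \<le> c * m x"
  using assms by (cases "M x") (auto simp: ennreal_mult[symmetric])

text \<open>Up to the critical radius this is the derivative bound. Beyond it,
  \<open>smooth_err\<close> is taken at the critical radius, where the derivative bound is
  \<open>D * real k * N\<close>, and the drift from there to \<open>t\<close> is added.\<close>

lemma smooth_err_le_profile:
  assumes d: "0 < d" and x: "M x < \<infinity>"
    and le: "\<forall>t>0. ennreal \<bar>smooth_err k x t\<bar> \<le> ennreal (D * real k * t ^ k) * M x"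
    and t: "0 < t"
  shows "\<bar>smooth_err k x t\<bar> \<le> profile_const d * profile d x t"
proof -
  have le: "\<bar>smooth_err k x t\<bar> \<le> D * real k * (t ^ k * m x)" if "0 < t" for t
    using ennreal_bound[OF le[rule_format, OF that] _ x] D_pos that by (simp add: mult_ac)
  have c0: "0 \<le> 2 ^ k * (2 ^ (DIM('a) + 1) * (1 + 2 / d) + (2 * real k) ^ DIM('a)) / \<omega>"
    using d \<omega>_pos by simp
  have "D * real k * 1 \<le> D * real k * (2 * real k) ^ DIM('a)"
    using D_pos one_le_two_k by (intro mult_left_mono) auto
  then have c1: "D * real k \<le> profile_const d"
    unfolding profile_const_def using c0 by linarith
  have c2: "D * real k + 2 ^ k * (2 ^ (DIM('a) + 1) * (1 + 2 / d)) / \<omega> \<le> profile_const d"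
  proof -
    have "2 ^ k * (2 ^ (DIM('a) + 1) * (1 + 2 / d)) / \<omega> \<le> 2 ^ k * (2 ^ (DIM('a) + 1) * (1 + 2 / d) + (2 * real k) ^ DIM('a)) / \<omega>"
      using \<omega>_pos by (intro divide_right_mono mult_left_mono) auto
    then show ?thesis
      using \<open>D * real k * 1 \<le> _\<close> unfolding profile_const_def by linarith
  qed
  show ?thesis
  proof (cases "m x = 0")
    case True
    then show ?thesis using le[OF t] by (simp add: profile_def)
  next
    case m: False
    show ?thesis
    proof (cases "t \<le> crit_radius x")
      case True
      have "\<bar>smooth_err k x t\<bar> \<le> D * real k * profile d x t"
        using le[OF t] profile_small[OF m True] by simp
      also have "\<dots> \<le> profile_const d * profile d x t"
        using c1 t by (intro mult_right_mono profile_nonneg) auto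
      finally show ?thesis .
    next
      case False
      let ?r = "crit_radius x"
      let ?P = "(t / ?r) powr d"
      have r: "0 < ?r" "?r \<le> t" using crit_radius_pos[OF m] False by auto
      have P: "1 \<le> ?P" using r d by (intro ge_one_powr_ge_zero) auto
      have "\<bar>smooth_err k x ?r\<bar> \<le> D * real k * N"
        using le[OF r(1)] crit_radius_power[OF m] by simp
      also have "\<dots> \<le> D * real k * (N * ?P)"
        using P N_pos D_pos by (intro mult_left_mono) auto
      finally have 1: "\<bar>smooth_err k x ?r\<bar> \<le> D * real k * (N * ?P)" .
      have 2: "\<bar>smooth_err k x t - smooth_err k x ?r\<bar> \<le> 2 ^ k * (2 ^ (DIM('a) + 1) * (1 + 2 / d)) / \<omega> * (N * ?P)"
        using smooth_err_growth[OF r d, of k x] by (simp add: mult_ac)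
      have "\<bar>smooth_err k x t\<bar> \<le> (D * real k + 2 ^ k * (2 ^ (DIM('a) + 1) * (1 + 2 / d)) / \<omega>) * (N * ?P)"
        using 1 2 unfolding distrib_right by linarith
      also have "\<dots> \<le> profile_const d * (N * ?P)"
        using c2 N_pos by (intro mult_right_mono) auto
      finally show ?thesis using profile_large[OF m, of t d] False by simp
    qed
  qed
qed

text \<open>No point value of \<open>F\<close> enters, so beyond the critical radius the oscillation
  bound applies without any drift; the power of \<open>norm h / crit_radius x\<close>, at least 1
  there, is inserted only to match the profile.\<close>

lemma fin_diff_ball_avg_le_profile:
  assumes d: "0 < d" and x: "M x < \<infinity>" and j: "j \<in> {1..k}" and h: "h \<noteq> 0"
    and le: "ennreal \<bar>fin_diff k h (\<lambda>y. ball_avg F y (real j * norm h)) x\<bar>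
     \<le> ennreal (D * real k * (2 * real k) ^ DIM('a) * norm h ^ k) * M x"
  shows "\<bar>fin_diff k h (\<lambda>y. ball_avg F y (real j * norm h)) x\<bar> \<le> profile_const d * profile d x (norm h)"
    (is "\<bar>?a\<bar> \<le> _")
proof -
  have le: "\<bar>?a\<bar> \<le> D * real k * (2 * real k) ^ DIM('a) * (norm h ^ k * m x)"
    using ennreal_bound[OF le _ x] D_pos by (simp add: mult_ac)
  have c0: "0 \<le> D * real k * (2 * real k) ^ DIM('a)" using D_pos by simp
  have "0 \<le> 2 ^ k * (2 ^ (DIM('a) + 1) * (1 + 2 / d) + (2 * real k) ^ DIM('a)) / \<omega>"
    using d \<omega>_pos by simp
  then have c1: "D * real k * (2 * real k) ^ DIM('a) \<le> profile_const d"
    unfolding profile_const_def by linarith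
  have "2 ^ k * (2 * real k) ^ DIM('a) / \<omega> \<le> 2 ^ k * (2 ^ (DIM('a) + 1) * (1 + 2 / d) + (2 * real k) ^ DIM('a)) / \<omega>"
    using \<omega>_pos d by (intro divide_right_mono mult_left_mono) auto
  then have c2: "2 ^ k * (2 * real k) ^ DIM('a) / \<omega> \<le> profile_const d"
    using c0 unfolding profile_const_def by linarith
  show ?thesis
  proof (cases "m x = 0")
    case True
    then show ?thesis using le by (simp add: profile_def)
  next
    case m: False
    show ?thesis
    proof (cases "norm h \<le> crit_radius x")
      case True
      have "\<bar>?a\<bar> \<le> D * real k * (2 * real k) ^ DIM('a) * profile d x (norm h)"
        using le profile_small[OF m True] by simp
      also have "\<dots> \<le> profile_const d * profile d x (norm h)"
        using c1 by (intro mult_right_mono profile_nonneg) auto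
      finally show ?thesis .
    next
      case False
      let ?P = "(norm h / crit_radius x) powr d"
      have P: "1 \<le> ?P" using crit_radius_pos[OF m] False d by (intro ge_one_powr_ge_zero) auto
      have "\<bar>?a\<bar> \<le> 2 ^ k * (2 * real k) ^ DIM('a) / \<omega> * N"
        using fin_diff_ball_avg_le[of j k h x] j h by (simp add: mult_ac)
      also have "\<dots> \<le> profile_const d * (N * ?P)"
        using c2 P N_pos profile_const_pos[OF d] by (intro mult_mono) auto
      finally show ?thesis using profile_large[OF m, of "norm h" d] False by simp
    qed
  qed
qed

text \<open>The interpolation of exponents happens here: the radial integral yields
  \<open>N powr p\<close> times the critical radius to the power \<open>- s k p\<close>. The latter
  is \<open>(m x / N) powr (s * p)\<close>, which leaves
  \<open>N powr ((1 - s) * p) * m x powr (s * p)\<close>.\<close>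

lemma nn_integral_profile:
  assumes p: "1 < p" and s: "1 / p < s" "s < 1"
  shows "(\<integral>\<^sup>+h. ennreal (profile (1 / (2 * p)) x (norm h) powr p / norm h powr (real DIM('a) + s * real k * p)) \<partial>(lborel :: 'a measure))
    \<le> ennreal (8 * \<omega> * 2 powr (real k * p + real DIM('a)) / (1 - s) * N powr ((1 - s) * p) * m x powr (s * p))"
proof (cases "m x = 0")
  case True
  then show ?thesis by (simp add: profile_def)
next
  case m: False
  then have mx: "0 < m x" using enn2real_nonneg[of "M x"] by linarith
  let ?I = "\<lambda>h::'a. two_scale k (1 / (2 * p)) (crit_radius x) (norm h) powr p / norm h powr (real DIM('a) + s * real k * p)"
  have ts: "0 \<le> two_scale k (1 / (2 * p)) (crit_radius x) (norm h)" for h :: 'a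
    using crit_radius_pos[OF m] by (simp add: two_scale_def)
  have "(\<integral>\<^sup>+h. ennreal (profile (1 / (2 * p)) x (norm h) powr p / norm h powr (real DIM('a) + s * real k * p)) \<partial>(lborel :: 'a measure))
     = (\<integral>\<^sup>+h. ennreal (N powr p) * ennreal (?I h) \<partial>(lborel :: 'a measure))"
    using m N_pos ts by (intro nn_integral_cong) (auto simp: profile_def powr_mult ennreal_mult'[symmetric])
  also have "\<dots> = ennreal (N powr p) * (\<integral>\<^sup>+h. ennreal (?I h) \<partial>(lborel :: 'a measure))"
    by (rule nn_integral_cmult) (simp add: two_scale_def)
  also have "\<dots> \<le> ennreal (N powr p) * ennreal (8 * \<omega> * 2 powr (real k * p + real DIM('a)) / (1 - s) * crit_radius x powr (- (s * real k * p)))"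
    unfolding \<omega>_def using assms k_pos crit_radius_pos[OF m] by (intro mult_left_mono nn_integral_two_scale) auto
  also have "\<dots> = ennreal (8 * \<omega> * 2 powr (real k * p + real DIM('a)) / (1 - s) * (N powr p * crit_radius x powr (- (s * real k * p))))"
    by (simp add: ennreal_mult'[symmetric] mult_ac)
  also have "N powr p * crit_radius x powr (- (s * real k * p)) = N powr ((1 - s) * p) * m x powr (s * p)"
  proof -
    have "crit_radius x powr (- (s * real k * p)) = (N / m x) powr (- (s * p))"
      using k_pos by (simp add: crit_radius_def powr_powr)
    also have "\<dots> = m x powr (s * p) / N powr (s * p)"
      using mx N_pos by (simp add: powr_minus powr_divide field_simps)
    also have "N powr p * \<dots> = N powr p / N powr (s * p) * m x powr (s * p)"
      by simp
    also have "N powr p / N powr (s * p) = N powr ((1 - s) * p)"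
      by (simp add: powr_diff[symmetric] algebra_simps)
    finally show ?thesis .
  qed
  finally show ?thesis by (simp add: mult_ac)
qed

lemma fin_diff_powr_le:
  assumes "0 \<le> p"
  shows "\<bar>fin_diff k h F x\<bar> powr p \<le> (2 ^ (k + 1) * real (k + 1)) powr p *
    ((\<Sum>i=0..k. \<bar>smooth_err k (x + real i *\<^sub>R h) t\<bar> powr p) +
     (\<Sum>j=1..k. \<bar>fin_diff k h (\<lambda>y. ball_avg F y (real j * t)) x\<bar> powr p))"
proof -
  let ?Ap = "(\<Sum>i=0..k. \<bar>smooth_err k (x + real i *\<^sub>R h) t\<bar> powr p)"
  let ?Bp = "(\<Sum>j=1..k. \<bar>fin_diff k h (\<lambda>y. ball_avg F y (real j * t)) x\<bar> powr p)"
  let ?A = "\<Sum>i=0..k. \<bar>smooth_err k (x + real i *\<^sub>R h) t\<bar>"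
  let ?B = "\<Sum>j=1..k. \<bar>fin_diff k h (\<lambda>y. ball_avg F y (real j * t)) x\<bar>"
  have ch: "real (k choose j) \<le> 2 ^ k" for j
    using binomial_le_pow2[of k j] by (metis of_nat_le_iff of_nat_numeral of_nat_power)
  have 1: "\<bar>fin_diff k h (\<lambda>y. smooth_err k y t) x\<bar> \<le> 2 ^ k * ?A"
    unfolding fin_diff_def sum_distrib_left
    by (rule order_trans[OF sum_abs sum_mono]) (auto simp: abs_mult power_abs intro!: mult_right_mono ch)
  have 2: "\<bar>\<Sum>j=1..k. (-1) ^ (k - j) * real (k choose j) * fin_diff k h (\<lambda>y. ball_avg F y (real j * t)) x\<bar> \<le> 2 ^ k * ?B"
    unfolding sum_distrib_left
    by (rule order_trans[OF sum_abs sum_mono]) (auto simp: abs_mult power_abs intro!: mult_right_mono ch)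
  have "\<bar>fin_diff k h F x\<bar> \<le> 2 ^ k * ?A + 2 ^ k * ?B"
    unfolding fin_diff_eq[of k h x t] abs_mult power_abs using 1 2 by simp
  \<comment> \<open>The sum of two terms is written as a sum over \<open>{True, False}\<close>, so
    that \<open>powr_sum_le\<close> also splits the outer sum.\<close>
  then have "\<bar>fin_diff k h F x\<bar> powr p \<le> (2 ^ k * (\<Sum>b\<in>{True, False}. if b then ?A else ?B)) powr p"
    using assms by (intro powr_mono2) (auto simp: distrib_left)
  also have "\<dots> = (2 ^ k) powr p * (\<Sum>b\<in>{True, False}. if b then ?A else ?B) powr p"
    by (rule powr_mult)
  also have "\<dots> \<le> (2 ^ k) powr p * (real (card {True, False}) powr p * (\<Sum>b\<in>{True, False}. (if b then ?A else ?B) powr p))"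
    using assms by (intro mult_left_mono powr_sum_le) (auto intro!: sum_nonneg)
  also have "\<dots> = (2 ^ k) powr p * (2 powr p * (?A powr p + ?B powr p))" by simp
  also have "\<dots> \<le> (2 ^ k) powr p * (2 powr p * (real (k + 1) powr p * ?Ap
      + real (k + 1) powr p * ?Bp))"
  proof (intro mult_left_mono add_mono)
    show "?A powr p \<le> real (k + 1) powr p * ?Ap"
      using powr_sum_le[of "{0..k}" "\<lambda>i. \<bar>smooth_err k (x + real i *\<^sub>R h) t\<bar>" p] assms by simp
    have "?B powr p \<le> real k powr p * ?Bp"
      using powr_sum_le[of "{1..k}" "\<lambda>j. \<bar>fin_diff k h (\<lambda>y. ball_avg F y (real j * t)) x\<bar>" p] assms by simp
    also have "\<dots> \<le> real (k + 1) powr p * ?Bp"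
      using assms by (intro mult_right_mono powr_mono2 sum_nonneg) auto
    finally show "?B powr p \<le> real (k + 1) powr p * ?Bp" .
  qed auto
  also have "\<dots> = (2 ^ (k + 1) * real (k + 1)) powr p *
    (?Ap +
     ?Bp)"
  proof -
    have "(2 ^ (k + 1) * real (k + 1)) powr p = (2 ^ k) powr p * (2 powr p * real (k + 1) powr p)"
      by (simp only: powr_mult[symmetric] power_add power_one_right mult.assoc)
    then show ?thesis by (simp only: distrib_left mult.assoc)
  qed
  finally show ?thesis .
qed

end

text \<open>A product of the number of terms, the loss in splitting the \<open>p\<close>-th power,
  \<open>profile_const\<close> at \<open>d = 1 / (2 * p)\<close>, the radial integral, and the
  maximal theorem. It is free of \<open>s\<close>, and it lives outside the locale because it has to
  be fixed before the function.\<close>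

definition interp_const :: "nat \<Rightarrow> nat \<Rightarrow> real \<Rightarrow> real \<Rightarrow> real \<Rightarrow> real" where
  "interp_const n k p D \<omega> = (2 * real k + 1) * (2 ^ (k + 1) * real (k + 1)) powr p *
     (D * real k * (2 * real k) ^ n + 2 ^ k * (2 ^ (n + 1) * (1 + 4 * p) + (2 * real k) ^ n) / \<omega>) powr p *
     (8 * \<omega> * 2 powr (real k * p + real n)) * (2 powr p * 5 ^ n * p)"

section \<open>Integration over points and steps\<close>

context diff_controlled
begin

text \<open>The \<open>k\<close>-th difference of \<open>smooth_err\<close> is bounded by profiles
  at \<open>x + i h\<close> and not at \<open>x\<close>. With \<open>h\<close> fixed and the
  integration in \<open>x\<close> done first, these translations disappear; the profile at
  \<open>x\<close> is then integrated over \<open>h\<close>.\<close>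

theorem nn_integral_fin_diff_le:
  assumes p: "1 < p" and s: "1 / p < s" "s < 1"
    and fin: "(\<integral>\<^sup>+x. ennreal (g x powr (s * p)) \<partial>lborel) < \<infinity>"
  shows "(\<integral>\<^sup>+x. \<integral>\<^sup>+h. ennreal (\<bar>fin_diff k h F x\<bar> powr p / norm h powr (real DIM('a) + s * real k * p)) \<partial>lborel \<partial>lborel)
    \<le> ennreal (interp_const DIM('a) k p D \<omega> / ((1 - s) * (s * p - 1)) * N powr ((1 - s) * p)) *
      (\<integral>\<^sup>+x. ennreal (g x powr (s * p)) \<partial>lborel)"
proof -
  let ?G = "(\<integral>\<^sup>+x. ennreal (g x powr (s * p)) \<partial>lborel)"
  let ?c = "(8 * \<omega> * 2 powr (real k * p + real DIM('a)) / (1 - s) * N powr ((1 - s) * p))"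
  have sp: "1 < s * p" using s p by (simp add: field_simps)
  have sp_le: "s * p \<le> p" using s p by simp
  define d where "d = 1 / (2 * p)"
  have d: "0 < d" using p by (simp add: d_def)
  let ?K = "profile_const d"
  let ?C = "(2 ^ (k + 1) * real (k + 1)) powr p"
  let ?w = "\<lambda>h::'a. norm h powr (real DIM('a) + s * real k * p)"
  let ?E = "\<lambda>x h::'a. ennreal (?C * \<bar>smooth_err k x (norm h)\<bar> powr p / ?w h)"
  let ?A = "\<lambda>j x h::'a. ennreal (?C * \<bar>fin_diff k h (\<lambda>y. ball_avg F y (real j * norm h)) x\<bar> powr p / ?w h)"
  let ?P = "\<lambda>x h::'a. ennreal (profile d x (norm h) powr p / ?w h)"
  have fin_M: "AE x in lborel. M x < \<infinity>"
    using sp fin g_nonneg by (intro maximal_finite[of g "s * p"]) auto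
  have E_le: "(\<integral>\<^sup>+x. ?E x h \<partial>lborel) \<le> (\<integral>\<^sup>+x. ennreal (?C * ?K powr p) * ?P x h \<partial>lborel)" if h: "h \<noteq> 0" for h
  proof (rule nn_integral_mono_AE, use fin_M smooth_err_le in eventually_elim)
    fix x assume x: "M x < \<infinity>" "\<forall>t>0. ennreal \<bar>smooth_err k x t\<bar> \<le> ennreal (D * real k * t ^ k) * M x"
    have "\<bar>smooth_err k x (norm h)\<bar> powr p \<le> (?K * profile d x (norm h)) powr p"
      using smooth_err_le_profile[OF d x, of "norm h"] h p by (intro powr_mono2) auto
    also have "\<dots> = ?K powr p * profile d x (norm h) powr p"
      by (rule powr_mult)
    finally have "?C * \<bar>smooth_err k x (norm h)\<bar> powr p / ?w h \<le> ?C * (?K powr p * profile d x (norm h) powr p) / ?w h"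
      by (intro divide_right_mono mult_left_mono) auto
    then show "?E x h \<le> ennreal (?C * ?K powr p) * ?P x h"
      by (subst ennreal_mult'[symmetric]) (auto simp: mult_ac)
  qed
  \<comment> \<open>For \<open>smooth_err\<close> the exceptional null set consists of points
    \<open>x\<close>; here it also involves steps, so the bound holds only for almost every
    \<open>h\<close>.\<close>
  have A_le: "AE h in lborel. \<forall>j\<in>{1..k}. (\<integral>\<^sup>+x. ?A j x h \<partial>lborel) \<le> (\<integral>\<^sup>+x. ennreal (?C * ?K powr p) * ?P x h \<partial>lborel)"
  proof -
    have "AE h in lborel. h \<noteq> (0::'a)" by (rule AE_lborel_singleton)
    then show ?thesis using fin_diff_ball_avg_le_maximal
    proof eventually_elim
      case (elim h)
      show ?case
      proof (intro ballI nn_integral_mono_AE, use fin_M in eventually_elim)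
        fix j x assume j: "j \<in> {1..k}" and x: "M x < \<infinity>"
        have "\<bar>fin_diff k h (\<lambda>y. ball_avg F y (real j * norm h)) x\<bar> powr p \<le> (?K * profile d x (norm h)) powr p"
          using fin_diff_ball_avg_le_profile[OF d x j elim(1)] elim(2) j p by (intro powr_mono2) auto
        also have "\<dots> = ?K powr p * profile d x (norm h) powr p"
          by (rule powr_mult)
        finally have "?C * \<bar>fin_diff k h (\<lambda>y. ball_avg F y (real j * norm h)) x\<bar> powr p / ?w h
            \<le> ?C * (?K powr p * profile d x (norm h) powr p) / ?w h"
          by (intro divide_right_mono mult_left_mono) auto
        then show "?A j x h \<le> ennreal (?C * ?K powr p) * ?P x h"
          by (subst ennreal_mult'[symmetric]) (auto simp: mult_ac)
      qed
    qed
  qed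
  have "(\<integral>\<^sup>+x. \<integral>\<^sup>+h. ennreal (\<bar>fin_diff k h F x\<bar> powr p / ?w h) \<partial>lborel \<partial>lborel)
    \<le> (\<integral>\<^sup>+x. \<integral>\<^sup>+h. (\<Sum>i\<in>{0..k}. ?E (x + real i *\<^sub>R h) h) + (\<Sum>j\<in>{1..k}. ?A j x h) \<partial>lborel \<partial>lborel)"
  proof (intro nn_integral_mono)
    fix x h :: 'a
    have "ennreal (\<bar>fin_diff k h F x\<bar> powr p / ?w h) \<le>
      ennreal (?C * ((\<Sum>i=0..k. \<bar>smooth_err k (x + real i *\<^sub>R h) (norm h)\<bar> powr p) +
     (\<Sum>j=1..k. \<bar>fin_diff k h (\<lambda>y. ball_avg F y (real j * norm h)) x\<bar> powr p)) / ?w h)"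
      using p by (intro ennreal_leI divide_right_mono fin_diff_powr_le) auto
    also have "\<dots> = (\<Sum>i\<in>{0..k}. ?E (x + real i *\<^sub>R h) h) + (\<Sum>j\<in>{1..k}. ?A j x h)"
      by (simp add: sum_ennreal ennreal_plus[symmetric] sum_nonneg distrib_left add_divide_distrib
          sum_distrib_left sum_divide_distrib del: ennreal_plus)
    finally show "ennreal (\<bar>fin_diff k h F x\<bar> powr p / ?w h) \<le> (\<Sum>i\<in>{0..k}. ?E (x + real i *\<^sub>R h) h) + (\<Sum>j\<in>{1..k}. ?A j x h)" .
  qed
  also have "\<dots> = (\<integral>\<^sup>+h. \<integral>\<^sup>+x. (\<Sum>i\<in>{0..k}. ?E (x + real i *\<^sub>R h) h) + (\<Sum>j\<in>{1..k}. ?A j x h) \<partial>lborel \<partial>lborel)"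
    by (rule lborel_pair.Fubini'[symmetric]) measurable
  also have "\<dots> = (\<integral>\<^sup>+h. (\<Sum>i\<in>{0..k}. \<integral>\<^sup>+x. ?E (x + real i *\<^sub>R h) h \<partial>lborel) + (\<Sum>j\<in>{1..k}. \<integral>\<^sup>+x. ?A j x h \<partial>lborel) \<partial>lborel)"
    by (intro nn_integral_cong) (simp add: nn_integral_add nn_integral_sum del: sum_ennreal)
  also have "\<dots> = (\<integral>\<^sup>+h. (\<Sum>i\<in>{0..k}. \<integral>\<^sup>+x. ?E x h \<partial>lborel) + (\<Sum>j\<in>{1..k}. \<integral>\<^sup>+x. ?A j x h \<partial>lborel) \<partial>lborel)"
    by (intro nn_integral_cong arg_cong2[where f="(+)"] sum.cong refl nn_integral_lborel_translate) measurable
  \<comment> \<open>There are \<open>k + 1\<close> terms from \<open>smooth_err\<close>, with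
    \<open>i\<close> from 0, and \<open>k\<close> from the averages, with \<open>j\<close> from 1,
    all under the same bound.\<close>
  also have "\<dots> \<le> (\<integral>\<^sup>+h. ennreal (2 * real k + 1) * (\<integral>\<^sup>+x. ennreal (?C * ?K powr p) * ?P x h \<partial>lborel) \<partial>lborel)"
  proof (rule nn_integral_mono_AE)
    have "AE h in lborel. h \<noteq> (0::'a)" by (rule AE_lborel_singleton)
    then show "AE h in lborel. (\<Sum>i\<in>{0..k}. \<integral>\<^sup>+x. ?E x h \<partial>lborel) + (\<Sum>j\<in>{1..k}. \<integral>\<^sup>+x. ?A j x h \<partial>lborel)
      \<le> ennreal (2 * real k + 1) * (\<integral>\<^sup>+x. ennreal (?C * ?K powr p) * ?P x h \<partial>lborel)"
      using A_le
    proof eventually_elim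
      case (elim h)
      let ?X = "\<integral>\<^sup>+x. ennreal (?C * ?K powr p) * ?P x h \<partial>lborel"
      have "(\<Sum>i\<in>{0..k}. \<integral>\<^sup>+x. ?E x h \<partial>lborel) + (\<Sum>j\<in>{1..k}. \<integral>\<^sup>+x. ?A j x h \<partial>lborel) \<le> (\<Sum>i\<in>{0..k}. ?X) + (\<Sum>j\<in>{1..k}. ?X)"
        using elim by (intro add_mono sum_mono E_le) auto
      also have "\<dots> = (ennreal (real (Suc k)) + ennreal (real k)) * ?X"
        by (simp add: distrib_right ennreal_of_nat_eq_real_of_nat)
      also have "ennreal (real (Suc k)) + ennreal (real k) = ennreal (2 * real k + 1)"
        by (subst ennreal_plus[symmetric]) auto
      finally show ?case .
    qed
  qed
  also have "\<dots> = (\<integral>\<^sup>+h. \<integral>\<^sup>+x. ennreal ((2 * real k + 1) * (?C * ?K powr p)) * ?P x h \<partial>lborel \<partial>lborel)"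
    by (intro nn_integral_cong, subst nn_integral_cmult[symmetric]) (auto simp: ennreal_mult mult.assoc)
  also have "\<dots> = (\<integral>\<^sup>+x. \<integral>\<^sup>+h. ennreal ((2 * real k + 1) * (?C * ?K powr p)) * ?P x h \<partial>lborel \<partial>lborel)"
    by (rule lborel_pair.Fubini') measurable
  also have "\<dots> = (\<integral>\<^sup>+x. ennreal ((2 * real k + 1) * (?C * ?K powr p)) * (\<integral>\<^sup>+h. ?P x h \<partial>lborel) \<partial>lborel)"
    by (intro nn_integral_cong nn_integral_cmult) measurable
  also have "\<dots> \<le> (\<integral>\<^sup>+x. ennreal ((2 * real k + 1) * (?C * ?K powr p)) *
      ennreal (8 * \<omega> * 2 powr (real k * p + real DIM('a)) / (1 - s) * N powr ((1 - s) * p) * m x powr (s * p)) \<partial>lborel)"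
    unfolding d_def by (intro nn_integral_mono mult_left_mono nn_integral_profile p s) auto
  also have "\<dots> = (\<integral>\<^sup>+x. ennreal ((2 * real k + 1) * (?C * ?K powr p) *
      ?c) * ennreal (m x powr (s * p)) \<partial>lborel)"
    using \<omega>_pos s by (intro nn_integral_cong) (auto simp: ennreal_mult'[symmetric] mult_ac)
  also have "\<dots> = ennreal ((2 * real k + 1) * (?C * ?K powr p) *
      ?c) * (\<integral>\<^sup>+x. ennreal (m x powr (s * p)) \<partial>lborel)"
    by (rule nn_integral_cmult) measurable
  also have "\<dots> \<le> ennreal ((2 * real k + 1) * (?C * ?K powr p) *
      ?c) *
      (ennreal (2 powr p * 5 ^ DIM('a) * p / (s * p - 1)) * ?G)"
  proof (intro mult_left_mono)
    have "(\<integral>\<^sup>+x. ennreal (m x powr (s * p)) \<partial>lborel) \<le>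
      ennreal (2 powr (s * p) * 5 ^ DIM('a) * (s * p) / (s * p - 1)) * ?G"
      using g_nonneg sp by (intro maximal_strong_type) auto
    \<comment> \<open>Since \<open>s * p \<le> p\<close>, the numerator is made independent of
      \<open>s\<close>; only \<open>s * p - 1\<close> has to stay.\<close>
    also have "\<dots> \<le> ennreal (2 powr p * 5 ^ DIM('a) * p / (s * p - 1)) * ?G"
      using sp sp_le by (intro mult_right_mono ennreal_leI divide_right_mono mult_mono powr_mono) auto
    finally show "(\<integral>\<^sup>+x. ennreal (m x powr (s * p)) \<partial>lborel) \<le>
      ennreal (2 powr p * 5 ^ DIM('a) * p / (s * p - 1)) * ?G" .
  qed auto
  also have "\<dots> = ennreal (interp_const DIM('a) k p D \<omega> / ((1 - s) * (s * p - 1)) * N powr ((1 - s) * p)) *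
      ?G"
  proof -
    have "?K = D * real k * (2 * real k) ^ DIM('a) + 2 ^ k * (2 ^ (DIM('a) + 1) * (1 + 4 * p) + (2 * real k) ^ DIM('a)) / \<omega>"
      unfolding profile_const_def d_def by simp
    then have eq: "(2 * real k + 1) * (?C * ?K powr p) *
      ?c * (2 powr p * 5 ^ DIM('a) * p / (s * p - 1))
      = interp_const DIM('a) k p D \<omega> / ((1 - s) * (s * p - 1)) * N powr ((1 - s) * p)"
      by (simp add: interp_const_def)
    have "0 \<le> 2 powr p * 5 ^ DIM('a) * p / (s * p - 1)" using sp p by simp
    note mult = ennreal_mult''[OF this]
    show ?thesis
      unfolding eq[symmetric] mult by (rule mult.assoc[symmetric])
  qed
  finally show ?thesis .
qed

end

subsection \<open>Approximation in mean and mollification\<close>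

text \<open>For an indicator, regularity gives a closed set inside and an open set outside with
  small gaps, and a Urysohn function between them differs from the indicator only in the gaps. Sums
  and dominated limits follow by the induction principle for integrable functions.\<close>

lemma integrable_approx_continuous:
  fixes f :: "'a::euclidean_space \<Rightarrow> real"
  assumes "integrable lborel f"
  shows "\<forall>e>0. \<exists>\<phi>. continuous_on UNIV \<phi> \<and> (\<integral>\<^sup>+x. ennreal \<bar>f x - \<phi> x\<bar> \<partial>lborel) \<le> ennreal e"
  using assms
proof (induction rule: integrable_induct)
  case (base A c)
  show ?case
  proof (intro allI impI)
    fix e :: real assume "0 < e"
    \<comment> \<open>Each of the two gaps has measure below \<open>d\<close>. The
      \<open>+ 1\<close> keeps the quotient meaningful for \<open>c = 0\<close>.\<close>
    define d where "d = e / (\<bar>c\<bar> + 1) / 2"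
    have d: "0 < d" using \<open>0 < e\<close> by (simp add: d_def)
    have A [measurable]: "A \<in> sets borel" using base by simp
    obtain U where U: "open U" "A \<subseteq> U" "emeasure lborel (U - A) < ennreal d"
      using outer_regular_lborel[OF A d] by blast
    obtain T where T: "closed T" "T \<subseteq> A" "emeasure lebesgue (A - T) < ennreal d"
    proof -
      have "A \<in> sets lebesgue" using A by simp
      then show thesis by (rule sets_lebesgue_inner_closed[OF _ d]) (rule that)
    qed
    have [measurable]: "U \<in> sets borel" "T \<in> sets borel" using U T by auto
    obtain u :: "'a \<Rightarrow> real" where u: "continuous_on UNIV u" "\<And>x. u x \<in> closed_segment 0 1"
        "\<And>x. x \<in> - U \<Longrightarrow> u x = 0" "\<And>x. x \<in> T \<Longrightarrow> u x = 1"
    proof (rule Urysohn[of "- U" T 0 "1::real"])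
      show "closed (- U)" "closed T" "- U \<inter> T = {}" using U T by auto
    qed (rule that, assumption, assumption, simp_all)
    have le: "\<bar>indicator A x - u x\<bar> \<le> indicator (U - A) x + indicator (A - T) x" for x
      using u(2)[of x] u(3,4)[of x] U(2) T(2) by (auto simp: indicator_def closed_segment_eq_real_ivl split: if_splits)
    have "(\<integral>\<^sup>+x. ennreal \<bar>indicator A x *\<^sub>R c - c * u x\<bar> \<partial>lborel)
      \<le> (\<integral>\<^sup>+x. ennreal \<bar>c\<bar> * (indicator (U - A) x + indicator (A - T) x) \<partial>lborel)"
    proof (rule nn_integral_mono)
      fix x
      have "\<bar>indicator A x *\<^sub>R c - c * u x\<bar> = \<bar>c\<bar> * \<bar>indicator A x - u x\<bar>"
        by (simp add: abs_mult[symmetric] algebra_simps)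
      also have "\<dots> \<le> \<bar>c\<bar> * (indicator (U - A) x + indicator (A - T) x)"
        by (intro mult_left_mono le) auto
      finally have "ennreal \<bar>indicator A x *\<^sub>R c - c * u x\<bar> \<le> ennreal (\<bar>c\<bar> * (indicator (U - A) x + indicator (A - T) x))"
        by (rule ennreal_leI)
      also have "\<dots> = ennreal \<bar>c\<bar> * (indicator (U - A) x + indicator (A - T) x)"
        by (auto simp: ennreal_mult ennreal_plus indicator_def)
      finally show "ennreal \<bar>indicator A x *\<^sub>R c - c * u x\<bar> \<le> ennreal \<bar>c\<bar> * (indicator (U - A) x + indicator (A - T) x)" .
    qed
    also have "\<dots> = ennreal \<bar>c\<bar> * (emeasure lborel (U - A) + emeasure lborel (A - T))"
      by (simp add: nn_integral_cmult nn_integral_add)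
    also have "\<dots> \<le> ennreal \<bar>c\<bar> * (ennreal d + ennreal d)"
      using U(3) T(3) by (intro mult_left_mono add_mono) auto
    also have "\<dots> = ennreal (\<bar>c\<bar> * (d + d))"
      using d by (subst ennreal_plus[symmetric], simp, simp, subst ennreal_mult[symmetric]) auto
    also have "\<dots> \<le> ennreal e"
    proof (rule ennreal_leI)
      have "d + d = e / (\<bar>c\<bar> + 1)" unfolding d_def by (rule field_sum_of_halves)
      then show "\<bar>c\<bar> * (d + d) \<le> e"
        using \<open>0 < e\<close> by (simp add: divide_le_eq add_pos_nonneg algebra_simps)
    qed
    finally show "\<exists>\<phi>. continuous_on UNIV \<phi> \<and> (\<integral>\<^sup>+x. ennreal \<bar>indicator A x *\<^sub>R c - \<phi> x\<bar> \<partial>lborel) \<le> ennreal e"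
      using u(1) by (intro exI[of _ "\<lambda>x. c * u x"]) (auto intro: continuous_intros)
  qed
next
  case (add f g)
  show ?case
  proof (intro allI impI)
    fix e :: real assume "0 < e"
    then have e2: "0 < e / 2" by simp
    from add(3)[rule_format, OF e2] add(4)[rule_format, OF e2]
    obtain \<phi> \<psi> where *: "continuous_on UNIV \<phi>" "(\<integral>\<^sup>+x. ennreal \<bar>f x - \<phi> x\<bar> \<partial>lborel) \<le> ennreal (e / 2)"
      "continuous_on UNIV \<psi>" "(\<integral>\<^sup>+x. ennreal \<bar>g x - \<psi> x\<bar> \<partial>lborel) \<le> ennreal (e / 2)"
      by blast
    have [measurable]: "f \<in> borel_measurable borel" "g \<in> borel_measurable borel"
      "\<phi> \<in> borel_measurable borel" "\<psi> \<in> borel_measurable borel"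
      using add * by (auto intro: borel_measurable_continuous_onI)
    have "(\<integral>\<^sup>+x. ennreal \<bar>f x + g x - (\<phi> x + \<psi> x)\<bar> \<partial>lborel) \<le> (\<integral>\<^sup>+x. ennreal \<bar>f x - \<phi> x\<bar> + ennreal \<bar>g x - \<psi> x\<bar> \<partial>lborel)"
      by (intro nn_integral_mono) (simp add: ennreal_plus[symmetric] del: ennreal_plus)
    also have "\<dots> \<le> ennreal (e / 2) + ennreal (e / 2)"
      using * by (simp add: nn_integral_add add_mono)
    also have "\<dots> = ennreal e"
      using \<open>0 < e\<close> by (subst ennreal_plus[symmetric]) auto
    finally show "\<exists>\<phi>. continuous_on UNIV \<phi> \<and> (\<integral>\<^sup>+x. ennreal \<bar>f x + g x - \<phi> x\<bar> \<partial>lborel) \<le> ennreal e"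
      using * by (intro exI[of _ "\<lambda>x. \<phi> x + \<psi> x"]) (auto intro: continuous_intros)
  qed
next
  case (lim f s)
  show ?case
  proof (intro allI impI)
    fix e :: real assume "0 < e"
    have [measurable]: "f \<in> borel_measurable borel" "\<And>i. s i \<in> borel_measurable borel"
      using lim by auto
    have "(\<lambda>i. \<integral>\<^sup>+x. ennreal (norm (f x - s i x)) \<partial>lborel) \<longlonglongrightarrow> 0"
    proof (rule nn_integral_dominated_convergence_norm[where w="\<lambda>x. 2 * norm (f x)"])
      show "(\<integral>\<^sup>+x. ennreal (2 * norm (f x)) \<partial>lborel) < \<infinity>"
      proof -
        have "(\<integral>\<^sup>+x. ennreal (norm (f x)) \<partial>lborel) < \<infinity>"
          using lim(4) unfolding integrable_iff_bounded by blast
        then show ?thesis by (simp add: ennreal_mult' nn_integral_cmult ennreal_mult_less_top)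
      qed
    qed (use lim(2,3) in \<open>auto intro!: AE_I2\<close>)
    then have "\<forall>\<^sub>F i in sequentially. (\<integral>\<^sup>+x. ennreal (norm (f x - s i x)) \<partial>lborel) < ennreal (e / 2)"
      using \<open>0 < e\<close> by (intro order_tendstoD(2)) auto
    then obtain i where i: "(\<integral>\<^sup>+x. ennreal (norm (f x - s i x)) \<partial>lborel) < ennreal (e / 2)"
      unfolding eventually_sequentially by blast
    obtain \<phi> where \<phi>: "continuous_on UNIV \<phi>" "(\<integral>\<^sup>+x. ennreal \<bar>s i x - \<phi> x\<bar> \<partial>lborel) \<le> ennreal (e / 2)"
      using lim(5)[of i, rule_format, of "e / 2"] \<open>0 < e\<close> by auto
    have [measurable]: "\<phi> \<in> borel_measurable borel"
      using \<phi> by (auto intro: borel_measurable_continuous_onI)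
    have "(\<integral>\<^sup>+x. ennreal \<bar>f x - \<phi> x\<bar> \<partial>lborel) \<le> (\<integral>\<^sup>+x. ennreal (norm (f x - s i x)) + ennreal \<bar>s i x - \<phi> x\<bar> \<partial>lborel)"
      by (intro nn_integral_mono) (simp add: ennreal_plus[symmetric] del: ennreal_plus)
    also have "\<dots> \<le> ennreal (e / 2) + ennreal (e / 2)"
      using i \<phi>(2) by (simp add: nn_integral_add add_mono)
    also have "\<dots> = ennreal e"
      using \<open>0 < e\<close> by (subst ennreal_plus[symmetric]) auto
    finally show "\<exists>\<phi>. continuous_on UNIV \<phi> \<and> (\<integral>\<^sup>+x. ennreal \<bar>f x - \<phi> x\<bar> \<partial>lborel) \<le> ennreal e"
      using \<phi>(1) by blast
  qed
qed

text \<open>\<open>F\<close> is cut off at radius \<open>R + 1\<close>, so that shifts by less than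
  1 of points of the smaller ball do not notice the cut. The approximation error enters twice, each
  time with \<open>e / 4\<close>; the continuous approximant is uniformly continuous on the closed
  ball and costs \<open>e / 2\<close>.\<close>

lemma translation_continuous_L1:
  fixes F :: "'a::euclidean_space \<Rightarrow> real"
  assumes [measurable]: "F \<in> borel_measurable borel"
    and int: "\<And>x r. integrable lborel (\<lambda>y. indicator (ball x r) y * F y)"
    and "0 \<le> R" "0 < e"
  obtains d where "0 < d" "\<And>y. norm y < d \<Longrightarrow> (\<integral>\<^sup>+x\<in>ball 0 R. ennreal \<bar>F (x - y) - F x\<bar> \<partial>lborel) \<le> ennreal e"
proof -
  let ?F = "\<lambda>y. indicator (ball 0 (R + 1)) y * F y"
  have [measurable]: "ball (0::'a) r \<in> sets borel" for r by simp
  obtain \<phi> where \<phi>: "continuous_on UNIV \<phi>" "(\<integral>\<^sup>+x. ennreal \<bar>?F x - \<phi> x\<bar> \<partial>lborel) \<le> ennreal (e / 4)"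
    using integrable_approx_continuous[OF int, rule_format, of "e / 4" 0 "R + 1"] \<open>0 < e\<close> by auto
  have [measurable]: "\<phi> \<in> borel_measurable borel"
    using \<phi> by (auto intro: borel_measurable_continuous_onI)
  define V where "V = measure lborel (ball (0::'a) R)"
  have V: "emeasure lborel (ball (0::'a) R) = ennreal V" "0 \<le> V"
    using emeasure_lborel_ball_finite[of "0::'a" R] by (auto simp: V_def emeasure_eq_ennreal_measure)
  define \<epsilon> where "\<epsilon> = e / (2 * (V + 1))"
  have \<epsilon>: "0 < \<epsilon>" "\<epsilon> * V \<le> e / 2"
    using V \<open>0 < e\<close> by (auto simp: \<epsilon>_def field_simps)
  have "uniformly_continuous_on (cball 0 (R + 1)) \<phi>"
    using \<phi>(1) by (intro compact_uniformly_continuous) (auto intro: continuous_on_subset)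
  then obtain d where d: "0 < d" "\<And>x x'. x \<in> cball 0 (R + 1) \<Longrightarrow> x' \<in> cball 0 (R + 1) \<Longrightarrow> dist x' x < d \<Longrightarrow> dist (\<phi> x') (\<phi> x) < \<epsilon>"
    using \<epsilon>(1) unfolding uniformly_continuous_on_def by blast
  show thesis
  proof (rule that[of "min d 1"])
    show "0 < min d 1" using d by simp
    fix y :: 'a assume y: "norm y < min d 1"
    have "(\<integral>\<^sup>+x\<in>ball 0 R. ennreal \<bar>F (x - y) - F x\<bar> \<partial>lborel)
      \<le> (\<integral>\<^sup>+x. ennreal \<bar>?F (x + - y) - \<phi> (x + - y)\<bar> + ennreal \<bar>?F x - \<phi> x\<bar> + ennreal \<epsilon> * indicator (ball 0 R) x \<partial>lborel)"
    proof (rule nn_integral_mono)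
      fix x
      show "ennreal \<bar>F (x - y) - F x\<bar> * indicator (ball 0 R) x
        \<le> ennreal \<bar>?F (x + - y) - \<phi> (x + - y)\<bar> + ennreal \<bar>?F x - \<phi> x\<bar> + ennreal \<epsilon> * indicator (ball 0 R) x"
      proof (cases "x \<in> ball 0 R")
        case True
        have "norm (x - y) < R + 1"
          using True y norm_triangle_ineq4[of x y] by simp
        then have in1: "x - y \<in> ball 0 (R + 1)" "x \<in> ball 0 (R + 1)" using True by auto
        have "dist (\<phi> (x - y)) (\<phi> x) < \<epsilon>"
          using in1 y by (intro d(2)) (auto simp: dist_norm)
        then have "\<bar>F (x - y) - F x\<bar> \<le> \<bar>?F (x + - y) - \<phi> (x + - y)\<bar> + \<bar>?F x - \<phi> x\<bar> + \<epsilon>"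
          using in1 by (simp add: dist_real_def)
        then show ?thesis using True \<epsilon>(1)
          by (simp add: ennreal_plus[symmetric] ennreal_leI del: ennreal_plus)
      qed simp
    qed
    also have "\<dots> = (\<integral>\<^sup>+x. ennreal \<bar>?F (x + - y) - \<phi> (x + - y)\<bar> \<partial>lborel) + (\<integral>\<^sup>+x. ennreal \<bar>?F x - \<phi> x\<bar> \<partial>lborel) + ennreal \<epsilon> * ennreal V"
      by (simp add: nn_integral_add nn_integral_cmult_indicator V)
    also have "(\<integral>\<^sup>+x. ennreal \<bar>?F (x + - y) - \<phi> (x + - y)\<bar> \<partial>lborel) = (\<integral>\<^sup>+x. ennreal \<bar>?F x - \<phi> x\<bar> \<partial>lborel)"
      by (rule nn_integral_lborel_translate) measurable
    also have "(\<integral>\<^sup>+x. ennreal \<bar>?F x - \<phi> x\<bar> \<partial>lborel) + (\<integral>\<^sup>+x. ennreal \<bar>?F x - \<phi> x\<bar> \<partial>lborel) + ennreal \<epsilon> * ennreal V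
      \<le> ennreal (e / 4) + ennreal (e / 4) + ennreal (e / 2)"
      using \<phi>(2) \<epsilon> V by (intro add_mono) (auto simp: ennreal_mult'[symmetric] intro: ennreal_leI)
    also have "\<dots> = ennreal e"
      using \<open>0 < e\<close> by (subst ennreal_plus[symmetric], simp, simp, subst ennreal_plus[symmetric]) auto
    finally show "(\<integral>\<^sup>+x\<in>ball 0 R. ennreal \<bar>F (x - y) - F x\<bar> \<partial>lborel) \<le> ennreal e" .
  qed
qed

text \<open>Boundedness and bounded support make the convolution with a locally integrable function
  absolutely convergent; the mass 1 lets the convolution be compared with the function
  itself.\<close>

definition mollifier :: "real \<Rightarrow> ('a::euclidean_space \<Rightarrow> real) \<Rightarrow> bool" where
  "mollifier d K \<longleftrightarrow> K \<in> borel_measurable borel \<and> (\<forall>z. 0 \<le> K z) \<and> (\<forall>z. d \<le> norm z \<longrightarrow> K z = 0) \<and>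
     (\<exists>B. \<forall>z. K z \<le> B) \<and> (\<integral>\<^sup>+z. ennreal (K z) \<partial>lborel) = 1"

text \<open>The absolute value stands inside the average. This dominates the distance between
  \<open>F\<close> and its convolution with \<open>K\<close>, and its integral over a ball reduces
  by Tonelli to the translation errors of \<open>F\<close>.\<close>

definition mollify_err :: "('a::euclidean_space \<Rightarrow> real) \<Rightarrow> ('a \<Rightarrow> real) \<Rightarrow> 'a \<Rightarrow> ennreal" where
  "mollify_err K F x = (\<integral>\<^sup>+y. ennreal (K y) * ennreal \<bar>F (x - y) - F x\<bar> \<partial>lborel)"

text \<open>The radius \<open>d\<close> works for every mollifier of that radius, so a single
  \<open>K\<close> can later serve both \<open>F\<close> and the majorant \<open>g\<close>.\<close>

lemma mollify_err_L1:
  fixes F :: "'a::euclidean_space \<Rightarrow> real"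
  assumes [measurable]: "F \<in> borel_measurable borel"
    and int: "\<And>x r. integrable lborel (\<lambda>y. indicator (ball x r) y * F y)"
    and "0 \<le> R" "0 < e"
  obtains d where "0 < d" "\<And>K. mollifier d K \<Longrightarrow> (\<integral>\<^sup>+x\<in>ball 0 R. mollify_err K F x \<partial>lborel) \<le> ennreal e"
proof -
  obtain d where d: "0 < d" "\<And>y. norm y < d \<Longrightarrow> (\<integral>\<^sup>+x\<in>ball 0 R. ennreal \<bar>F (x - y) - F x\<bar> \<partial>lborel) \<le> ennreal e"
    using translation_continuous_L1[OF assms] by blast
  have [measurable]: "ball (0::'a) r \<in> sets borel" for r by simp
  show thesis
  proof (rule that[OF d(1)])
    fix K :: "'a \<Rightarrow> real" assume K: "mollifier d K"
    then have [measurable]: "K \<in> borel_measurable borel" by (simp add: mollifier_def)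
    have "(\<integral>\<^sup>+x\<in>ball 0 R. mollify_err K F x \<partial>lborel) =
      (\<integral>\<^sup>+x. \<integral>\<^sup>+y. ennreal (K y) * (ennreal \<bar>F (x - y) - F x\<bar> * indicator (ball 0 R) x) \<partial>lborel \<partial>lborel)"
      unfolding mollify_err_def by (intro nn_integral_cong) (auto simp: indicator_def)
    also have "\<dots> = (\<integral>\<^sup>+y. \<integral>\<^sup>+x. ennreal (K y) * (ennreal \<bar>F (x - y) - F x\<bar> * indicator (ball 0 R) x) \<partial>lborel \<partial>lborel)"
      by (rule lborel_pair.Fubini'[symmetric]) measurable
    also have "\<dots> \<le> (\<integral>\<^sup>+y. ennreal (K y) * ennreal e \<partial>lborel)"
    proof (rule nn_integral_mono)
      fix y
      show "(\<integral>\<^sup>+x. ennreal (K y) * (ennreal \<bar>F (x - y) - F x\<bar> * indicator (ball 0 R) x) \<partial>lborel) \<le> ennreal (K y) * ennreal e"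
      proof (cases "norm y < d")
        case True
        then show ?thesis by (simp add: nn_integral_cmult mult_left_mono d(2))
      next
        case False
        then have "K y = 0" using K by (simp add: mollifier_def)
        then show ?thesis by simp
      qed
    qed
    also have "\<dots> = ennreal e"
      using K by (simp add: nn_integral_multc mollifier_def)
    finally show "(\<integral>\<^sup>+x\<in>ball 0 R. mollify_err K F x \<partial>lborel) \<le> ennreal e" .
  qed
qed

lemma integrable_mollify:
  fixes F :: "'a::euclidean_space \<Rightarrow> real"
  assumes [measurable]: "F \<in> borel_measurable borel"
    and int: "\<And>x r. integrable lborel (\<lambda>y. indicator (ball x r) y * F y)"
    and K: "mollifier d K"
  shows "integrable lborel (\<lambda>y. F (x - y) * K y)"
proof -
  have [measurable]: "K \<in> borel_measurable borel" using K by (simp add: mollifier_def)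
  obtain B where B: "\<And>z. K z \<le> B" using K by (auto simp: mollifier_def)
  have K0: "0 \<le> K z" for z using K by (simp add: mollifier_def)
  have "integrable lborel (\<lambda>u. indicator (ball x d) (x + (-1) *\<^sub>R u) * F (x + (-1) *\<^sub>R u))"
    by (rule integrable_lborel_affine[OF int]) simp
  then have "integrable lborel (\<lambda>u. B * (indicator (ball x d) (x - u) * F (x - u)))"
    by simp
  then show ?thesis
  proof (rule Bochner_Integration.integrable_bound)
    show "AE y in lborel. norm (F (x - y) * K y) \<le> norm (B * (indicator (ball x d) (x - y) * F (x - y)))"
    proof (intro AE_I2)
      fix y
      show "norm (F (x - y) * K y) \<le> norm (B * (indicator (ball x d) (x - y) * F (x - y)))"
      proof (cases "norm y < d")
        case True
        have "\<bar>F (x - y)\<bar> * \<bar>K y\<bar> \<le> \<bar>F (x - y)\<bar> * \<bar>B\<bar>"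
          using B[of y] K0[of y] by (intro mult_left_mono) auto
        then show ?thesis using True by (simp add: abs_mult dist_norm mult_ac)
      next
        case False
        then have "K y = 0" using K by (simp add: mollifier_def)
        then show ?thesis by simp
      qed
    qed
  qed measurable
qed

lemma mollify_diff_le:
  fixes F :: "'a::euclidean_space \<Rightarrow> real"
  assumes [measurable]: "F \<in> borel_measurable borel"
    and int: "\<And>x r. integrable lborel (\<lambda>y. indicator (ball x r) y * F y)"
    and K: "mollifier d K"
  shows "ennreal \<bar>F x - (\<integral>y. F (x - y) * K y \<partial>lborel)\<bar> \<le> mollify_err K F x"
proof -
  have [measurable]: "K \<in> borel_measurable borel" using K by (simp add: mollifier_def)
  have K0: "0 \<le> K z" for z using K by (simp add: mollifier_def)
  have iK: "integrable lborel K" using K K0 by (simp add: integrable_iff_bounded mollifier_def)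
  have 1: "(\<integral>y. K y \<partial>lborel) = 1"
    using K K0 by (subst integral_eq_nn_integral) (auto simp: mollifier_def)
  have iF: "integrable lborel (\<lambda>y. F (x - y) * K y)" by (rule integrable_mollify[OF assms])
  have "(\<integral>y. (F (x - y) - F x) * K y \<partial>lborel) = (\<integral>y. F (x - y) * K y \<partial>lborel) - (\<integral>y. F x * K y \<partial>lborel)"
    unfolding left_diff_distrib by (rule Bochner_Integration.integral_diff) (use iF iK in auto)
  then have eq: "\<bar>F x - (\<integral>y. F (x - y) * K y \<partial>lborel)\<bar> = \<bar>\<integral>y. (F (x - y) - F x) * K y \<partial>lborel\<bar>"
    using 1 by simp
  have "integrable lborel (\<lambda>y. (F (x - y) - F x) * K y)"
    unfolding left_diff_distrib using iF iK by (intro Bochner_Integration.integrable_diff) auto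
  from integral_norm_bound_ennreal[OF this]
  have "ennreal (norm (\<integral>y. (F (x - y) - F x) * K y \<partial>lborel)) \<le> (\<integral>\<^sup>+y. ennreal (norm ((F (x - y) - F x) * K y)) \<partial>lborel)" .
  also have "\<dots> = mollify_err K F x"
    unfolding mollify_err_def using K0
    by (intro nn_integral_cong) (simp add: abs_mult ennreal_mult'[symmetric] mult.commute)
  finally show ?thesis using eq by simp
qed

lemma borel_measurable_mollify_err [measurable (raw)]:
  fixes F :: "'a::euclidean_space \<Rightarrow> real"
  assumes [measurable]: "F \<in> borel_measurable borel" "K \<in> borel_measurable borel" "x \<in> borel_measurable M"
  shows "(\<lambda>z. mollify_err K F (x z)) \<in> borel_measurable M"
  unfolding mollify_err_def by measurable

lemma set_nn_integral_translate_le: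
  fixes f :: "'a::euclidean_space \<Rightarrow> ennreal"
  assumes [measurable]: "f \<in> borel_measurable borel" and "norm v \<le> r"
  shows "(\<integral>\<^sup>+x\<in>ball 0 R. f (x + v) \<partial>lborel) \<le> (\<integral>\<^sup>+x\<in>ball 0 (R + r). f x \<partial>lborel)"
proof -
  have [measurable]: "ball (0::'a) s \<in> sets borel" for s by simp
  have "(\<integral>\<^sup>+x\<in>ball 0 R. f (x + v) \<partial>lborel) \<le> (\<integral>\<^sup>+x. f (x + v) * indicator (ball 0 (R + r)) (x + v) \<partial>lborel)"
  proof (rule nn_integral_mono)
    fix x
    have "norm (x + v) \<le> norm x + norm v" by (rule norm_triangle_ineq)
    then show "f (x + v) * indicator (ball 0 R) x \<le> f (x + v) * indicator (ball 0 (R + r)) (x + v)"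
      using assms(2) by (intro mult_left_mono) (auto simp: indicator_def)
  qed
  also have "\<dots> = (\<integral>\<^sup>+x\<in>ball 0 (R + r). f x \<partial>lborel)"
    by (rule nn_integral_lborel_translate) measurable
  finally show ?thesis .
qed

text \<open>No almost everywhere convergent subsequence is needed: on every bounded set the positive part
  of the difference of both sides has arbitrarily small integral.\<close>

lemma AE_fin_diff_le:
  fixes F g :: "'a::euclidean_space \<Rightarrow> real"
  assumes F [measurable]: "F \<in> borel_measurable borel" and g [measurable]: "g \<in> borel_measurable borel"
    and g0: "\<And>x. 0 \<le> g x" and D: "0 \<le> D"
    and intF: "\<And>x r. integrable lborel (\<lambda>y. indicator (ball x r) y * F y)"
    and intg: "\<And>x r. integrable lborel (\<lambda>y. indicator (ball x r) y * g y)"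
    and approx: "\<And>d. 0 < d \<Longrightarrow> \<exists>K. mollifier d K \<and>
      (\<forall>x h. ennreal \<bar>fin_diff k h (\<lambda>x. \<integral>y. F (x - y) * K y \<partial>lborel) x\<bar> \<le>
        ennreal (D * norm h ^ k) * (\<integral>\<^sup>+\<sigma>\<in>{0..real k}. (\<integral>\<^sup>+y. ennreal (K y) * ennreal (g (x + \<sigma> *\<^sub>R h - y)) \<partial>lborel) \<partial>lborel))"
  shows "AE z in lborel \<Otimes>\<^sub>M lborel. ennreal \<bar>fin_diff k (snd z) F (fst z)\<bar> \<le>
    ennreal (D * norm (snd z) ^ k) * (\<integral>\<^sup>+\<sigma>\<in>{0..real k}. ennreal (g (fst z + \<sigma> *\<^sub>R snd z)) \<partial>lborel)"
proof -
  let ?a = "\<lambda>z::'a \<times> 'a. ennreal \<bar>fin_diff k (snd z) F (fst z)\<bar>"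
  let ?b = "\<lambda>z::'a \<times> 'a. ennreal (D * norm (snd z) ^ k) * (\<integral>\<^sup>+\<sigma>\<in>{0..real k}. ennreal (g (fst z + \<sigma> *\<^sub>R snd z)) \<partial>lborel)"
  have [measurable]: "ball (0::'a) s \<in> sets borel" for s by simp
  have local: "AE z in lborel \<Otimes>\<^sub>M lborel. z \<in> ball 0 R \<times> ball 0 R \<longrightarrow> ?a z \<le> ?b z" if R: "0 < R" for R :: real
  proof -
    \<comment> \<open>For \<open>x\<close> and \<open>h\<close> in the ball of radius
      \<open>R\<close>, all points \<open>x + \<sigma> h\<close> with \<open>\<sigma>\<close>
      between 0 and \<open>k\<close> lie in the ball of radius \<open>?R\<close>.\<close>
    let ?B = "ball (0::'a) R" and ?R = "R + real k * R"
    define V where "V = measure lborel ?B"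
    have V: "emeasure lborel ?B = ennreal V" "0 \<le> V"
      using emeasure_lborel_ball_finite[of "0::'a" R] by (auto simp: V_def emeasure_eq_ennreal_measure)
    define C where "C = D * R ^ k * real k * V + 2 ^ k * V + 1"
    have C: "0 < C" using D R V by (auto simp: C_def intro!: add_nonneg_pos add_nonneg_nonneg)
    \<comment> \<open>Subtraction in \<open>ennreal\<close> stops at 0, so this is the positive
      part, also where \<open>?b\<close> is infinite.\<close>
    let ?f = "\<lambda>z. (?a z - ?b z) * indicator (?B \<times> ?B) z"
    let ?I = "(\<integral>\<^sup>+z. ?f z \<partial>(lborel \<Otimes>\<^sub>M lborel))"
    have "?I \<le> ennreal (C * e)" if e: "0 < e" for e
    proof -
      obtain d1 where d1: "0 < d1" "\<And>K. mollifier d1 K \<Longrightarrow> (\<integral>\<^sup>+x\<in>ball 0 ?R. mollify_err K F x \<partial>lborel) \<le> ennreal e"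
        using mollify_err_L1[OF F intF _ e, of ?R] R by auto
      obtain d2 where d2: "0 < d2" "\<And>K. mollifier d2 K \<Longrightarrow> (\<integral>\<^sup>+x\<in>ball 0 ?R. mollify_err K g x \<partial>lborel) \<le> ennreal e"
        using mollify_err_L1[OF g intg _ e, of ?R] R by auto
      obtain K where K: "mollifier (min d1 d2) K" and le: "\<And>x h. ennreal \<bar>fin_diff k h (\<lambda>x. \<integral>y. F (x - y) * K y \<partial>lborel) x\<bar> \<le>
        ennreal (D * norm h ^ k) * (\<integral>\<^sup>+\<sigma>\<in>{0..real k}. (\<integral>\<^sup>+y. ennreal (K y) * ennreal (g (x + \<sigma> *\<^sub>R h - y)) \<partial>lborel) \<partial>lborel)"
        using approx[of "min d1 d2"] d1(1) d2(1) by auto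
      have [measurable]: "K \<in> borel_measurable borel" using K by (simp add: mollifier_def)
      have K': "mollifier d1 K" "mollifier d2 K" using K by (auto simp: mollifier_def)
      let ?E = "mollify_err K F" and ?G = "mollify_err K g"
      have EF: "(\<integral>\<^sup>+x\<in>ball 0 R. ?E (x + c *\<^sub>R h) \<partial>lborel) \<le> ennreal e" "(\<integral>\<^sup>+x\<in>ball 0 R. ?G (x + c *\<^sub>R h) \<partial>lborel) \<le> ennreal e"
        if "0 \<le> c" "c \<le> real k" "h \<in> ?B" for c h
      proof -
        have "norm (c *\<^sub>R h) \<le> real k * R"
          using that by (simp add: mult_mono)
        then show "(\<integral>\<^sup>+x\<in>ball 0 R. ?E (x + c *\<^sub>R h) \<partial>lborel) \<le> ennreal e" "(\<integral>\<^sup>+x\<in>ball 0 R. ?G (x + c *\<^sub>R h) \<partial>lborel) \<le> ennreal e"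
          using order_trans[OF set_nn_integral_translate_le d1(2)[OF K'(1)]]
            order_trans[OF set_nn_integral_translate_le d2(2)[OF K'(2)]] by simp_all
      qed
      \<comment> \<open>The cost of replacing the mollified functions by the originals: for
        \<open>g\<close> along the segment, for \<open>F\<close> at the \<open>k + 1\<close> points
        of the difference.\<close>
      let ?r = "\<lambda>z. (\<integral>\<^sup>+\<sigma>. ennreal (D * R ^ k) * (?G (fst z + \<sigma> *\<^sub>R snd z) * indicator {0..real k} \<sigma>) \<partial>lborel) +
         (\<Sum>i\<in>{0..k}. ennreal (real (k choose i)) * ?E (fst z + real i *\<^sub>R snd z))"
      have main: "?a z \<le> ?b z + ?r z" if z: "z \<in> ?B \<times> ?B" for z
      proof -
        obtain x h where xh: "z = (x, h)" "h \<in> ?B" using z by auto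
        let ?F = "\<lambda>x. \<integral>y. F (x - y) * K y \<partial>lborel"
        have "\<bar>fin_diff k h F x\<bar> \<le> \<bar>fin_diff k h ?F x\<bar> + \<bar>fin_diff k h (\<lambda>y. F y - ?F y) x\<bar>"
          unfolding fin_diff_diff by linarith
        also have "\<bar>fin_diff k h (\<lambda>y. F y - ?F y) x\<bar> \<le> (\<Sum>i\<in>{0..k}. real (k choose i) * \<bar>F (x + real i *\<^sub>R h) - ?F (x + real i *\<^sub>R h)\<bar>)"
          unfolding fin_diff_def by (rule order_trans[OF sum_abs]) (simp add: abs_mult power_abs)
        finally have "?a z \<le> ennreal \<bar>fin_diff k h ?F x\<bar> + (\<Sum>i\<in>{0..k}. ennreal (real (k choose i)) * ennreal \<bar>F (x + real i *\<^sub>R h) - ?F (x + real i *\<^sub>R h)\<bar>)"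
          unfolding xh(1) by (simp add: ennreal_mult'[symmetric] sum_ennreal ennreal_plus[symmetric] sum_nonneg ennreal_leI del: ennreal_plus)
        also have "\<dots> \<le> ennreal \<bar>fin_diff k h ?F x\<bar> + (\<Sum>i\<in>{0..k}. ennreal (real (k choose i)) * ?E (x + real i *\<^sub>R h))"
          by (intro add_left_mono sum_mono mult_left_mono mollify_diff_le[OF F intF K]) auto
        also have "ennreal \<bar>fin_diff k h ?F x\<bar> \<le>
          ennreal (D * norm h ^ k) * (\<integral>\<^sup>+\<sigma>\<in>{0..real k}. ennreal (g (x + \<sigma> *\<^sub>R h)) + ?G (x + \<sigma> *\<^sub>R h) \<partial>lborel)"
        proof (rule order_trans[OF le], intro mult_left_mono nn_integral_mono mult_right_mono)
          fix \<sigma>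
          let ?y = "x + \<sigma> *\<^sub>R h"
          have "(\<integral>\<^sup>+y. ennreal (K y) * ennreal (g (?y - y)) \<partial>lborel) \<le>
             (\<integral>\<^sup>+y. ennreal (K y) * ennreal (g ?y) + ennreal (K y) * ennreal \<bar>g (?y - y) - g ?y\<bar> \<partial>lborel)"
          proof (rule nn_integral_mono)
            fix y
            have "ennreal (g (?y - y)) \<le> ennreal (g ?y) + ennreal \<bar>g (?y - y) - g ?y\<bar>"
            proof -
              have "g (?y - y) \<le> g ?y + \<bar>g (?y - y) - g ?y\<bar>" by linarith
              then have "ennreal (g (?y - y)) \<le> ennreal (g ?y + \<bar>g (?y - y) - g ?y\<bar>)"
                by (rule ennreal_leI)
              then show ?thesis using g0[of ?y] by (simp only: ennreal_plus abs_ge_zero)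
            qed
            then show "ennreal (K y) * ennreal (g (?y - y)) \<le> ennreal (K y) * ennreal (g ?y) + ennreal (K y) * ennreal \<bar>g (?y - y) - g ?y\<bar>"
              unfolding distrib_left[symmetric] by (rule mult_left_mono) simp
          qed
          also have "\<dots> = ennreal (g ?y) + ?G ?y"
            using K by (simp add: nn_integral_add nn_integral_multc mollify_err_def mollifier_def)
          finally show "(\<integral>\<^sup>+y. ennreal (K y) * ennreal (g (?y - y)) \<partial>lborel) \<le> ennreal (g ?y) + ?G ?y" .
        qed auto
        also have "\<dots> = ?b z + ennreal (D * norm h ^ k) * (\<integral>\<^sup>+\<sigma>\<in>{0..real k}. ?G (x + \<sigma> *\<^sub>R h) \<partial>lborel)"
          unfolding xh(1) by (simp add: distrib_right nn_integral_add distrib_left)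
        also have "ennreal (D * norm h ^ k) * (\<integral>\<^sup>+\<sigma>\<in>{0..real k}. ?G (x + \<sigma> *\<^sub>R h) \<partial>lborel) \<le>
            ennreal (D * R ^ k) * (\<integral>\<^sup>+\<sigma>\<in>{0..real k}. ?G (x + \<sigma> *\<^sub>R h) \<partial>lborel)"
          using xh(2) D by (intro mult_right_mono ennreal_leI mult_left_mono power_mono) auto
        finally show ?thesis
          unfolding xh(1) by (simp add: nn_integral_cmult add.assoc)
      qed
      have "?I \<le> (\<integral>\<^sup>+z. ?r z * indicator (?B \<times> ?B) z \<partial>(lborel \<Otimes>\<^sub>M lborel))"
      proof (rule nn_integral_mono)
        fix z
        show "?f z \<le> ?r z * indicator (?B \<times> ?B) z"
          using main[of z] by (cases "z \<in> ?B \<times> ?B") (auto simp: ennreal_minus_le_iff)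
      qed
      also have "\<dots> = (\<integral>\<^sup>+h. \<integral>\<^sup>+x. ?r (x, h) * indicator (?B \<times> ?B) (x, h) \<partial>lborel \<partial>lborel)"
        by (rule lborel_pair.nn_integral_snd[symmetric]) measurable
      also have "\<dots> \<le> (\<integral>\<^sup>+h. ennreal (D * R ^ k * real k * e + 2 ^ k * e) * indicator ?B h \<partial>lborel)"
      proof (rule nn_integral_mono)
        fix h
        show "(\<integral>\<^sup>+x. ?r (x, h) * indicator (?B \<times> ?B) (x, h) \<partial>lborel) \<le> ennreal (D * R ^ k * real k * e + 2 ^ k * e) * indicator ?B h"
        proof (cases "h \<in> ?B")
          case True
          let ?\<Gamma> = "\<lambda>x \<sigma>. ennreal (D * R ^ k) * (?G (x + \<sigma> *\<^sub>R h) * indicator {0..real k} \<sigma>) * indicator ?B x"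
          have "(\<integral>\<^sup>+x. ?r (x, h) * indicator (?B \<times> ?B) (x, h) \<partial>lborel) =
            (\<integral>\<^sup>+x. (\<integral>\<^sup>+\<sigma>. ?\<Gamma> x \<sigma> \<partial>lborel) +
              (\<Sum>i\<in>{0..k}. ennreal (real (k choose i)) * (?E (x + real i *\<^sub>R h) * indicator ?B x)) \<partial>lborel)"
            using True by (intro nn_integral_cong) (auto simp: indicator_def)
          also have "\<dots> = (\<integral>\<^sup>+x. (\<integral>\<^sup>+\<sigma>. ?\<Gamma> x \<sigma> \<partial>lborel) \<partial>lborel) +
              (\<Sum>i\<in>{0..k}. ennreal (real (k choose i)) * (\<integral>\<^sup>+x\<in>?B. ?E (x + real i *\<^sub>R h) \<partial>lborel))"
            by (simp add: nn_integral_add nn_integral_sum nn_integral_cmult del: sum_ennreal)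
          also have "(\<integral>\<^sup>+x. (\<integral>\<^sup>+\<sigma>. ?\<Gamma> x \<sigma> \<partial>lborel) \<partial>lborel)
             = (\<integral>\<^sup>+\<sigma>. (\<integral>\<^sup>+x. ?\<Gamma> x \<sigma> \<partial>lborel) \<partial>lborel)"
            by (rule lborel_pair.Fubini'[symmetric]) measurable
          also have "\<dots> \<le> (\<integral>\<^sup>+\<sigma>. ennreal (D * R ^ k * e) * indicator {0..real k} \<sigma> \<partial>lborel)"
          proof (rule nn_integral_mono)
            fix \<sigma> :: real
            show "(\<integral>\<^sup>+x. ?\<Gamma> x \<sigma> \<partial>lborel)
              \<le> ennreal (D * R ^ k * e) * indicator {0..real k} \<sigma>"
            proof (cases "\<sigma> \<in> {0..real k}")
              case s: True
              have "(\<integral>\<^sup>+x. ?\<Gamma> x \<sigma> \<partial>lborel)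
                = ennreal (D * R ^ k) * (\<integral>\<^sup>+x\<in>?B. ?G (x + \<sigma> *\<^sub>R h) \<partial>lborel)"
                using s by (simp add: mult.assoc nn_integral_cmult)
              also have "\<dots> \<le> ennreal (D * R ^ k) * ennreal e"
                using s True by (intro mult_left_mono EF) auto
              also have "\<dots> = ennreal (D * R ^ k * e)"
                using D R e by (subst ennreal_mult[symmetric]) auto
              finally show ?thesis using s by simp
            qed simp
          qed
          also have "\<dots> = ennreal (D * R ^ k * e) * ennreal (real k)"
            by (subst nn_integral_cmult_indicator) auto
          also have "\<dots> = ennreal (D * R ^ k * real k * e)"
            using D R e by (subst ennreal_mult[symmetric]) (auto simp: mult_ac)
          also have "(\<Sum>i\<in>{0..k}. ennreal (real (k choose i)) * (\<integral>\<^sup>+x\<in>?B. ?E (x + real i *\<^sub>R h) \<partial>lborel))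
             \<le> (\<Sum>i\<in>{0..k}. ennreal (real (k choose i)) * ennreal e)"
            using True by (intro sum_mono mult_left_mono EF) auto
          also have "\<dots> = ennreal (\<Sum>i\<in>{0..k}. real (k choose i) * e)"
            using e by (simp add: ennreal_mult'[symmetric] sum_ennreal)
          also have "(\<Sum>i\<in>{0..k}. real (k choose i) * e) = 2 ^ k * e"
            using choose_row_sum[of k]
            by (simp add: sum_distrib_right[symmetric] of_nat_sum[symmetric] atMost_atLeast0[symmetric] del: of_nat_sum)
          finally show ?thesis
            using True D R e by (simp add: add_left_mono add_right_mono)
        qed (simp add: indicator_def)
      qed
      also have "\<dots> = ennreal (D * R ^ k * real k * e + 2 ^ k * e) * ennreal V"
        by (subst nn_integral_cmult_indicator) (auto simp: V)
      also have "\<dots> \<le> ennreal (C * e)"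
        using D R e V by (subst ennreal_mult[symmetric]) (auto simp: C_def algebra_simps intro!: ennreal_leI)
      finally show ?thesis .
    qed note bound = this
    have "?I = 0"
    proof (rule ccontr)
      define I where "I = ?I"
      assume "?I \<noteq> 0"
      then have I0: "0 < I" unfolding I_def by (simp only: zero_less_iff_neq_zero not_False_eq_True)
      have "I < top"
        using bound[of 1] unfolding I_def[symmetric] by (simp add: le_less_trans)
      define c where "c = enn2real I"
      have c: "?I = ennreal c" "0 < c"
        using I0 \<open>I < top\<close> unfolding I_def[symmetric] c_def by (simp_all add: enn2real_positive_iff)
      \<comment> \<open>The choice \<open>e = c / (2 * C)\<close> gives
        \<open>c \<le> c / 2\<close>.\<close>
      have "ennreal c \<le> ennreal (C * (c / (2 * C)))"
        unfolding c(1)[symmetric] using c(2) C by (intro bound) auto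
      then show False using c(2) C by (subst (asm) ennreal_le_iff) auto
    qed
    then have "AE z in lborel \<Otimes>\<^sub>M lborel. ?f z = 0"
      by (subst (asm) nn_integral_0_iff_AE) measurable
    then show ?thesis
    proof eventually_elim
      case (elim z)
      show ?case
      proof
        assume "z \<in> ?B \<times> ?B"
        then have "?a z - ?b z = 0" using elim by simp
        then show "?a z \<le> ?b z" by (simp only: diff_eq_0_iff_ennreal)
      qed
    qed
  qed
  have "AE z in lborel \<Otimes>\<^sub>M lborel. \<forall>n::nat. z \<in> ball 0 (real (Suc n)) \<times> ball 0 (real (Suc n)) \<longrightarrow> ?a z \<le> ?b z"
    unfolding AE_all_countable by (intro allI local) simp
  then show ?thesis
  proof eventually_elim
    case (elim z)
    obtain n :: nat where n: "max (norm (fst z)) (norm (snd z)) < real n" using reals_Archimedean2 by blast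
    then have "z \<in> ball 0 (real (Suc n)) \<times> ball 0 (real (Suc n))" by (cases z) auto
    then show ?case using elim by blast
  qed
qed

subsection \<open>Smooth bumps as test functions\<close>

text \<open>A smooth function of one variable carried together with all its derivatives:
  \<open>b m\<close> is the \<open>m\<close>-th derivative of \<open>b 0\<close>. Chain and Leibniz
  rules thus become closure properties of sequences.\<close>

definition smooth_seq :: "(nat \<Rightarrow> real \<Rightarrow> real) \<Rightarrow> bool" where
  "smooth_seq b \<longleftrightarrow> (\<forall>m x. (b m has_real_derivative b (Suc m) x) (at x))"

lemma smooth_seqD: "smooth_seq b \<Longrightarrow> (b m has_real_derivative b (Suc m) x) (at x)"
  by (simp add: smooth_seq_def)

lemma smooth_seq_affine:
  assumes "smooth_seq b"
  shows "smooth_seq (\<lambda>m x. r ^ m * b m (c + r * x))"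
  unfolding smooth_seq_def
proof (intro allI)
  fix m x
  have "((\<lambda>x. b m (c + r * x)) has_real_derivative b (Suc m) (c + r * x) * r) (at x)"
    by (rule DERIV_chain2[OF smooth_seqD[OF assms]]) (auto intro!: derivative_eq_intros)
  from DERIV_cmult[OF this, of "r ^ m"]
  show "((\<lambda>x. r ^ m * b m (c + r * x)) has_real_derivative r ^ Suc m * b (Suc m) (c + r * x)) (at x)"
    by (simp add: mult_ac)
qed

lemma smooth_seq_mult:
  assumes a: "smooth_seq a" and b: "smooth_seq b"
  shows "smooth_seq (\<lambda>m x. \<Sum>j\<le>m. real (m choose j) * (a j x * b (m - j) x))"
  unfolding smooth_seq_def
proof (intro allI)
  fix m x
  have "((\<lambda>x. \<Sum>j\<le>m. real (m choose j) * (a j x * b (m - j) x)) has_real_derivative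
     (\<Sum>j\<le>m. real (m choose j) * (a (Suc j) x * b (m - j) x + b (Suc (m - j)) x * a j x))) (at x)"
    by (intro DERIV_sum DERIV_cmult DERIV_mult smooth_seqD a b)
  moreover have "(\<Sum>j\<le>m. real (m choose j) * (a (Suc j) x * b (m - j) x + b (Suc (m - j)) x * a j x))
    = (\<Sum>j\<le>Suc m. real (Suc m choose j) * (a j x * b (Suc m - j) x))"
  proof -
    have "(\<Sum>j\<le>m. real (m choose j) * (b (Suc (m - j)) x * a j x)) = (\<Sum>j\<le>Suc m. real (m choose j) * (a j x * b (Suc m - j) x))"
      by (simp add: binomial_eq_0 Suc_diff_le mult_ac)
    also have "\<dots> = a 0 x * b (Suc m) x + (\<Sum>j\<le>m. real (m choose Suc j) * (a (Suc j) x * b (m - j) x))"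
      by (subst sum.atMost_Suc_shift) simp
    finally have "(\<Sum>j\<le>m. real (m choose j) * (a (Suc j) x * b (m - j) x + b (Suc (m - j)) x * a j x))
       = a 0 x * b (Suc m) x + (\<Sum>j\<le>m. real (Suc m choose Suc j) * (a (Suc j) x * b (m - j) x))"
      by (simp add: distrib_left distrib_right sum.distrib)
    also have "\<dots> = (\<Sum>j\<le>Suc m. real (Suc m choose j) * (a j x * b (Suc m - j) x))"
      by (subst sum.atMost_Suc_shift) simp
    finally show ?thesis .
  qed
  ultimately show "((\<lambda>x. \<Sum>j\<le>m. real (m choose j) * (a j x * b (m - j) x)) has_real_derivative
    (\<Sum>j\<le>Suc m. real (Suc m choose j) * (a j x * b (Suc m - j) x))) (at x)"
    by simp
qed

text \<open>The derivatives of \<open>exp (- (1 / x))\<close> for \<open>x > 0\<close> are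
  polynomials in \<open>1 / x\<close> times the same exponential. With \<open>t = 1 / x\<close> the
  derivative in \<open>x\<close> is \<open>- t ^ 2\<close> times that in \<open>t\<close>, which
  sends \<open>p\<close> to \<open>t ^ 2 * (p - p')\<close>.\<close>

primrec flat_poly :: "nat \<Rightarrow> real poly" where
  "flat_poly 0 = 1"
| "flat_poly (Suc m) = [:0, 0, 1:] * (flat_poly m - pderiv (flat_poly m))"

definition flat :: "nat \<Rightarrow> real \<Rightarrow> real" where
  "flat m x = (if 0 < x then poly (flat_poly m) (1 / x) * exp (- (1 / x)) else 0)"

lemma poly_times_exp_tendsto_0: "((\<lambda>t. poly p t * exp (- t)) \<longlongrightarrow> (0::real)) at_top"
proof -
  have "((\<lambda>t. \<Sum>i\<le>degree p. coeff p i * (t ^ i / exp t)) \<longlongrightarrow> (\<Sum>i\<le>degree p. coeff p i * 0)) at_top"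
    by (intro tendsto_sum tendsto_mult tendsto_const tendsto_power_div_exp_0)
  then show ?thesis
    by (simp add: poly_altdef sum_distrib_left exp_minus divide_inverse mult_ac)
qed

text \<open>Only \<open>x = 0\<close> is delicate: the right difference quotient there is again a
  polynomial in \<open>1 / y\<close> times \<open>exp (- (1 / y))\<close>, and the exponential
  wins.\<close>

lemma smooth_seq_flat: "smooth_seq flat"
  unfolding smooth_seq_def
proof (intro allI)
  fix m and x :: real
  consider "0 < x" | "x < 0" | "x = 0" by linarith
  then show "(flat m has_real_derivative flat (Suc m) x) (at x)"
  proof cases
    case 1
    have "((\<lambda>x. poly (flat_poly m) (1 / x) * exp (- (1 / x))) has_real_derivative flat (Suc m) x) (at x)"
      using 1 by (auto intro!: derivative_eq_intros DERIV_chain2[OF poly_DERIV]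
          simp: flat_def power2_eq_square field_simps)
    then show ?thesis
      by (rule has_field_derivative_transform_within_open[of _ _ _ "{0<..}"]) (use 1 in \<open>auto simp: flat_def\<close>)
  next
    case 2
    have "((\<lambda>x. 0) has_real_derivative flat (Suc m) x) (at x)"
      using 2 by (simp add: flat_def)
    then show ?thesis
      by (rule has_field_derivative_transform_within_open[of _ _ _ "{..<0}"]) (use 2 in \<open>auto simp: flat_def\<close>)
  next
    case 3
    have "((\<lambda>y. flat m y / y) \<longlongrightarrow> 0) (at_left 0)"
    proof (rule tendsto_eventually)
      show "\<forall>\<^sub>F y in at_left 0. flat m y / y = 0"
        by (auto simp: eventually_at_filter flat_def)
    qed
    moreover have "((\<lambda>y. flat m y / y) \<longlongrightarrow> 0) (at_right 0)"
    proof (rule Lim_transform_eventually)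
      \<comment> \<open>\<open>pCons 0\<close> multiplies the polynomial by its variable
        \<open>1 / y\<close>, which accounts for the division by \<open>y\<close> in the difference
        quotient.\<close>
      show "((\<lambda>y. poly (pCons 0 (flat_poly m)) (inverse y) * exp (- inverse y)) \<longlongrightarrow> 0) (at_right 0)"
        by (rule filterlim_compose[OF poly_times_exp_tendsto_0 filterlim_inverse_at_top_right])
      show "\<forall>\<^sub>F y in at_right 0. poly (pCons 0 (flat_poly m)) (inverse y) * exp (- inverse y) = flat m y / y"
        by (auto simp: eventually_at_filter flat_def field_simps)
    qed
    ultimately have "((\<lambda>y. flat m y / y) \<longlongrightarrow> 0) (at 0)"
      by (rule filterlim_split_at)
    then show ?thesis
      using 3 by (simp add: has_field_derivative_iff flat_def)
  qed
qed

text \<open>The product of a rescaled \<open>flat\<close> and its mirror image, one vanishing to the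
  left of \<open>- d\<close> and the other to the right of \<open>d\<close>. Every term of the
  Leibniz sum contains a factor that vanishes outside, endpoints included.\<close>

lemma bump_exists:
  assumes "0 < d"
  obtains b where "smooth_seq b" "\<And>x. 0 \<le> b 0 x" "0 < b 0 0" "\<And>m x. d \<le> \<bar>x\<bar> \<Longrightarrow> b m x = 0"
proof -
  let ?p = "\<lambda>m x. (1 / d) ^ m * flat m (1 + 1 / d * x)" and ?q = "\<lambda>m x. (- 1 / d) ^ m * flat m (1 + - 1 / d * x)"
  define b where "b = (\<lambda>m x. \<Sum>j\<le>m. real (m choose j) * (?p j x * ?q (m - j) x))"
  have "smooth_seq b"
    unfolding b_def by (intro smooth_seq_mult smooth_seq_affine smooth_seq_flat)
  moreover have b0: "b 0 x = flat 0 (1 + 1 / d * x) * flat 0 (1 + - 1 / d * x)" for x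
    unfolding b_def by (subst atMost_0) simp
  moreover have "0 \<le> b 0 x" for x unfolding b0 by (intro mult_nonneg_nonneg) (auto simp: flat_def)
  moreover have "0 < b 0 0" unfolding b0 by (simp add: flat_def)
  moreover have "b m x = 0" if "d \<le> \<bar>x\<bar>" for m x
  proof -
    have "1 + 1 / d * x \<le> 0 \<or> 1 + - 1 / d * x \<le> 0"
      using that assms by (auto simp: field_simps abs_if split: if_splits)
    then show ?thesis by (auto simp: b_def flat_def)
  qed
  ultimately show thesis using that by blast
qed

text \<open>A tensor product of one-dimensional functions, differentiated \<open>m i\<close> times
  in the direction \<open>i\<close>. The family is closed under partial derivatives, each of which
  raises one entry of \<open>m\<close>, so the order of differentiation is invisible.\<close>

definition prod_fun :: "('n::finite \<Rightarrow> nat \<Rightarrow> real \<Rightarrow> real) \<Rightarrow> ('n \<Rightarrow> nat) \<Rightarrow> real ^ 'n \<Rightarrow> real" where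
  "prod_fun b m y = (\<Prod>i\<in>UNIV. b i (m i) (y $ i))"

lemma has_derivative_prod_fun:
  assumes b: "\<And>i. smooth_seq (b i)"
  shows "(prod_fun b m has_derivative (\<lambda>v. \<Sum>i\<in>UNIV. v $ i * prod_fun b (m(i := Suc (m i))) y)) (at y)"
proof -
  have 1: "((\<lambda>y. b i (m i) (y $ i)) has_derivative (\<lambda>v. v $ i * b i (Suc (m i)) (y $ i))) (at y)" for i
  proof -
    have "(b i (m i) has_derivative (*) (b i (Suc (m i)) (y $ i))) (at (y $ i))"
      using smooth_seqD[OF b] by (simp add: has_field_derivative_def)
    from has_derivative_compose[of "\<lambda>y. y $ i" "\<lambda>v. v $ i" y UNIV "b i (m i)", OF _ this]
    show ?thesis by (simp add: mult.commute bounded_linear_imp_has_derivative bounded_linear_vec_nth)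
  qed
  have "((\<lambda>y. \<Prod>i\<in>UNIV. b i (m i) (y $ i)) has_derivative
    (\<lambda>v. \<Sum>i\<in>UNIV. v $ i * b i (Suc (m i)) (y $ i) * (\<Prod>j\<in>UNIV - {i}. b j (m j) (y $ j)))) (at y)"
    by (rule has_derivative_prod) (rule 1)
  moreover have "b i (Suc (m i)) (y $ i) * (\<Prod>j\<in>UNIV - {i}. b j (m j) (y $ j)) = prod_fun b (m(i := Suc (m i))) y" for i
    unfolding prod_fun_def by (subst prod.remove[of UNIV i]) (auto intro!: prod.cong)
  ultimately show ?thesis by (simp add: prod_fun_def[abs_def] mult.assoc)
qed

lemma iter_partial_deriv_prod_fun:
  assumes b: "\<And>i. smooth_seq (b i)"
  shows "iter_partial_deriv is (prod_fun b m) = prod_fun b (\<lambda>i. m i + count_list is i)"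
proof (induction "is")
  case (Cons a "is")
  show ?case
  proof
    fix y
    let ?m = "\<lambda>i. m i + count_list is i"
    have "frechet_derivative (prod_fun b ?m) (at y) = (\<lambda>v. \<Sum>i\<in>UNIV. v $ i * prod_fun b (?m(i := Suc (?m i))) y)"
      by (rule frechet_derivative_at[OF has_derivative_prod_fun[of b, OF b], symmetric])
    then have "partial_deriv a (prod_fun b ?m) y = (\<Sum>i\<in>UNIV. axis a 1 $ i * prod_fun b (?m(i := Suc (?m i))) y)"
      by (simp add: partial_deriv_def)
    also have "\<dots> = prod_fun b (?m(a := Suc (?m a))) y"
      by (subst sum.remove[of UNIV a]) (auto simp: axis_def)
    also have "?m(a := Suc (?m a)) = (\<lambda>i. m i + count_list (a # is) i)"
      by auto
    finally show "iter_partial_deriv (a # is) (prod_fun b m) y = prod_fun b (\<lambda>i. m i + count_list (a # is) i) y"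
      using Cons by simp
  qed
qed simp

lemma prod_fun_test_function:
  fixes c :: "real ^ 'n"
  assumes b: "\<And>i. smooth_seq (b i)" and supp: "\<And>i t. d \<le> \<bar>c $ i - t\<bar> \<Longrightarrow> b i 0 t = 0"
  shows "prod_fun b (\<lambda>_. 0) \<in> test_functions"
proof -
  have "{x. prod_fun b (\<lambda>_. 0) x \<noteq> 0} \<subseteq> cball c (real CARD('n) * d)"
  proof
    fix x assume "x \<in> {x. prod_fun b (\<lambda>_. 0) x \<noteq> 0}"
    then have "\<bar>c $ i - x $ i\<bar> \<le> d" for i
      using supp[of i "x $ i"] by (force simp: prod_fun_def)
    then have "(\<Sum>i\<in>UNIV. \<bar>(c - x) $ i\<bar>) \<le> (\<Sum>i\<in>(UNIV :: 'n set). d)"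
      by (intro sum_mono) simp
    then show "x \<in> cball c (real CARD('n) * d)"
      using norm_le_l1_cart[of "c - x"] by (simp add: dist_norm)
  qed
  then have "bounded {x. prod_fun b (\<lambda>_. 0) x \<noteq> 0}"
    using bounded_cball bounded_subset by blast
  moreover have "iter_partial_deriv is (prod_fun b (\<lambda>_. 0)) differentiable (at x)" for "is" x
    unfolding iter_partial_deriv_prod_fun[OF b] differentiable_def
    using has_derivative_prod_fun[of b, OF b] by blast
  ultimately show ?thesis by (simp add: test_functions_def)
qed

text \<open>Weak derivatives are tested along lists of directions; this provides a list that
  realises a given multi-index.\<close>

lemma ex_count_list:
  fixes m :: "'n::finite \<Rightarrow> nat"
  obtains xs where "\<And>i. count_list xs i = m i"
proof -
  have "\<exists>xs. \<forall>i. count_list xs i = (if i \<in> A then m i else 0)" if "finite A" for A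
    using that
  proof (induction A)
    case (insert a A)
    then obtain xs where xs: "\<forall>i. count_list xs i = (if i \<in> A then m i else 0)" by blast
    have rep: "count_list (replicate l a) i = (if i = a then l else 0)" for l and i :: 'n
      by (induction l) auto
    show ?case
      using xs insert.hyps by (intro exI[of _ "replicate (m a) a @ xs"]) (auto simp: rep)
  qed (auto intro: exI[of _ "[]"])
  from this[of UNIV] show thesis using that by auto
qed

subsection \<open>Finite differences of convolutions\<close>

lemma fin_diff_Suc: "fin_diff (Suc k) h f x = fin_diff k h f (x + h) - fin_diff k h f x"
proof -
  let ?A = "\<lambda>j. f (x + real j *\<^sub>R h)"
  have "fin_diff (Suc k) h f x = (-1) ^ Suc k * ?A 0 + (\<Sum>j\<le>k. (-1) ^ (k - j) * real (Suc k choose Suc j) * ?A (Suc j))"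
    unfolding fin_diff_def atMost_atLeast0[symmetric] by (subst sum.atMost_Suc_shift) simp
  also have "(\<Sum>j\<le>k. (-1) ^ (k - j) * real (Suc k choose Suc j) * ?A (Suc j)) =
    (\<Sum>j\<le>k. (-1) ^ (k - j) * real (k choose j) * ?A (Suc j)) + (\<Sum>j\<le>k. (-1) ^ (k - j) * real (k choose Suc j) * ?A (Suc j))"
    unfolding sum.distrib[symmetric] by (intro sum.cong) (simp_all add: algebra_simps)
  also have "(\<Sum>j\<le>k. (-1) ^ (k - j) * real (k choose j) * ?A (Suc j)) = fin_diff k h f (x + h)"
    unfolding fin_diff_def atMost_atLeast0[symmetric] by (intro sum.cong) (simp_all add: algebra_simps)
  also have "(-1) ^ Suc k * ?A 0 + (fin_diff k h f (x + h) + (\<Sum>j\<le>k. (-1) ^ (k - j) * real (k choose Suc j) * ?A (Suc j)))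
    = fin_diff k h f (x + h) + (\<Sum>j\<le>Suc k. (-1) ^ (Suc k - j) * real (k choose j) * ?A j)"
    by (subst sum.atMost_Suc_shift) simp
  also have "(\<Sum>j\<le>Suc k. (-1) ^ (Suc k - j) * real (k choose j) * ?A j) = (\<Sum>j\<le>k. (-1) ^ (Suc k - j) * real (k choose j) * ?A j)"
    by (simp add: binomial_eq_0)
  also have "\<dots> = - fin_diff k h f x"
    unfolding fin_diff_def atMost_atLeast0[symmetric] sum_negf[symmetric]
    by (intro sum.cong) (auto simp: Suc_diff_le)
  finally show ?thesis by simp
qed

lemma fin_diff_shift: "fin_diff k h f (x + h) - fin_diff k h f x = fin_diff k h (\<lambda>y. f (y + h) - f y) x"
  by (simp add: fin_diff_def sum_subtractf[symmetric] algebra_simps)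

text \<open>\<open>U j\<close> plays the role of the \<open>j\<close>-th derivative along
  \<open>h\<close>. Each order of the difference is turned by the fundamental theorem into one
  integration over the unit interval, and the \<open>k\<close> nested integrations together run over
  parameters between 0 and \<open>k\<close>.\<close>

lemma fin_diff_le_integral:
  fixes U :: "nat \<Rightarrow> 'a::euclidean_space \<Rightarrow> real"
  assumes meas [measurable]: "\<And>j. U j \<in> borel_measurable borel"
    and int: "\<And>j x. integrable lborel (\<lambda>r. indicator {0..1} r * U j (x + r *\<^sub>R h))"
    and ftc: "\<And>j x. U j (x + h) - U j x = (\<integral>r. indicator {0..1} r * U (Suc j) (x + r *\<^sub>R h) \<partial>lborel)"
    and k: "1 \<le> k"
  shows "ennreal \<bar>fin_diff k h (U j) x\<bar> \<le> (\<integral>\<^sup>+r\<in>{0..real k}. ennreal \<bar>U (j + k) (x + r *\<^sub>R h)\<bar> \<partial>lborel)"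
proof -
  have step: "ennreal \<bar>fin_diff (Suc k) h (U j) x\<bar> \<le> (\<integral>\<^sup>+r\<in>{0..1}. ennreal \<bar>fin_diff k h (U (Suc j)) (x + r *\<^sub>R h)\<bar> \<partial>lborel)" for k j x
  proof -
    have "fin_diff (Suc k) h (U j) x = (\<Sum>i=0..k. (-1) ^ (k - i) * real (k choose i) *
        (\<integral>r. indicator {0..1} r * U (Suc j) ((x + real i *\<^sub>R h) + r *\<^sub>R h) \<partial>lborel))"
      unfolding fin_diff_Suc fin_diff_shift ftc by (simp add: fin_diff_def)
    also have "\<dots> = (\<integral>r. (\<Sum>i=0..k. (-1) ^ (k - i) * real (k choose i) *
        (indicator {0..1} r * U (Suc j) ((x + real i *\<^sub>R h) + r *\<^sub>R h))) \<partial>lborel)"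
      by (subst Bochner_Integration.integral_sum) (auto intro!: integrable_mult_right int)
    also have "\<dots> = (\<integral>r. indicator {0..1} r * fin_diff k h (U (Suc j)) (x + r *\<^sub>R h) \<partial>lborel)"
      by (intro Bochner_Integration.integral_cong) (auto simp: fin_diff_def sum_distrib_left algebra_simps)
    finally have eq: "fin_diff (Suc k) h (U j) x = (\<integral>r. indicator {0..1} r * fin_diff k h (U (Suc j)) (x + r *\<^sub>R h) \<partial>lborel)" .
    have "integrable lborel (\<lambda>r. \<Sum>i=0..k. (-1) ^ (k - i) * real (k choose i) *
        (indicator {0..1} r * U (Suc j) ((x + real i *\<^sub>R h) + r *\<^sub>R h)))"
      by (intro Bochner_Integration.integrable_sum integrable_mult_right int)
    then have "integrable lborel (\<lambda>r. indicator {0..1} r * fin_diff k h (U (Suc j)) (x + r *\<^sub>R h))"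
      by (simp add: fin_diff_def sum_distrib_left algebra_simps)
    from integral_norm_bound_ennreal[OF this]
    have "ennreal \<bar>fin_diff (Suc k) h (U j) x\<bar> \<le> (\<integral>\<^sup>+r. ennreal (norm (indicator {0..1} r * fin_diff k h (U (Suc j)) (x + r *\<^sub>R h))) \<partial>lborel)"
      unfolding eq by simp
    also have "\<dots> = (\<integral>\<^sup>+r\<in>{0..1}. ennreal \<bar>fin_diff k h (U (Suc j)) (x + r *\<^sub>R h)\<bar> \<partial>lborel)"
      by (intro nn_integral_cong) (auto simp: indicator_def)
    finally show ?thesis .
  qed
  show ?thesis using k
  proof (induction k arbitrary: j x rule: dec_induct)
    case base
    show ?case using step[of 0 j x] by (simp add: fin_diff_def)
  next
    case (step k)
    have "ennreal \<bar>fin_diff (Suc k) h (U j) x\<bar> \<le> (\<integral>\<^sup>+r\<in>{0..1}. ennreal \<bar>fin_diff k h (U (Suc j)) (x + r *\<^sub>R h)\<bar> \<partial>lborel)"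
      by (rule \<open>\<And>k j x. ennreal \<bar>fin_diff (Suc k) h (U j) x\<bar> \<le> _ k j x\<close>)
    also have "\<dots> \<le> (\<integral>\<^sup>+r\<in>{0..1::real}. (\<integral>\<^sup>+s\<in>{0..real (Suc k)}. ennreal \<bar>U (j + Suc k) (x + s *\<^sub>R h)\<bar> \<partial>lborel) \<partial>lborel)"
    proof (rule nn_integral_mono)
      fix r :: real
      show "ennreal \<bar>fin_diff k h (U (Suc j)) (x + r *\<^sub>R h)\<bar> * indicator {0..1} r
        \<le> (\<integral>\<^sup>+s\<in>{0..real (Suc k)}. ennreal \<bar>U (j + Suc k) (x + s *\<^sub>R h)\<bar> \<partial>lborel) * indicator {0..1} r"
      proof (cases "r \<in> {0..1}")
        case True
        have "ennreal \<bar>fin_diff k h (U (Suc j)) (x + r *\<^sub>R h)\<bar>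
           \<le> (\<integral>\<^sup>+s\<in>{0..real k}. ennreal \<bar>U (Suc j + k) (x + r *\<^sub>R h + s *\<^sub>R h)\<bar> \<partial>lborel)"
          by (rule step.IH)
        \<comment> \<open>The parameters add up. The interval from \<open>r\<close> to
          \<open>r + k\<close> is enlarged to \<open>{0..real (Suc k)}\<close>, after which
          \<open>r\<close> has disappeared and its integration costs a factor 1.\<close>
        also have "\<dots> \<le> (\<integral>\<^sup>+s. ennreal \<bar>U (j + Suc k) (x + (s + r) *\<^sub>R h)\<bar> * indicator {0..real (Suc k)} (s + r) \<partial>lborel)"
          using True by (intro nn_integral_mono) (auto simp: indicator_def algebra_simps)
        also have "\<dots> = (\<integral>\<^sup>+s\<in>{0..real (Suc k)}. ennreal \<bar>U (j + Suc k) (x + s *\<^sub>R h)\<bar> \<partial>lborel)"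
          by (rule nn_integral_lborel_translate) measurable
        finally show ?thesis using True by simp
      qed simp
    qed
    also have "\<dots> = (\<integral>\<^sup>+s\<in>{0..real (Suc k)}. ennreal \<bar>U (j + Suc k) (x + s *\<^sub>R h)\<bar> \<partial>lborel)"
      by (subst nn_integral_cmult_indicator) auto
    finally show ?case .
  qed
qed

section \<open>Convolution with kernels of bounded support\<close>

lemma integrable_mult_bounded_support:
  fixes F :: "'a::euclidean_space \<Rightarrow> real"
  assumes [measurable]: "F \<in> borel_measurable borel" "K \<in> borel_measurable borel"
    and int: "\<And>x r. integrable lborel (\<lambda>y. indicator (ball x r) y * F y)"
    and B: "\<And>z. \<bar>K z\<bar> \<le> B" and supp: "\<And>z. d \<le> norm z \<Longrightarrow> K z = 0"
  shows "integrable lborel (\<lambda>y. F y * K (x - y))"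
proof -
  have "integrable lborel (\<lambda>y. B * (indicator (ball x d) y * F y))"
    using int[of x d] by simp
  then show ?thesis
  proof (rule Bochner_Integration.integrable_bound)
    show "AE y in lborel. norm (F y * K (x - y)) \<le> norm (B * (indicator (ball x d) y * F y))"
    proof (intro AE_I2)
      fix y
      show "norm (F y * K (x - y)) \<le> norm (B * (indicator (ball x d) y * F y))"
      proof (cases "norm (x - y) < d")
        case True
        have "\<bar>F y\<bar> * \<bar>K (x - y)\<bar> \<le> \<bar>F y\<bar> * \<bar>B\<bar>"
          using B[of "x - y"] by (intro mult_left_mono) auto
        then show ?thesis using True by (simp add: abs_mult dist_norm mult_ac)
      next
        case False
        then have "K (x - y) = 0" using supp by simp
        then show ?thesis by simp
      qed
    qed
  qed measurable
qed

lemma integral_convolution_line: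
  fixes F :: "'a::euclidean_space \<Rightarrow> real"
  assumes F [measurable]: "F \<in> borel_measurable borel" and K [measurable]: "K \<in> borel_measurable borel"
    and int: "\<And>x r. integrable lborel (\<lambda>y. indicator (ball x r) y * F y)"
    and B: "\<And>z. \<bar>K z\<bar> \<le> B" and supp: "\<And>z. d \<le> norm z \<Longrightarrow> K z = 0"
  shows "integrable lborel (\<lambda>r. indicator {0..1} r * (\<integral>y. F y * K (x + r *\<^sub>R h - y) \<partial>lborel))"
    and "(\<integral>r. indicator {0..1} r * (\<integral>y. F y * K (x + r *\<^sub>R h - y) \<partial>lborel) \<partial>lborel) =
      (\<integral>y. F y * (\<integral>r. indicator {0..1} r * K (x - y + r *\<^sub>R h) \<partial>lborel) \<partial>lborel)"
proof -
  \<comment> \<open>For parameters between 0 and 1 the moving kernel sees \<open>F\<close> only in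
    the ball of this radius around \<open>x\<close>, which gives an integrable majorant for
    Fubini.\<close>
  let ?d = "norm h + d"
  have [measurable]: "ball x r \<in> sets borel" for r by simp
  have prod: "integrable (lborel \<Otimes>\<^sub>M lborel) (\<lambda>(r, y). indicator {0..1::real} r * (F y * K (x + r *\<^sub>R h - y)))"
    unfolding integrable_iff_bounded
  proof
    have "(\<integral>\<^sup>+z. ennreal (norm (case z of (r, y) \<Rightarrow> indicator {0..1::real} r * (F y * K (x + r *\<^sub>R h - y)))) \<partial>(lborel \<Otimes>\<^sub>M lborel))
      \<le> (\<integral>\<^sup>+z. (case z of (r, y) \<Rightarrow> indicator {0..1::real} r * ennreal (norm (B * (indicator (ball x ?d) y * F y)))) \<partial>(lborel \<Otimes>\<^sub>M lborel))"
    proof (rule nn_integral_mono, clarify)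
      fix r :: real and y
      show "ennreal (norm (indicator {0..1} r * (F y * K (x + r *\<^sub>R h - y)))) \<le> indicator {0..1} r * ennreal (norm (B * (indicator (ball x ?d) y * F y)))"
      proof (cases "r \<in> {0..1}")
        case True
        have "norm (F y * K (x + r *\<^sub>R h - y)) \<le> norm (B * (indicator (ball x ?d) y * F y))"
        proof (cases "norm (x + r *\<^sub>R h - y) < d")
          case d: True
          have "norm (x - y) \<le> norm (x + r *\<^sub>R h - y) + norm (r *\<^sub>R h)"
            using norm_triangle_ineq4[of "x + r *\<^sub>R h - y" "r *\<^sub>R h"] by (simp add: algebra_simps)
          also have "norm (r *\<^sub>R h) \<le> norm h" using True by (simp add: mult_left_le_one_le)
          finally have "y \<in> ball x ?d" using d by (simp add: dist_norm)
          moreover have "\<bar>F y\<bar> * \<bar>K (x + r *\<^sub>R h - y)\<bar> \<le> \<bar>F y\<bar> * \<bar>B\<bar>"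
            using B[of "x + r *\<^sub>R h - y"] by (intro mult_left_mono) auto
          ultimately show ?thesis by (simp add: abs_mult mult_ac)
        next
          case False
          then have "K (x + r *\<^sub>R h - y) = 0" using supp by simp
          then show ?thesis by simp
        qed
        then show ?thesis using True by (simp add: ennreal_leI)
      qed simp
    qed
    also have "\<dots> = (\<integral>\<^sup>+r. \<integral>\<^sup>+y. indicator {0..1::real} r * ennreal (norm (B * (indicator (ball x ?d) y * F y))) \<partial>lborel \<partial>lborel)"
      by (subst lborel.nn_integral_fst[symmetric]) (auto, measurable)
    also have "\<dots> = (\<integral>\<^sup>+y. ennreal (norm (B * (indicator (ball x ?d) y * F y))) \<partial>lborel)"
      by (simp add: nn_integral_cmult nn_integral_multc)
    also have "\<dots> < \<infinity>"
      using integrable_mult_right[OF int[of x ?d], of B] unfolding integrable_iff_bounded by blast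
    finally show "(\<integral>\<^sup>+z. ennreal (norm (case z of (r, y) \<Rightarrow> indicator {0..1::real} r * (F y * K (x + r *\<^sub>R h - y)))) \<partial>(lborel \<Otimes>\<^sub>M lborel)) < \<infinity>" .
  qed measurable
  from lborel_pair.integrable_fst[OF prod]
  show "integrable lborel (\<lambda>r. indicator {0..1} r * (\<integral>y. F y * K (x + r *\<^sub>R h - y) \<partial>lborel))"
    by simp
  have "(\<integral>r. (\<integral>y. indicator {0..1} r * (F y * K (x + r *\<^sub>R h - y)) \<partial>lborel) \<partial>lborel) =
     (\<integral>y. (\<integral>r. indicator {0..1} r * (F y * K (x + r *\<^sub>R h - y)) \<partial>lborel) \<partial>lborel)"
    by (rule lborel_pair.Fubini_integral[OF prod, symmetric])
  also have "\<dots> = (\<integral>y. F y * (\<integral>r. indicator {0..1} r * K (x - y + r *\<^sub>R h) \<partial>lborel) \<partial>lborel)"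
    by (subst Bochner_Integration.integral_mult_right_zero[symmetric]) (simp add: algebra_simps)
  finally show "(\<integral>r. indicator {0..1} r * (\<integral>y. F y * K (x + r *\<^sub>R h - y) \<partial>lborel) \<partial>lborel) =
      (\<integral>y. F y * (\<integral>r. indicator {0..1} r * K (x - y + r *\<^sub>R h) \<partial>lborel) \<partial>lborel)"
    by simp
qed

text \<open>The \<open>j\<close>-th derivative along \<open>h\<close> of the mixed partial
  derivative of order \<open>m\<close>, expanded into mixed partial derivatives. When
  \<open>j\<close> is used up, only pure tensor products with total order raised by \<open>j\<close>
  are left, to which weak derivatives apply.\<close>

primrec dir_deriv :: "(nat \<Rightarrow> real \<Rightarrow> real) \<Rightarrow> real ^ 'n \<Rightarrow> nat \<Rightarrow> ('n::finite \<Rightarrow> nat) \<Rightarrow> real ^ 'n \<Rightarrow> real" where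
  "dir_deriv b h 0 = prod_fun (\<lambda>_. b)"
| "dir_deriv b h (Suc j) = (\<lambda>m z. \<Sum>i\<in>UNIV. h $ i * dir_deriv b h j (m(i := Suc (m i))) z)"

lemma dir_deriv_line:
  assumes b: "smooth_seq b"
  shows "((\<lambda>t. dir_deriv b h j m (z + t *\<^sub>R h)) has_vector_derivative dir_deriv b h (Suc j) m (z + t *\<^sub>R h)) (at t)"
proof (induction j arbitrary: m)
  case 0
  have "((\<lambda>t. z + t *\<^sub>R h) has_derivative (\<lambda>s. s *\<^sub>R h)) (at t)"
    by (auto intro!: derivative_eq_intros)
  from has_derivative_compose[OF this has_derivative_prod_fun[of "\<lambda>_. b" m, OF b]]
  show ?case
    by (simp add: has_vector_derivative_def sum_distrib_left mult.assoc)
next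
  case (Suc j)
  have "((\<lambda>t. \<Sum>i\<in>UNIV. h $ i * dir_deriv b h j (m(i := Suc (m i))) (z + t *\<^sub>R h)) has_vector_derivative
    (\<Sum>i\<in>UNIV. h $ i * dir_deriv b h (Suc j) (m(i := Suc (m i))) (z + t *\<^sub>R h))) (at t)"
    by (intro has_vector_derivative_sum has_vector_derivative_mult_right Suc)
  then show ?case by simp
qed

lemma continuous_dir_deriv:
  assumes b: "smooth_seq b"
  shows "continuous_on UNIV (dir_deriv b h j m)"
proof (induction j arbitrary: m)
  case 0
  show ?case
    unfolding dir_deriv.simps
    by (intro continuous_at_imp_continuous_on ballI has_derivative_continuous[OF has_derivative_prod_fun[of "\<lambda>_. b", OF b]])
qed (auto intro!: continuous_intros)

text \<open>The norm is at most the sum of the coordinates in absolute value, so some coordinate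
  reaches the share \<open>d / n\<close>, and the factor belonging to it vanishes.\<close>

lemma prod_fun_support:
  fixes z :: "real ^ 'n"
  assumes b: "\<And>l t. d / real CARD('n) \<le> \<bar>t\<bar> \<Longrightarrow> b l t = 0" and z: "d \<le> norm z"
  shows "prod_fun (\<lambda>_. b) m z = 0"
proof -
  have "\<exists>i. d / real CARD('n) \<le> \<bar>z $ i\<bar>"
  proof (rule ccontr)
    assume "\<nexists>i. d / real CARD('n) \<le> \<bar>z $ i\<bar>"
    then have "(\<Sum>i\<in>UNIV. \<bar>z $ i\<bar>) < (\<Sum>i\<in>(UNIV :: 'n set). d / real CARD('n))"
      by (intro sum_strict_mono) (auto simp: not_le)
    then show False using norm_le_l1_cart[of z] z by simp
  qed
  then show ?thesis using b by (auto simp: prod_fun_def)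
qed

lemma dir_deriv_support:
  fixes z :: "real ^ 'n"
  assumes b: "\<And>l t. d / real CARD('n) \<le> \<bar>t\<bar> \<Longrightarrow> b l t = 0" and z: "d \<le> norm z"
  shows "dir_deriv b h j m z = 0"
  using prod_fun_support[of d b, OF b z] by (induction j arbitrary: m) auto

lemma dir_deriv_bounded:
  fixes h :: "real ^ 'n"
  assumes b: "smooth_seq b" and supp: "\<And>l t. d / real CARD('n) \<le> \<bar>t\<bar> \<Longrightarrow> b l t = 0"
  shows "\<exists>B. \<forall>z. \<bar>dir_deriv b h j m z\<bar> \<le> B"
proof -
  have "bounded (dir_deriv b h j m ` cball 0 d)"
    by (intro compact_imp_bounded compact_continuous_image continuous_on_subset[OF continuous_dir_deriv[OF b]]) auto
  then obtain B where B: "\<forall>z\<in>cball 0 d. \<bar>dir_deriv b h j m z\<bar> \<le> B"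
    unfolding bounded_iff by (auto simp del: mem_cball)
  have "\<bar>dir_deriv b h j m z\<bar> \<le> max B 0" for z
  proof (cases "norm z \<le> d")
    case True
    then show ?thesis using B by force
  next
    case False
    then show ?thesis using dir_deriv_support[of d b z, OF supp] by simp
  qed
  then show ?thesis by blast
qed

section \<open>Mollifying against weak derivatives\<close>

lemma integral_lborel_reflect:
  fixes f :: "'a::euclidean_space \<Rightarrow> real"
  assumes [measurable]: "f \<in> borel_measurable borel"
  shows "(\<integral>y. f (x - y) \<partial>lborel) = (\<integral>y. f y \<partial>lborel)"
proof -
  have eq: "(lborel :: 'a measure) = distr lborel borel (\<lambda>y. x - y)"
    using lborel_affine[of "-1" x] by (simp add: density_1)
  show ?thesis
    by (subst (2) eq, subst integral_distr) auto
qed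

lemma nn_integral_lborel_reflect:
  fixes f :: "'a::euclidean_space \<Rightarrow> ennreal"
  assumes "f \<in> borel_measurable borel"
  shows "(\<integral>\<^sup>+y. f (x - y) \<partial>lborel) = (\<integral>\<^sup>+y. f y \<partial>lborel)"
  using nn_integral_lborel_affine[OF assms, of "-1" x] by simp

text \<open>\<open>K\<close> is the normalised tensor bump. The \<open>k\<close>-th derivative along
  \<open>h\<close> of the convolution expands into \<open>n ^ k\<close> mixed derivatives with
  coefficients at most \<open>norm h ^ k\<close>. In each, the derivatives move from the kernel to
  \<open>G m\<close>, which is dominated by \<open>g\<close>; this is the origin of the constant
  \<open>n ^ k\<close>.\<close>

lemma weak_deriv_approx:
  fixes F g :: "real ^ 'n \<Rightarrow> real" and G :: "('n \<Rightarrow> nat) \<Rightarrow> real ^ 'n \<Rightarrow> real"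
  assumes F [measurable]: "F \<in> borel_measurable borel" and g [measurable]: "g \<in> borel_measurable borel"
    and G [measurable]: "\<And>m. G m \<in> borel_measurable borel"
    and intF: "\<And>x r. integrable lborel (\<lambda>y. indicator (ball x r) y * F y)"
    and intg: "\<And>x r. integrable lborel (\<lambda>y. indicator (ball x r) y * g y)"
    and Gg: "\<And>m x. (\<Sum>i\<in>UNIV. m i) = k \<Longrightarrow> \<bar>G m x\<bar> \<le> g x"
    and weak: "\<And>m \<phi> is. (\<Sum>i\<in>UNIV. m i) = k \<Longrightarrow> \<phi> \<in> test_functions \<Longrightarrow> (\<forall>i. count_list is i = m i) \<Longrightarrow>
      (\<integral>x. F x * iter_partial_deriv is \<phi> x \<partial>lborel) = (-1) ^ k * (\<integral>x. G m x * \<phi> x \<partial>lborel)"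
    and k: "1 \<le> k" and d: "0 < d"
  shows "\<exists>K. mollifier d K \<and>
      (\<forall>x h. ennreal \<bar>fin_diff k h (\<lambda>x. \<integral>y. F (x - y) * K y \<partial>lborel) x\<bar> \<le>
        ennreal (real CARD('n) ^ k * norm h ^ k) * (\<integral>\<^sup>+\<sigma>\<in>{0..real k}. (\<integral>\<^sup>+y. ennreal (K y) * ennreal (g (x + \<sigma> *\<^sub>R h - y)) \<partial>lborel) \<partial>lborel))"
proof -
  let ?n = "real CARD('n)"
  obtain b where b: "smooth_seq b" and b0: "\<And>x. 0 \<le> b 0 x" "0 < b 0 0" and supp: "\<And>l t. d / ?n \<le> \<bar>t\<bar> \<Longrightarrow> b l t = 0"
    using bump_exists[of "d / ?n"] d by auto
  let ?Z = "\<lambda>_::'n. 0::nat"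
  define Q where "Q = prod_fun (\<lambda>_::'n. b)"
  have Qd: "Q m = dir_deriv b 0 0 m" for m by (simp add: Q_def)
  have [measurable]: "dir_deriv b h j m \<in> borel_measurable borel" for h j and m :: "'n \<Rightarrow> nat"
    by (intro borel_measurable_continuous_onI continuous_dir_deriv b)
  have [measurable]: "Q m \<in> borel_measurable borel" for m unfolding Qd by measurable
  have Q0: "0 \<le> Q ?Z z" for z unfolding Q_def prod_fun_def by (intro prod_nonneg) (simp add: b0)
  have Qsupp: "Q ?Z z = 0" if "d \<le> norm z" for z
    unfolding Qd using dir_deriv_support[of d b, OF supp that] .
  have intD: "integrable lborel (\<lambda>y. F y * dir_deriv b h j m (x - y))" for h j m x
  proof -
    obtain B where B: "\<And>z. \<bar>dir_deriv b h j m z\<bar> \<le> B" using dir_deriv_bounded[OF b supp] by blast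
    show ?thesis
      by (rule integrable_mult_bounded_support[OF F _ intF B dir_deriv_support[of d b, OF supp]]) measurable
  qed
  \<comment> \<open>Induction on the number \<open>j\<close> of derivatives along \<open>h\<close>
    still to be expanded; the invariant is that the total order remains \<open>k\<close>, so the
    weak derivatives are used exactly at \<open>j = 0\<close>.\<close>
  have bound: "ennreal \<bar>\<integral>y. F y * dir_deriv b h j m (x - y) \<partial>lborel\<bar> \<le>
      ennreal ((?n * norm h) ^ j) * (\<integral>\<^sup>+y. ennreal (Q ?Z (x - y)) * ennreal (g y) \<partial>lborel)"
    if "(\<Sum>i\<in>UNIV. m i) + j = k" for j h m x
    using that
  proof (induction j arbitrary: m)
    case 0
    obtain xs where xs: "\<And>i. count_list xs i = m i" using ex_count_list[of m] by blast
    \<comment> \<open>The test function is the bump reflected and centred at \<open>x\<close>. The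
      sign \<open>(-1) ^ l\<close> from the reflection adds up to \<open>(-1) ^ k\<close> and
      cancels the sign in the weak derivative.\<close>
    define c where "c = (\<lambda>i l t. (-1) ^ l * b l (x $ i + -1 * t))"
    have c: "smooth_seq (c i)" for i unfolding c_def by (rule smooth_seq_affine[OF b])
    have \<phi>: "prod_fun c ?Z \<in> test_functions"
      by (rule prod_fun_test_function[of c "d / ?n" x, OF c]) (simp add: c_def supp)
    have \<phi>_eq: "prod_fun c m' y = (-1) ^ (\<Sum>i\<in>UNIV. m' i) * Q m' (x - y)" for m' y
      by (simp add: prod_fun_def c_def Q_def prod.distrib power_sum)
    have "(\<integral>y. F y * prod_fun c m y \<partial>lborel) = (-1) ^ k * (\<integral>y. G m y * prod_fun c ?Z y \<partial>lborel)"
      using weak[OF _ \<phi>, of m xs] 0 xs iter_partial_deriv_prod_fun[of c xs ?Z, OF c] by simp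
    moreover have "(\<integral>y. F y * prod_fun c m y \<partial>lborel) = (\<integral>y. (-1) ^ k * (F y * Q m (x - y)) \<partial>lborel)"
      using 0 by (intro Bochner_Integration.integral_cong) (auto simp: \<phi>_eq)
    ultimately have "(-1) ^ k * (\<integral>y. F y * Q m (x - y) \<partial>lborel) = (-1) ^ k * (\<integral>y. G m y * Q ?Z (x - y) \<partial>lborel)"
      by (simp add: \<phi>_eq)
    then have eq: "(\<integral>y. F y * Q m (x - y) \<partial>lborel) = (\<integral>y. G m y * Q ?Z (x - y) \<partial>lborel)" by simp
    obtain B where B: "\<And>z. \<bar>Q ?Z z\<bar> \<le> B" unfolding Qd using dir_deriv_bounded[OF b supp] by blast
    have ig: "integrable lborel (\<lambda>y. g y * Q ?Z (x - y))"
      by (rule integrable_mult_bounded_support[OF g _ intg B Qsupp]) measurable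
    have "integrable lborel (\<lambda>y. G m y * Q ?Z (x - y))"
    proof (rule Bochner_Integration.integrable_bound[OF ig])
      show "AE y in lborel. norm (G m y * Q ?Z (x - y)) \<le> norm (g y * Q ?Z (x - y))"
        using Gg[of m] 0 by (intro AE_I2) (auto simp: abs_mult Q0 intro!: mult_right_mono order_trans[OF _ abs_ge_self])
    qed measurable
    from integral_norm_bound_ennreal[OF this]
    have "ennreal \<bar>\<integral>y. F y * Q m (x - y) \<partial>lborel\<bar> \<le> (\<integral>\<^sup>+y. ennreal (norm (G m y * Q ?Z (x - y))) \<partial>lborel)"
      unfolding eq by simp
    also have "\<dots> \<le> (\<integral>\<^sup>+y. ennreal (Q ?Z (x - y)) * ennreal (g y) \<partial>lborel)"
    proof (rule nn_integral_mono)
      fix y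
      have "norm (G m y * Q ?Z (x - y)) \<le> Q ?Z (x - y) * g y"
        using Gg[of m y] 0 Q0[of "x - y"] by (simp add: abs_mult mult.commute[of _ "Q ?Z (x - y)"] mult_left_mono)
      then have "ennreal (norm (G m y * Q ?Z (x - y))) \<le> ennreal (Q ?Z (x - y) * g y)" by (rule ennreal_leI)
      also have "\<dots> = ennreal (Q ?Z (x - y)) * ennreal (g y)" by (rule ennreal_mult'[OF Q0])
      finally show "ennreal (norm (G m y * Q ?Z (x - y))) \<le> ennreal (Q ?Z (x - y)) * ennreal (g y)" .
    qed
    finally show ?case by (simp add: Q_def)
  next
    case (Suc j)
    let ?X = "\<integral>\<^sup>+y. ennreal (Q ?Z (x - y)) * ennreal (g y) \<partial>lborel"
    have "(\<integral>y. F y * dir_deriv b h (Suc j) m (x - y) \<partial>lborel) =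
        (\<integral>y. (\<Sum>i\<in>UNIV. h $ i * (F y * dir_deriv b h j (m(i := Suc (m i))) (x - y))) \<partial>lborel)"
      by (intro Bochner_Integration.integral_cong) (auto simp: sum_distrib_left mult_ac)
    also have "\<dots> = (\<Sum>i\<in>UNIV. h $ i * (\<integral>y. F y * dir_deriv b h j (m(i := Suc (m i))) (x - y) \<partial>lborel))"
      by (subst Bochner_Integration.integral_sum) (auto intro!: integrable_mult_right intD)
    finally have "\<bar>\<integral>y. F y * dir_deriv b h (Suc j) m (x - y) \<partial>lborel\<bar> \<le>
        (\<Sum>i\<in>UNIV. norm h * \<bar>\<integral>y. F y * dir_deriv b h j (m(i := Suc (m i))) (x - y) \<partial>lborel\<bar>)"
      by (simp only:) (rule order_trans[OF sum_abs sum_mono], simp add: abs_mult component_le_norm_cart mult_right_mono)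
    then have "ennreal \<bar>\<integral>y. F y * dir_deriv b h (Suc j) m (x - y) \<partial>lborel\<bar> \<le>
        (\<Sum>i\<in>UNIV. ennreal (norm h) * ennreal \<bar>\<integral>y. F y * dir_deriv b h j (m(i := Suc (m i))) (x - y) \<partial>lborel\<bar>)"
      by (subst ennreal_mult'[symmetric], simp, subst sum_ennreal) (auto intro!: ennreal_leI)
    also have "\<dots> \<le> (\<Sum>i\<in>(UNIV :: 'n set). ennreal (norm h) * (ennreal ((?n * norm h) ^ j) * ?X))"
    proof (intro sum_mono mult_left_mono Suc.IH)
      fix i
      have "(\<Sum>l\<in>UNIV. (m(i := Suc (m i))) l) = Suc (\<Sum>l\<in>UNIV. m l)"
        by (subst (1 2) sum.remove[of UNIV i]) auto
      then show "(\<Sum>l\<in>UNIV. (m(i := Suc (m i))) l) + j = k" using Suc.prems by simp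
    qed auto
    also have "\<dots> = (ennreal ?n * ennreal (norm h) * ennreal ((?n * norm h) ^ j)) * ?X"
      by (simp add: mult.assoc ennreal_of_nat_eq_real_of_nat)
    also have "ennreal ?n * ennreal (norm h) * ennreal ((?n * norm h) ^ j) = ennreal ((?n * norm h) ^ Suc j)"
      by (simp add: ennreal_mult[symmetric])
    finally show ?case .
  qed
  define c where "c = (\<integral>z. Q ?Z z \<partial>lborel)"
  obtain B where B: "\<And>z. \<bar>Q ?Z z\<bar> \<le> B" unfolding Qd using dir_deriv_bounded[OF b supp] by blast
  \<comment> \<open>Integrability of the bump itself: convolution with the constant 1 at the point
    0, followed by a reflection.\<close>
  have "integrable lborel (\<lambda>y. 1 * Q ?Z (0 - y))"
  proof (rule integrable_mult_bounded_support[OF _ _ _ B Qsupp])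
    show "integrable lborel (\<lambda>y. indicator (ball x r) y * (1::real))" for x :: "real ^ 'n" and r
      using emeasure_lborel_ball_finite[of x r] by (simp add: less_top[symmetric])
  qed measurable
  then have iQ: "integrable lborel (Q ?Z)"
    using integrable_lborel_affine[of "\<lambda>y. Q ?Z (0 - y)" "-1" 0] by simp
  have c_nn: "(\<integral>\<^sup>+z. ennreal (Q ?Z z) \<partial>lborel) = ennreal c"
    unfolding c_def by (rule nn_integral_eq_integral[OF iQ]) (simp add: Q0)
  \<comment> \<open>The bump is continuous and positive at 0, hence positive on a small ball; if its
    integral vanished, that ball would be a null set.\<close>
  have c: "0 < c"
  proof (rule ccontr)
    assume "\<not> 0 < c"
    then have "(\<integral>\<^sup>+z. ennreal (Q ?Z z) \<partial>lborel) = 0" by (simp add: c_nn ennreal_neg)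
    then have ae: "AE z in lborel. Q ?Z z \<le> 0"
      by (subst (asm) nn_integral_0_iff_AE) (auto simp: ennreal_eq_0_iff)
    have "open {z. 0 < Q ?Z z}"
      unfolding Qd by (intro open_Collect_less continuous_on_const continuous_dir_deriv b)
    moreover have "0 \<in> {z. 0 < Q ?Z z}"
      using b0 by (auto simp: Q_def prod_fun_def intro!: prod_pos)
    ultimately obtain e where e: "0 < e" "ball 0 e \<subseteq> {z. 0 < Q ?Z z}"
      by (meson openE)
    have "AE z in lborel. z \<notin> ball (0 :: real ^ 'n) e" using ae by eventually_elim (use e in force)
    then have "emeasure lborel (ball (0 :: real ^ 'n) e) = 0"
      by (subst (asm) AE_iff_null_sets[symmetric]) auto
    then show False using emeasure_ball_pos[OF e(1), of "0 :: real ^ 'n"] by simp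
  qed
  define K where "K = (\<lambda>z. Q ?Z z / c)"
  have [measurable]: "K \<in> borel_measurable borel" unfolding K_def by measurable
  have "mollifier d K"
    unfolding mollifier_def
  proof (intro conjI allI impI exI)
    show "0 \<le> K z" for z using Q0[of z] c by (simp add: K_def)
    show "K z = 0" if "d \<le> norm z" for z using Qsupp[OF that] by (simp add: K_def)
    show "K z \<le> B / c" for z using B[of z] c by (simp add: K_def divide_right_mono)
    have "(\<integral>\<^sup>+z. ennreal (K z) \<partial>lborel) = (\<integral>\<^sup>+z. ennreal (Q ?Z z) * ennreal (1 / c) \<partial>lborel)"
      using c Q0 by (intro nn_integral_cong) (simp add: K_def ennreal_mult''[symmetric])
    also have "\<dots> = ennreal c * ennreal (1 / c)"
      by (subst nn_integral_multc) (auto simp: c_nn)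
    also have "\<dots> = 1" using c by (simp add: ennreal_mult''[symmetric])
    finally show "(\<integral>\<^sup>+z. ennreal (K z) \<partial>lborel) = 1" .
  qed measurable
  moreover have "ennreal \<bar>fin_diff k h (\<lambda>x. \<integral>y. F (x - y) * K y \<partial>lborel) x\<bar> \<le>
        ennreal (?n ^ k * norm h ^ k) * (\<integral>\<^sup>+\<sigma>\<in>{0..real k}. (\<integral>\<^sup>+y. ennreal (K y) * ennreal (g (x + \<sigma> *\<^sub>R h - y)) \<partial>lborel) \<partial>lborel)" for x h
  proof -
    \<comment> \<open>The derivatives along \<open>h\<close> fall on the kernel, so \<open>F\<close>
      needs no regularity for the fundamental theorem.\<close>
    define U where "U = (\<lambda>j x. \<integral>y. F y * dir_deriv b h j ?Z (x - y) \<partial>lborel)"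
    have [measurable]: "U j \<in> borel_measurable borel" for j unfolding U_def by measurable
    have U_le: "ennreal \<bar>fin_diff k h (U 0) x\<bar> \<le> (\<integral>\<^sup>+r\<in>{0..real k}. ennreal \<bar>U (0 + k) (x + r *\<^sub>R h)\<bar> \<partial>lborel)"
    proof (rule fin_diff_le_integral)
      fix j x
      obtain B where B: "\<And>z. \<bar>dir_deriv b h j ?Z z\<bar> \<le> B" using dir_deriv_bounded[OF b supp] by blast
      show "integrable lborel (\<lambda>r. indicator {0..1} r * U j (x + r *\<^sub>R h))"
        unfolding U_def by (rule integral_convolution_line(1)[OF F _ intF B dir_deriv_support[of d b, OF supp]]) measurable
      obtain B' where B': "\<And>z. \<bar>dir_deriv b h (Suc j) ?Z z\<bar> \<le> B'" using dir_deriv_bounded[OF b supp] by blast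
      have "U j (x + h) - U j x = (\<integral>y. F y * dir_deriv b h j ?Z (x + h - y) - F y * dir_deriv b h j ?Z (x - y) \<partial>lborel)"
        unfolding U_def by (rule Bochner_Integration.integral_diff[symmetric]) (rule intD)+
      also have "\<dots> = (\<integral>y. F y * (\<integral>r. indicator {0..1} r * dir_deriv b h (Suc j) ?Z (x - y + r *\<^sub>R h) \<partial>lborel) \<partial>lborel)"
      proof (rule Bochner_Integration.integral_cong[OF refl])
        fix y
        have "(\<integral>r. indicator {0..1} r *\<^sub>R dir_deriv b h (Suc j) ?Z (x - y + r *\<^sub>R h) \<partial>lborel)
          = dir_deriv b h j ?Z (x - y + 1 *\<^sub>R h) - dir_deriv b h j ?Z (x - y + 0 *\<^sub>R h)"
        proof (rule integral_FTC_atLeastAtMost)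
          show "((\<lambda>t. dir_deriv b h j ?Z (x - y + t *\<^sub>R h)) has_vector_derivative dir_deriv b h (Suc j) ?Z (x - y + t *\<^sub>R h)) (at t within {0..1})" for t
            using dir_deriv_line[OF b] by (rule has_vector_derivative_at_within)
          show "continuous_on {0..1} (\<lambda>t. dir_deriv b h (Suc j) ?Z (x - y + t *\<^sub>R h))"
            by (intro continuous_on_compose2[OF continuous_dir_deriv[OF b]] continuous_intros) auto
        qed simp
        moreover have "x - y + 1 *\<^sub>R h = x + h - y" "x - y + 0 *\<^sub>R h = x - y" by simp_all
        ultimately show "F y * dir_deriv b h j ?Z (x + h - y) - F y * dir_deriv b h j ?Z (x - y) =
          F y * (\<integral>r. indicator {0..1} r * dir_deriv b h (Suc j) ?Z (x - y + r *\<^sub>R h) \<partial>lborel)"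
          by (simp only: real_scaleR_def right_diff_distrib)
      qed
      also have "\<dots> = (\<integral>r. indicator {0..1} r * U (Suc j) (x + r *\<^sub>R h) \<partial>lborel)"
        unfolding U_def by (rule integral_convolution_line(2)[OF F _ intF B' dir_deriv_support[of d b, OF supp], symmetric]) measurable
      finally show "U j (x + h) - U j x = (\<integral>r. indicator {0..1} r * U (Suc j) (x + r *\<^sub>R h) \<partial>lborel)" .
    qed (use k in auto)
    have conv: "(\<integral>y. F (x - y) * K y \<partial>lborel) = 1 / c * U 0 x" for x
    proof -
      have "(\<integral>y. F (x - y) * K y \<partial>lborel) = (\<integral>y. 1 / c * (F (x - y) * Q ?Z (x - (x - y))) \<partial>lborel)"
        by (intro Bochner_Integration.integral_cong) (auto simp: K_def)
      also have "\<dots> = (\<integral>y. 1 / c * (F y * Q ?Z (x - y)) \<partial>lborel)"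
        by (rule integral_lborel_reflect) measurable
      finally show ?thesis by (simp add: U_def Q_def)
    qed
    have "fin_diff k h (\<lambda>x. \<integral>y. F (x - y) * K y \<partial>lborel) x = 1 / c * fin_diff k h (U 0) x"
      unfolding conv fin_diff_def sum_distrib_left by (intro sum.cong) auto
    then have "ennreal \<bar>fin_diff k h (\<lambda>x. \<integral>y. F (x - y) * K y \<partial>lborel) x\<bar> = ennreal (1 / c) * ennreal \<bar>fin_diff k h (U 0) x\<bar>"
      using c by (simp add: abs_mult ennreal_mult'[symmetric])
    also have "\<dots> \<le> ennreal (1 / c) * (\<integral>\<^sup>+r\<in>{0..real k}. ennreal \<bar>U k (x + r *\<^sub>R h)\<bar> \<partial>lborel)"
      using U_le by (intro mult_left_mono) auto
    also have "\<dots> \<le> ennreal (1 / c) * (\<integral>\<^sup>+r\<in>{0..real k}. ennreal ((?n * norm h) ^ k) *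
         (\<integral>\<^sup>+y. ennreal (Q ?Z (x + r *\<^sub>R h - y)) * ennreal (g y) \<partial>lborel) \<partial>lborel)"
      unfolding U_def by (intro mult_left_mono nn_integral_mono mult_right_mono bound) auto
    also have "\<dots> = (\<integral>\<^sup>+r. ennreal (?n ^ k * norm h ^ k) * ((\<integral>\<^sup>+y. ennreal (K y) * ennreal (g (x + r *\<^sub>R h - y)) \<partial>lborel) * indicator {0..real k} r) \<partial>lborel)"
    proof (subst nn_integral_cmult[symmetric], measurable, intro nn_integral_cong)
      fix r :: real
      let ?y = "x + r *\<^sub>R h"
      have "(\<integral>\<^sup>+y. ennreal (Q ?Z (?y - y)) * ennreal (g y) \<partial>lborel) = (\<integral>\<^sup>+y. ennreal (Q ?Z (?y - (?y - y))) * ennreal (g (?y - y)) \<partial>lborel)"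
        by (rule nn_integral_lborel_reflect[symmetric]) measurable
      also have "\<dots> = (\<integral>\<^sup>+y. ennreal c * (ennreal (K y) * ennreal (g (?y - y))) \<partial>lborel)"
        using c by (intro nn_integral_cong) (simp add: K_def mult.assoc[symmetric] ennreal_mult'[symmetric])
      also have "\<dots> = ennreal c * (\<integral>\<^sup>+y. ennreal (K y) * ennreal (g (?y - y)) \<partial>lborel)"
        by (rule nn_integral_cmult) measurable
      finally have "(\<integral>\<^sup>+y. ennreal (Q ?Z (?y - y)) * ennreal (g y) \<partial>lborel) = ennreal c * (\<integral>\<^sup>+y. ennreal (K y) * ennreal (g (?y - y)) \<partial>lborel)" .
      note eq = this
      have one: "ennreal (1 / c) * ennreal c = 1" using c by (simp add: ennreal_mult'[symmetric])
      let ?X = "\<integral>\<^sup>+y. ennreal (K y) * ennreal (g (?y - y)) \<partial>lborel"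
      have "ennreal (1 / c) * (ennreal ((?n * norm h) ^ k) * (ennreal c * ?X) * indicator {0..real k} r)
        = (ennreal (1 / c) * ennreal c) * (ennreal ((?n * norm h) ^ k) * (?X * indicator {0..real k} r))"
        by (simp only: mult_ac)
      then show "ennreal (1 / c) * (ennreal ((?n * norm h) ^ k) * (\<integral>\<^sup>+y. ennreal (Q ?Z (?y - y)) * ennreal (g y) \<partial>lborel) * indicator {0..real k} r)
        = ennreal (?n ^ k * norm h ^ k) * (?X * indicator {0..real k} r)"
        unfolding eq one by (simp only: power_mult_distrib mult_1_left)
    qed
    also have "\<dots> = ennreal (?n ^ k * norm h ^ k) * (\<integral>\<^sup>+\<sigma>\<in>{0..real k}. (\<integral>\<^sup>+y. ennreal (K y) * ennreal (g (x + \<sigma> *\<^sub>R h - y)) \<partial>lborel) \<partial>lborel)"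
      by (rule nn_integral_cmult) measurable
    finally show ?thesis .
  qed
  ultimately show ?thesis by blast
qed

subsection \<open>The estimate for Sobolev functions\<close>

lemma borel_measurable_iter_partial_deriv:
  assumes "\<phi> \<in> test_functions"
  shows "iter_partial_deriv is \<phi> \<in> borel_measurable borel"
  using assms
  by (intro borel_measurable_continuous_onI continuous_at_imp_continuous_on ballI differentiable_imp_continuous_within)
    (auto simp: test_functions_def)

lemma integrable_ball_of_L1_loc:
  assumes f: "f \<in> L1_loc" and F [measurable]: "F \<in> borel_measurable borel" and ae: "AE x in lborel. f x = F x"
  shows "integrable lborel (\<lambda>y. indicator (ball x r) y * F y)"
proof -
  have [measurable]: "ball x r \<in> sets borel" by simp
  have [measurable]: "f \<in> borel_measurable lebesgue" using f by (simp add: L1_loc_def)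
  have "set_integrable lebesgue (cball x r) f" using f by (simp add: L1_loc_def)
  then have "set_integrable lebesgue (ball x r) f"
    by (rule set_integrable_subset) auto
  then have "integrable lebesgue (\<lambda>y. indicator (ball x r) y * f y)"
    by (simp add: set_integrable_def)
  then have "integrable lebesgue (\<lambda>y. indicator (ball x r) y * F y)"
  proof (rule integrable_cong_AE_imp)
    show "(\<lambda>y. indicator (ball x r) y * F y) \<in> borel_measurable lebesgue"
      by (rule measurable_completion) measurable
    show "AE y in lebesgue. indicator (ball x r) y * f y = indicator (ball x r) y * F y"
      using AE_completion[OF ae] by eventually_elim simp
  qed
  then show ?thesis by (subst (asm) integrable_completion) measurable
qed

lemma integral_lebesgue_cong_borel:
  fixes f F :: "'a::euclidean_space \<Rightarrow> real"
  assumes f [measurable]: "f \<in> borel_measurable lebesgue" and F [measurable]: "F \<in> borel_measurable borel"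
    and ae: "AE x in lborel. f x = F x" and \<phi> [measurable]: "\<phi> \<in> borel_measurable borel"
  shows "(\<integral>x. f x * \<phi> x \<partial>lebesgue) = (\<integral>x. F x * \<phi> x \<partial>lborel)"
proof -
  have m: "F \<in> borel_measurable lebesgue" "\<phi> \<in> borel_measurable lebesgue"
    by (auto intro: measurable_completion)
  have "(\<integral>x. f x * \<phi> x \<partial>lebesgue) = (\<integral>x. F x * \<phi> x \<partial>lebesgue)"
  proof (rule integral_cong_AE)
    show "AE x in lebesgue. f x * \<phi> x = F x * \<phi> x"
      using AE_completion[OF ae] by eventually_elim simp
  qed (use f m in \<open>auto intro: borel_measurable_times\<close>)
  also have "\<dots> = (\<integral>x. F x * \<phi> x \<partial>lborel)"
    by (rule integral_completion) measurable
  finally show ?thesis .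
qed

text \<open>The ball lies in the concentric cube of side \<open>2 * r\<close>, whose volume supplies
  the factor \<open>2 ^ n\<close>. Strictness in the hypothesis yields a constant \<open>c\<close>
  that undercuts the bound.\<close>

lemma bmo_norm_ball:
  fixes f :: "real ^ 'n \<Rightarrow> real"
  assumes "bmo_norm f < ennreal b" and r: "0 < r"
  shows "\<exists>c. (\<integral>\<^sup>+y\<in>ball x r. ennreal \<bar>f y - c\<bar> \<partial>lebesgue) \<le> ennreal (2 ^ CARD('n) * b * r ^ CARD('n))"
proof -
  let ?a = "x - (\<chi> i. r)"
  let ?Q = "cbox ?a (?a + (\<chi> i. 2 * r))"
  have "?Q \<in> cubes" unfolding cubes_def using r by (intro CollectI exI[of _ ?a] exI[of _ "2 * r"]) auto
  then have "(INF c. (\<integral>\<^sup>+y\<in>?Q. ennreal \<bar>f y - c\<bar> \<partial>lebesgue) / emeasure lebesgue ?Q) \<le> bmo_norm f"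
    unfolding bmo_norm_def by (rule SUP_upper)
  then have "(INF c. (\<integral>\<^sup>+y\<in>?Q. ennreal \<bar>f y - c\<bar> \<partial>lebesgue) / emeasure lebesgue ?Q) < ennreal b"
    using assms(1) by (rule le_less_trans)
  then obtain c where c: "(\<integral>\<^sup>+y\<in>?Q. ennreal \<bar>f y - c\<bar> \<partial>lebesgue) / emeasure lebesgue ?Q < ennreal b"
    by (auto simp: INF_less_iff)
  have b: "0 \<le> b" using c by (cases "0 \<le> b") (auto simp: ennreal_neg)
  have ne: "?Q \<noteq> {}" using r by (auto simp: interval_ne_empty_cart)
  have "measure lborel ?Q = (2 * r) ^ CARD('n)"
    by (subst content_cbox_cart[OF ne]) simp
  then have Q: "emeasure lebesgue ?Q = ennreal ((2 * r) ^ CARD('n))"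
    using emeasure_lborel_cbox_finite[of ?a "?a + (\<chi> i. 2 * r)"] by (simp add: emeasure_eq_ennreal_measure)
  let ?I = "\<integral>\<^sup>+y\<in>?Q. ennreal \<bar>f y - c\<bar> \<partial>lebesgue"
  have "(\<integral>\<^sup>+y\<in>ball x r. ennreal \<bar>f y - c\<bar> \<partial>lebesgue) \<le> ?I"
  proof (rule nn_integral_mono)
    fix y
    have "y \<in> ?Q" if "y \<in> ball x r"
    proof -
      have "\<bar>(x - y) $ i\<bar> < r" for i
        using component_le_norm_cart[of "x - y" i] that by (simp add: dist_norm)
      then have "x $ i - r \<le> y $ i \<and> y $ i \<le> x $ i + r" for i
        by (auto simp: abs_less_iff less_imp_le algebra_simps dest!: meta_spec[of _ i])
      then show ?thesis by (simp add: mem_box_cart algebra_simps)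
    qed
    then show "ennreal \<bar>f y - c\<bar> * indicator (ball x r) y \<le> ennreal \<bar>f y - c\<bar> * indicator ?Q y"
      by (auto simp: indicator_def)
  qed
  also have "?I = ?I / emeasure lebesgue ?Q * emeasure lebesgue ?Q"
    unfolding Q using r by (simp add: ennreal_divide_times mult_divide_eq_ennreal)
  also have "\<dots> \<le> ennreal b * emeasure lebesgue ?Q"
    using c by (intro mult_right_mono) auto
  also have "\<dots> = ennreal (2 ^ CARD('n) * b * r ^ CARD('n))"
    unfolding Q using b r by (subst ennreal_mult[symmetric]) (auto simp: power_mult_distrib mult_ac)
  finally show ?thesis by blast
qed

text \<open>For \<open>j \<ge> 1\<close> the sample point moves with \<open>h\<close>, and null sets
  pull back to null sets. For \<open>j = 0\<close> it is \<open>x\<close> itself, hence the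
  exclusion of a null set of \<open>x\<close>.\<close>

lemma AE_fin_diff_cong:
  fixes f F :: "'a::euclidean_space \<Rightarrow> real"
  assumes ae: "AE x in lborel. f x = F x"
  shows "AE x in lborel. AE h in lborel. fin_diff k h f x = fin_diff k h F x"
  using ae
proof eventually_elim
  case (elim x)
  have "AE h in lborel. \<forall>j\<in>{0..k}. f (x + real j *\<^sub>R h) = F (x + real j *\<^sub>R h)"
  proof (subst AE_finite_all, simp, intro ballI)
    fix j
    show "AE h in lborel. f (x + real j *\<^sub>R h) = F (x + real j *\<^sub>R h)"
    proof (cases "j = 0")
      case True
      then show ?thesis using elim by simp
    next
      case False
      then show ?thesis by (intro AE_lborel_affine[OF ae]) simp
    qed
  qed
  then show ?case by eventually_elim (simp add: fin_diff_def)
qed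

text \<open>Translation of the Borel estimate to the given definitions, with \<open>b\<close>
  strictly above the BMO norm in place of the norm. The finiteness of the gradient integral is
  recorded as well, since the passage to the limit in \<open>b\<close> treats that integral as a
  real number.\<close>

lemma sobolev_bmo_estimate:
  fixes f :: "real ^ 'n \<Rightarrow> real" and k :: nat and p s b :: real
  assumes k: "1 \<le> k" and p: "1 < p" and s: "1 / p < s" "s < 1"
    and f: "f \<in> hom_sobolev k (s * p)" and b: "0 < b" "bmo_norm f < ennreal b"
  shows "(\<integral>\<^sup>+x. ennreal (norm_grad k f x powr (s * p)) \<partial>lebesgue) < \<infinity>"
    and "(\<integral>\<^sup>+x. \<integral>\<^sup>+h. ennreal (\<bar>fin_diff k h f x\<bar> powr p /
          norm h powr (real CARD('n) + s * real k * p)) \<partial>lebesgue \<partial>lebesgue)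
      \<le> ennreal (interp_const CARD('n) k p (real CARD('n) ^ k) (measure lborel (ball (0 :: real ^ 'n) 1)) /
          ((1 - s) * (s * p - 1)) * (2 ^ CARD('n) * b) powr ((1 - s) * p)) *
        (\<integral>\<^sup>+x. ennreal (norm_grad k f x powr (s * p)) \<partial>lebesgue)"
proof -
  let ?I = "\<integral>\<^sup>+x. ennreal (norm_grad k f x powr (s * p)) \<partial>lebesgue"
  have sp: "1 < s * p" using s p by (simp add: field_simps)
  let ?MI = "multi_indices k :: ('n \<Rightarrow> nat) set"
  have fL: "f \<in> L1_loc" using f by (simp add: hom_sobolev_def)
  then have fm: "f \<in> borel_measurable lebesgue" by (simp add: L1_loc_def)
  have wd: "has_weak_deriv \<alpha> f (weak_deriv \<alpha> f)" "weak_deriv \<alpha> f \<in> Lp (s * p)" if "\<alpha> \<in> ?MI" for \<alpha>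
  proof -
    have ex: "\<exists>g. has_weak_deriv \<alpha> f g" and Lp: "weak_deriv \<alpha> f \<in> Lp (s * p)"
      using f that by (auto simp: hom_sobolev_def)
    from ex show "has_weak_deriv \<alpha> f (weak_deriv \<alpha> f)"
      unfolding weak_deriv_def by (rule someI_ex)
    show "weak_deriv \<alpha> f \<in> Lp (s * p)" by (rule Lp)
  qed
  obtain F where F [measurable]: "F \<in> borel_measurable borel" and fF: "AE x in lborel. f x = F x"
    using completion_ex_borel_measurable_real[OF fm] by auto
  \<comment> \<open>Borel representatives of all weak derivatives of order \<open>k\<close> at once;
    for other multi-indices the zero function makes the family measurable throughout.\<close>
  have "\<exists>G. \<forall>\<alpha>. G \<alpha> \<in> borel_measurable borel \<and> (\<alpha> \<in> ?MI \<longrightarrow> (AE x in lborel. weak_deriv \<alpha> f x = G \<alpha> x))"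
  proof (rule choice, intro allI)
    fix \<alpha>
    show "\<exists>G. G \<in> borel_measurable borel \<and> (\<alpha> \<in> ?MI \<longrightarrow> (AE x in lborel. weak_deriv \<alpha> f x = G x))"
    proof (cases "\<alpha> \<in> ?MI")
      case True
      then have "weak_deriv \<alpha> f \<in> borel_measurable lebesgue" using wd(2) by (simp add: Lp_def)
      from completion_ex_borel_measurable_real[OF this] show ?thesis by auto
    qed (auto intro: exI[of _ "\<lambda>_. 0"])
  qed
  then obtain G where G [measurable]: "\<And>\<alpha>. G \<alpha> \<in> borel_measurable borel"
    and GW: "\<And>\<alpha>. \<alpha> \<in> ?MI \<Longrightarrow> AE x in lborel. weak_deriv \<alpha> f x = G \<alpha> x"
    by blast
  define g where "g x = sqrt (\<Sum>\<alpha>\<in>?MI. (G \<alpha> x)\<^sup>2)" for x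
  have g [measurable]: "g \<in> borel_measurable borel" unfolding g_def[abs_def] by measurable
  have g0: "0 \<le> g x" for x by (simp add: g_def sum_nonneg)
  have Gg: "\<bar>G \<alpha> x\<bar> \<le> g x" if "\<alpha> \<in> ?MI" for \<alpha> x
  proof -
    have "(G \<alpha> x)\<^sup>2 \<le> (\<Sum>\<alpha>\<in>?MI. (G \<alpha> x)\<^sup>2)"
      by (rule member_le_sum[where f="\<lambda>\<alpha>. (G \<alpha> x)\<^sup>2"]) (use that finite_multi_indices in auto)
    then show ?thesis unfolding g_def by (intro real_le_rsqrt) simp
  qed
  \<comment> \<open>Local integrability and the \<open>s p\<close>-th power integrability of
    \<open>g\<close> are inherited from the single derivatives through this comparison of the
    Euclidean norm with the sum.\<close>
  have gG: "g x \<le> (\<Sum>\<alpha>\<in>?MI. \<bar>G \<alpha> x\<bar>)" for x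
    unfolding g_def using L2_set_le_sum_abs[of "\<lambda>\<alpha>. G \<alpha> x" ?MI] by (simp add: L2_set_def)
  have gn: "AE x in lborel. norm_grad k f x = g x"
  proof -
    have "AE x in lborel. \<forall>\<alpha>\<in>?MI. weak_deriv \<alpha> f x = G \<alpha> x"
      using GW by (subst AE_finite_all) (auto simp: finite_multi_indices)
    then show ?thesis by eventually_elim (simp add: norm_grad_def g_def)
  qed
  have intF: "integrable lborel (\<lambda>y. indicator (ball x r) y * F y)" for x r
    by (rule integrable_ball_of_L1_loc[OF fL F fF])
  have intG: "integrable lborel (\<lambda>y. indicator (ball x r) y * G \<alpha> y)" if "\<alpha> \<in> ?MI" for \<alpha> x r
    using wd(1)[OF that] by (intro integrable_ball_of_L1_loc[OF _ G GW[OF that]]) (simp add: has_weak_deriv_def)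
  have intg: "integrable lborel (\<lambda>y. indicator (ball x r) y * g y)" for x r
  proof (rule Bochner_Integration.integrable_bound)
    show "integrable lborel (\<lambda>y. \<Sum>\<alpha>\<in>?MI. \<bar>indicator (ball x r) y * G \<alpha> y\<bar>)"
      by (intro Bochner_Integration.integrable_sum integrable_abs intG)
    have [measurable]: "ball x r \<in> sets borel" by simp
    show "(\<lambda>y. indicator (ball x r) y * g y) \<in> borel_measurable lborel" by measurable
    show "AE y in lborel. norm (indicator (ball x r) y * g y) \<le> norm (\<Sum>\<alpha>\<in>?MI. \<bar>indicator (ball x r) y * G \<alpha> y\<bar>)"
      using gG g0 by (intro AE_I2) (auto simp: indicator_def intro: order_trans[OF _ abs_ge_self])
  qed
  have I_eq: "?I = (\<integral>\<^sup>+x. ennreal (g x powr (s * p)) \<partial>lborel)"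
    unfolding nn_integral_completion using gn by (intro nn_integral_cong_AE) (auto elim!: eventually_mono)
  have fin: "(\<integral>\<^sup>+x. ennreal (g x powr (s * p)) \<partial>lborel) < \<infinity>"
  proof -
    let ?q = "s * p"
    have Gfin: "(\<integral>\<^sup>+x. ennreal (\<bar>G \<alpha> x\<bar> powr ?q) \<partial>lborel) < \<infinity>" if "\<alpha> \<in> ?MI" for \<alpha>
    proof -
      have "integrable lebesgue (\<lambda>x. \<bar>weak_deriv \<alpha> f x\<bar> powr ?q)"
        using wd(2)[OF that] by (simp add: Lp_def)
      then have "(\<integral>\<^sup>+x. ennreal (norm (\<bar>weak_deriv \<alpha> f x\<bar> powr ?q)) \<partial>lebesgue) < \<infinity>"
        unfolding integrable_iff_bounded by blast
      also have "(\<integral>\<^sup>+x. ennreal (norm (\<bar>weak_deriv \<alpha> f x\<bar> powr ?q)) \<partial>lebesgue) = (\<integral>\<^sup>+x. ennreal (\<bar>G \<alpha> x\<bar> powr ?q) \<partial>lborel)"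
        unfolding nn_integral_completion using GW[OF that] by (intro nn_integral_cong_AE) (auto elim!: eventually_mono)
      finally show ?thesis .
    qed
    have "(\<integral>\<^sup>+x. ennreal (g x powr ?q) \<partial>lborel) \<le>
      (\<integral>\<^sup>+x. ennreal (real (card ?MI) powr ?q) * (\<Sum>\<alpha>\<in>?MI. ennreal (\<bar>G \<alpha> x\<bar> powr ?q)) \<partial>lborel)"
    proof (rule nn_integral_mono)
      fix x
      have "g x powr ?q \<le> (\<Sum>\<alpha>\<in>?MI. \<bar>G \<alpha> x\<bar>) powr ?q"
        using gG g0 sp by (intro powr_mono2) auto
      also have "\<dots> \<le> real (card ?MI) powr ?q * (\<Sum>\<alpha>\<in>?MI. \<bar>G \<alpha> x\<bar> powr ?q)"
        using sp by (intro powr_sum_le) (auto simp: finite_multi_indices)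
      finally have "ennreal (g x powr ?q) \<le> ennreal (real (card ?MI) powr ?q * (\<Sum>\<alpha>\<in>?MI. \<bar>G \<alpha> x\<bar> powr ?q))"
        by (rule ennreal_leI)
      also have "\<dots> = ennreal (real (card ?MI) powr ?q) * (\<Sum>\<alpha>\<in>?MI. ennreal (\<bar>G \<alpha> x\<bar> powr ?q))"
        by (simp add: ennreal_mult' sum_ennreal)
      finally show "ennreal (g x powr ?q) \<le> ennreal (real (card ?MI) powr ?q) * (\<Sum>\<alpha>\<in>?MI. ennreal (\<bar>G \<alpha> x\<bar> powr ?q))" .
    qed
    also have "\<dots> = ennreal (real (card ?MI) powr ?q) * (\<Sum>\<alpha>\<in>?MI. \<integral>\<^sup>+x. ennreal (\<bar>G \<alpha> x\<bar> powr ?q) \<partial>lborel)"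
      by (simp add: nn_integral_cmult nn_integral_sum del: sum_ennreal)
    also have "\<dots> < \<infinity>"
      using Gfin by (auto simp: ennreal_mult_less_top finite_multi_indices ennreal_sum_less_top)
    finally show ?thesis .
  qed
  then show "?I < \<infinity>" using I_eq by simp
  have weak: "(\<integral>x. F x * iter_partial_deriv is \<phi> x \<partial>lborel) = (-1) ^ k * (\<integral>x. G m x * \<phi> x \<partial>lborel)"
    if "(\<Sum>i\<in>UNIV. m i) = k" "\<phi> \<in> test_functions" "\<forall>i. count_list is i = m i" for m \<phi> "is"
  proof -
    have m: "m \<in> ?MI" using that(1) by (simp add: multi_indices_def)
    have \<phi>: "\<phi> \<in> borel_measurable borel" using borel_measurable_iter_partial_deriv[OF that(2), of "[]"] by simp
    have "(\<integral>x. F x * iter_partial_deriv is \<phi> x \<partial>lborel) = (\<integral>x. f x * iter_partial_deriv is \<phi> x \<partial>lebesgue)"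
      by (rule integral_lebesgue_cong_borel[OF fm F fF borel_measurable_iter_partial_deriv[OF that(2)], symmetric])
    also have "\<dots> = (-1) ^ k * (\<integral>x. weak_deriv m f x * \<phi> x \<partial>lebesgue)"
      using wd(1)[OF m] that by (simp add: has_weak_deriv_def)
    also have "(\<integral>x. weak_deriv m f x * \<phi> x \<partial>lebesgue) = (\<integral>x. G m x * \<phi> x \<partial>lborel)"
      using wd(2)[OF m] by (intro integral_lebesgue_cong_borel G GW m \<phi>) (simp add: Lp_def)
    finally show ?thesis .
  qed
  let ?D = "real CARD('n) ^ k" and ?\<omega> = "measure lborel (ball (0 :: real ^ 'n) 1)" and ?N = "2 ^ CARD('n) * b"
  have "AE z in lborel \<Otimes>\<^sub>M lborel. ennreal \<bar>fin_diff k (snd z) F (fst z)\<bar> \<le>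
    ennreal (?D * norm (snd z) ^ k) * (\<integral>\<^sup>+\<sigma>\<in>{0..real k}. ennreal (g (fst z + \<sigma> *\<^sub>R snd z)) \<partial>lborel)"
  proof (rule AE_fin_diff_le[OF F g g0 _ intF intg])
    fix d :: real assume "0 < d"
    show "\<exists>K. mollifier d K \<and>
      (\<forall>x h. ennreal \<bar>fin_diff k h (\<lambda>x. \<integral>y. F (x - y) * K y \<partial>lborel) x\<bar> \<le>
        ennreal (?D * norm h ^ k) * (\<integral>\<^sup>+\<sigma>\<in>{0..real k}. (\<integral>\<^sup>+y. ennreal (K y) * ennreal (g (x + \<sigma> *\<^sub>R h - y)) \<partial>lborel) \<partial>lborel))"
      using \<open>0 < d\<close> k
      by (intro weak_deriv_approx[where G=G] F g G intF intg weak Gg) (auto simp: multi_indices_def)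
  qed simp
  moreover have "\<exists>c. (\<integral>\<^sup>+y\<in>ball x r. ennreal \<bar>F y - c\<bar> \<partial>lborel) \<le> ennreal (?N * r ^ DIM(real ^ 'n))" if r: "0 < r" for x r
  proof -
    obtain c where c: "(\<integral>\<^sup>+y\<in>ball x r. ennreal \<bar>f y - c\<bar> \<partial>lebesgue) \<le> ennreal (?N * r ^ CARD('n))"
      using bmo_norm_ball[OF b(2) r, of x] by blast
    have "(\<integral>\<^sup>+y\<in>ball x r. ennreal \<bar>f y - c\<bar> \<partial>lebesgue) = (\<integral>\<^sup>+y\<in>ball x r. ennreal \<bar>F y - c\<bar> \<partial>lborel)"
      unfolding nn_integral_completion using fF by (intro nn_integral_cong_AE) (auto elim!: eventually_mono)
    then show ?thesis using c by auto
  qed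
  ultimately interpret diff_controlled F ?\<omega> ?N g k ?D
    using k b(1) by unfold_locales (auto intro: intF g0)
  have "(\<integral>\<^sup>+x. \<integral>\<^sup>+h. ennreal (\<bar>fin_diff k h f x\<bar> powr p / norm h powr (real CARD('n) + s * real k * p)) \<partial>lebesgue \<partial>lebesgue)
    = (\<integral>\<^sup>+x. \<integral>\<^sup>+h. ennreal (\<bar>fin_diff k h F x\<bar> powr p / norm h powr (real DIM(real ^ 'n) + s * real k * p)) \<partial>lborel \<partial>lborel)"
    unfolding nn_integral_completion
  proof (rule nn_integral_cong_AE, use AE_fin_diff_cong[OF fF, of k] in eventually_elim)
    fix x assume "AE h in lborel. fin_diff k h f x = fin_diff k h F x"
    then show "(\<integral>\<^sup>+h. ennreal (\<bar>fin_diff k h f x\<bar> powr p / norm h powr (real CARD('n) + s * real k * p)) \<partial>lborel) =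
      (\<integral>\<^sup>+h. ennreal (\<bar>fin_diff k h F x\<bar> powr p / norm h powr (real DIM(real ^ 'n) + s * real k * p)) \<partial>lborel)"
      by (intro nn_integral_cong_AE) (auto elim!: eventually_mono)
  qed
  also have "\<dots> \<le> ennreal (interp_const DIM(real ^ 'n) k p ?D ?\<omega> / ((1 - s) * (s * p - 1)) * ?N powr ((1 - s) * p)) *
      (\<integral>\<^sup>+x. ennreal (g x powr (s * p)) \<partial>lborel)"
    by (rule nn_integral_fin_diff_le[OF p s fin])
  finally show "(\<integral>\<^sup>+x. \<integral>\<^sup>+h. ennreal (\<bar>fin_diff k h f x\<bar> powr p /
          norm h powr (real CARD('n) + s * real k * p)) \<partial>lebesgue \<partial>lebesgue)
      \<le> ennreal (interp_const CARD('n) k p ?D ?\<omega> / ((1 - s) * (s * p - 1)) * ?N powr ((1 - s) * p)) * ?I"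
    unfolding I_eq by simp
qed

lemma interp_const_nonneg: "0 \<le> D \<Longrightarrow> 0 \<le> \<omega> \<Longrightarrow> 0 \<le> p \<Longrightarrow> 0 \<le> interp_const n k p D \<omega>"
  by (simp add: interp_const_def)

text \<open>The estimate is applied with \<open>b\<close> equal to the BMO norm plus
  \<open>1 / (n + 1)\<close>, and \<open>n\<close> tends to infinity. This also settles functions of
  BMO norm 0.\<close>

theorem theorem6p7:
  fixes k :: nat and p :: real
  assumes "k \<ge> 1" and "1 < p"
  shows "\<exists>C>0. \<forall>s. 1 / p < s \<and> s < 1 \<longrightarrow>
    (\<forall>f :: real ^ 'n \<Rightarrow> real. f \<in> BMO \<inter> hom_sobolev k (s * p) \<longrightarrow>
      (\<integral>\<^sup>+x. \<integral>\<^sup>+h. ennreal (\<bar>fin_diff k h f x\<bar> powr p /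
          norm h powr (real CARD('n) + s * real k * p)) \<partial>lebesgue \<partial>lebesgue)
      \<le> ennreal (C / ((1 - s) * (s * p - 1)) * enn2real (bmo_norm f) powr ((1 - s) * p)) *
        (\<integral>\<^sup>+x. ennreal (norm_grad k f x powr (s * p)) \<partial>lebesgue))"
proof -
  define A where "A = interp_const CARD('n) k p (real CARD('n) ^ k) (measure lborel (ball (0 :: real ^ 'n) 1))"
  have A: "0 \<le> A" using assms unfolding A_def by (intro interp_const_nonneg) auto
  \<comment> \<open>The exponent \<open>(1 - s) * p\<close> of \<open>2 ^ n\<close> is at most
    \<open>p\<close>, which removes \<open>s\<close> from the constant; the \<open>+ 1\<close> makes
    \<open>C\<close> positive.\<close>
  define C where "C = A * (2 ^ CARD('n)) powr p + 1"
  have C: "0 < C" using A by (simp add: C_def add_nonneg_pos)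
  show ?thesis
  proof (intro exI[of _ C] conjI C allI impI, elim conjE)
    fix s :: real and f :: "real ^ 'n \<Rightarrow> real"
    assume s: "1 / p < s" "s < 1" and f: "f \<in> BMO \<inter> hom_sobolev k (s * p)"
    have sp: "1 < s * p" using s assms by (simp add: field_simps)
    let ?L = "\<integral>\<^sup>+x. \<integral>\<^sup>+h. ennreal (\<bar>fin_diff k h f x\<bar> powr p / norm h powr (real CARD('n) + s * real k * p)) \<partial>lebesgue \<partial>lebesgue"
    let ?I = "\<integral>\<^sup>+x. ennreal (norm_grad k f x powr (s * p)) \<partial>lebesgue"
    let ?c = "(1 - s) * (s * p - 1)" and ?e = "(1 - s) * p"
    let ?B = "enn2real (bmo_norm f)"
    have c: "0 < ?c" and e: "0 < ?e" "?e \<le> p" using s sp assms(2)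
      by (auto simp: mult_le_cancel_right2) (smt (verit) divide_pos_pos)
    have bmo: "bmo_norm f = ennreal ?B" using f by (simp add: BMO_def less_top)
    have lt: "bmo_norm f < ennreal (?B + 1 / real (Suc n))" for n
      by (subst bmo) (simp add: ennreal_less_iff)
    note est = sobolev_bmo_estimate[OF assms s, of f]
    have fin: "?I < \<infinity>" using est(1)[of "?B + 1 / real (Suc 0)"] f lt[of 0] by (auto simp: add_nonneg_pos)
    then obtain I where I: "?I = ennreal I" "0 \<le> I" by (cases ?I) auto
    have le: "?L \<le> ennreal (C / ?c * (?B + 1 / real (Suc n)) powr ?e * I)" for n
    proof -
      let ?b = "?B + 1 / real (Suc n)"
      have b: "0 < ?b" by (simp add: add_nonneg_pos)
      have "?L \<le> ennreal (A / ?c * (2 ^ CARD('n) * ?b) powr ?e) * ?I"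
        unfolding A_def using f b lt[of n] by (intro est(2)) auto
      also have "\<dots> \<le> ennreal (C / ?c * ?b powr ?e) * ?I"
      proof (intro mult_right_mono ennreal_leI)
        have "A / ?c * (2 ^ CARD('n) * ?b) powr ?e = A * (2 ^ CARD('n)) powr ?e / ?c * ?b powr ?e"
          by (simp add: powr_mult)
        also have "\<dots> \<le> C / ?c * ?b powr ?e"
        proof (intro mult_right_mono divide_right_mono)
          have "A * (2 ^ CARD('n)) powr ?e \<le> A * (2 ^ CARD('n)) powr p"
            using A e by (intro mult_left_mono powr_mono) auto
          then show "A * (2 ^ CARD('n)) powr ?e \<le> C" by (simp add: C_def)
        qed (use c in auto)
        finally show "A / ?c * (2 ^ CARD('n) * ?b) powr ?e \<le> C / ?c * ?b powr ?e" .
      qed simp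
      also have "\<dots> = ennreal (C / ?c * ?b powr ?e * I)"
        unfolding I(1) using I(2) C c by (subst ennreal_mult[symmetric]) auto
      finally show ?thesis .
    qed
    \<comment> \<open>The power is continuous along this sequence even for norm 0, because the
      exponent \<open>(1 - s) * p\<close> is positive.\<close>
    have "(\<lambda>n. ?B + 1 / real (Suc n)) \<longlonglongrightarrow> ?B + 0"
      by (intro tendsto_intros LIMSEQ_inverse_real_of_nat[unfolded inverse_eq_divide])
    then have "(\<lambda>n. (?B + 1 / real (Suc n)) powr ?e) \<longlonglongrightarrow> (?B + 0) powr ?e"
      by (rule tendsto_powr2) (use e in \<open>auto intro!: always_eventually add_nonneg_nonneg\<close>)
    then have "(\<lambda>n. ennreal (C / ?c * (?B + 1 / real (Suc n)) powr ?e * I)) \<longlonglongrightarrow> ennreal (C / ?c * (?B + 0) powr ?e * I)"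
      by (intro tendsto_ennrealI tendsto_mult tendsto_const)
    then have "?L \<le> ennreal (C / ?c * (?B + 0) powr ?e * I)"
      by (rule LIMSEQ_le_const) (use le in blast)
    also have "\<dots> = ennreal (C / ?c * ?B powr ?e) * ?I"
      unfolding I(1) using I(2) C c by (subst ennreal_mult[symmetric]) auto
    finally show "?L \<le> ennreal (C / ?c * ?B powr ?e) * ?I" .
  qed
qed

end
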